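(* Suppose $n\delta_n\to0$ as $n\to+\infty$. For $\theta\in\Theta$ let $a(\theta)=\psi(\theta)$ and $b(\theta)=\psi(\theta)+r$. Then, for all $\theta_0\in\Theta$, \[ \lim_{\epsilon\to0}\ \liminf_{n\to+\infty}\ \inf_{\bar\theta_n}\ \sup_{|\theta-\theta_0|<\epsilon}n^2\,\mathbf{E}_\theta\bigl(\bar\theta_n-\theta\bigr)^2\ \geq\ \mathbf{E}\,\zeta_{a(\theta_0),b(\theta_0)}^2, \] where the infimum is taken over all possible estimators $\bar\theta_n$ of the parameter $\theta$ (measurable functions of the observations $X^{(n)}$).
   Context: Let $0<\alpha<\beta<\tau$ be known constants, $\psi$ a known strictly positive continuous function on $[0,\tau]$, $r>-\min_{0\le t\le\tau}\psi(t)$ a known constant with $r\neq0$, and $(\delta_n)$ a known sequence of positive numbers decreasing to $0$. The unknown parameter is $\theta\in\Theta=(\alpha,\beta)$. For each $n\ge1$ one observes $X^{(n)}=(X_1,\ldots,X_n)$, where $X_j=(X_j(t),\ 0\le t\le\tau)$, $j=1,\ldots,n$, are independent inhomogeneous Poisson processes on $[0,\tau]$ with common intensity function \[ \lambda_\theta^{(n)}(t)=\psi(t)+\frac{r}{\delta_n}(t-\theta)\,\mathbb{1}_{[\theta,\theta+\delta_n)}(t)+r\,\mathbb{1}_{[\theta+\delta_n,\tau]}(t),\qquad 0\le t\le\tau. \] $\mathbf{P}_\theta=\mathbf{P}_\theta^{(n)}$ denotes the law of $X^{(n)}$ and $\mathbf{E}_\theta$ the corresponding expectation. For constants $a,b>0$,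 let $Y^+$ and $Y^-$ be independent Poisson processes on $\mathbb{R}_+$ of constant intensities $b$ and $a$ respectively, and let \[ Z^\star_{a,b}(u)=\begin{cases}\exp\bigl\{\ln\bigl(\frac ab\bigr)Y^+(u)+(b-a)u\bigr\},&u\ge0,\\ \exp\bigl\{\ln\bigl(\frac ba\bigr)Y^-(-u)+(b-a)u\bigr\},&u\le0.\end{cases} \] For $a\ne b$ set \[ \zeta_{a,b}=\frac{\int_{\mathbb{R}}u\,Z^\star_{a,b}(u)\,\mathrm{d}u}{\int_{\mathbb{R}}Z^\star_{a,b}(u)\,\mathrm{d}u}. \] *)

theory Defs
  imports "HOL-Probability.Probability"
begin

definition path_space :: "real set \<Rightarrow> (real \<Rightarrow> nat) measure" where
  "path_space T = PiM T (\<lambda>_. count_space UNIV)"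

definition path_of :: "real set \<Rightarrow> (real \<Rightarrow> 'w \<Rightarrow> nat) \<Rightarrow> 'w \<Rightarrow> real \<Rightarrow> nat" where
  "path_of T N \<omega> = (\<lambda>t\<in>T. N t \<omega>)"

(* T is an interval with left endpoint 0. Every path, not only almost every one, is a
   right-continuous counting path; in particular the increments N t - N s (s \<le> t) are not
   truncated. The intensity lam is meant to be positive, so that poisson_pmf receives a
   positive rate. *)
definition poisson_process ::
  "'w measure \<Rightarrow> real set \<Rightarrow> (real \<Rightarrow> real) \<Rightarrow> (real \<Rightarrow> 'w \<Rightarrow> nat) \<Rightarrow> bool" where
  "poisson_process M T lam N \<longleftrightarrow>
     prob_space M \<and>
     (\<forall>t\<in>T. N t \<in> measurable M (count_space UNIV)) \<and>
     (\<forall>\<omega>\<in>space M. N 0 \<omega> = 0 \<and> mono_on T (\<lambda>t. N t \<omega>) \<and>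
        (\<forall>t\<in>T. continuous (at t within (T \<inter> {t<..})) (\<lambda>s. N s \<omega>))) \<and>
     (\<forall>k (t :: nat \<Rightarrow> real). (\<forall>i\<le>k. t i \<in> T) \<and> (\<forall>i<k. t i < t (Suc i)) \<longrightarrow>
        prob_space.indep_vars M (\<lambda>_. count_space UNIV)
          (\<lambda>i \<omega>. N (t (Suc i)) \<omega> - N (t i) \<omega>) {..<k}) \<and>
     (\<forall>s\<in>T. \<forall>t\<in>T. s < t \<longrightarrow>
        distr M (count_space UNIV) (\<lambda>\<omega>. N t \<omega> - N s \<omega>) =
          measure_pmf (poisson_pmf (LINT x:{s..t}|lborel. lam x)))"

definition intensity ::
  "(real \<Rightarrow> real) \<Rightarrow> real \<Rightarrow> real \<Rightarrow> real \<Rightarrow> real \<Rightarrow> real \<Rightarrow> real" where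
  "intensity \<psi> r \<tau> d \<theta> t =
     \<psi> t + r / d * (t - \<theta>) * indicator {\<theta>..<\<theta> + d} t + r * indicator {\<theta> + d..\<tau>} t"

definition sample_space :: "nat \<Rightarrow> real \<Rightarrow> (nat \<Rightarrow> real \<Rightarrow> nat) measure" where
  "sample_space n \<tau> = PiM {1..n} (\<lambda>_. path_space {0..\<tau>})"

definition sample_law ::
  "nat \<Rightarrow> real \<Rightarrow> 'w measure \<Rightarrow> (nat \<Rightarrow> real \<Rightarrow> 'w \<Rightarrow> nat) \<Rightarrow> (nat \<Rightarrow> real \<Rightarrow> nat) measure" where
  "sample_law n \<tau> M X =
     distr M (sample_space n \<tau>) (\<lambda>\<omega>. \<lambda>j\<in>{1..n}. path_of {0..\<tau>} (X j) \<omega>)"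

definition Zstar ::
  "real \<Rightarrow> real \<Rightarrow> (real \<Rightarrow> nat) \<Rightarrow> (real \<Rightarrow> nat) \<Rightarrow> real \<Rightarrow> real" where
  "Zstar a b yp ym u =
     (if u \<ge> 0 then exp (ln (a / b) * real (yp u) + (b - a) * u)
      else exp (ln (b / a) * real (ym (- u)) + (b - a) * u))"

definition zeta ::
  "real \<Rightarrow> real \<Rightarrow> (real \<Rightarrow> nat) \<Rightarrow> (real \<Rightarrow> nat) \<Rightarrow> real" where
  "zeta a b yp ym =
     (LINT u|lborel. u * Zstar a b yp ym u) / (LINT u|lborel. Zstar a b yp ym u)"

end

theory Submission
  imports Defs
begin

text \<open>
  The supremum of the risk over a neighbourhood of \<theta>0 is at least the average of the risks at
  the points \<theta>0 + i h / n, i \<le> N, of a finite grid, and this grid lies in the neighbourhood once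
  n is large. Its spacing is of order 1 / n, the scale at which n observed processes can just tell two
  change points apart. So the bound is a Bayes bound for a uniform prior on the grid, first
  for n to infinity, and then for long grids of small mesh h.

  For a finite grid no exact likelihood ratio of the observed paths is necessary, because the
  loss is nonnegative and lower bounds of the laws suffice. Fix the event that no point falls
  into a ramp, of length \<delta> n, that starts at a grid point, and that the total numbers of points in
  the cells between the ramps are given numbers k. On this event the law under the i-th grid
  point dominates a multiple of the law under the last one, and the multiplier depends on k
  only: each point in a cell after i contributes a factor \<rho>, slightly smaller than
  (\<psi> \<theta>0 + r) / \<psi> \<theta>0, and the difference of the mean measures contributes exp (- r h (N - i)). For sets that depend on finitely many times this is an inequality between
  products of Poisson weights (\<open>law_le\<close>); approximating measurable sets by such cylinders gives it
  for all events, so an estimator gains nothing from the rest of the path. Minimising the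
  weighted squared loss pointwise, by the posterior mean, bounds the average
  risk from below (\<open>bayes_lower_bound\<close>). Since n times \<delta> n tends to 0, the ramps become void with
  probability tending to 1 and the cell counts become independent Poisson variables, with rate
  a = \<psi> \<theta>0 before and b = \<psi> \<theta>0 + r after the change (\<open>minimax_ge_limit_bayes\<close>).

  In this limit experiment, seen from the true grid point i, the cell counts are the increments of
  Ym and Yp, the likelihood of the l-th next grid point relative to i is Zstar at l h, and the
  error of the posterior mean is therefore the Riemann sum version of zeta over the window from
  - i h to (N - i) h (\<open>bayes_mean_eq_zeta_sum\<close>). As h tends to 0 and both ends of the window
  recede to infinity these Riemann sums converge to zeta whenever both integrals in zeta
  exist; in the other case zeta is 0 and there is nothing to bound. By Fatou's lemma, every c below the
  expectation of the square of zeta is eventually exceeded by the mean squared error, uniformly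
  over all windows with long ends (\<open>zeta_risk_eventually_large\<close>). All but a vanishing fraction of the points of a long grid have long ends on both
  sides, so the average over the grid is at least c in the limit.
\<close>

section \<open>Comparing finite measures on a generating algebra\<close>

text \<open>The sets that can be approximated from the algebra, simultaneously for both measures, are
  closed under complements and finite unions. For a countable union, continuity from below makes
  all but finitely many of its members negligible.\<close>

lemma algebra_approximation:
  assumes G: "algebra \<Omega> G"
    and fin: "finite_measure \<mu>" "finite_measure \<nu>"
    and sets: "sets \<mu> = sigma_sets \<Omega> G" "sets \<nu> = sigma_sets \<Omega> G"
    and A: "A \<in> sigma_sets \<Omega> G" and e: "0 < (e::real)"
  shows "\<exists>B\<in>G. measure \<mu> (sym_diff A B) + measure \<nu> (sym_diff A B) < e"
proof -
  interpret G: algebra \<Omega> G by fact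
  interpret mu: finite_measure \<mu> by fact
  interpret nu: finite_measure \<nu> by fact
  define m where "m = (\<lambda>A. measure \<mu> A + measure \<nu> A)"
  define S where "S = sigma_sets \<Omega> G"
  have GS: "G \<subseteq> S" unfolding S_def by auto
  have [simp]: "A \<in> sets \<mu> \<longleftrightarrow> A \<in> S" "A \<in> sets \<nu> \<longleftrightarrow> A \<in> S" for A
    by (auto simp: sets S_def)
  have S_ops: "A \<union> B \<in> S" "A - B \<in> S" if "A \<in> S" "B \<in> S" for A B
    using sets.Un[of A \<mu> B] sets.Diff[of A \<mu> B] that by auto
  have m_mono: "m A \<le> m B" if "A \<subseteq> B" "B \<in> S" for A B
    unfolding m_def using that by (intro add_mono mu.finite_measure_mono nu.finite_measure_mono) auto
  have m_Un: "m (A \<union> B) \<le> m A + m B" if "A \<in> S" "B \<in> S" for A B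
    unfolding m_def using that
      measure_Un_le[of A \<mu> B] measure_Un_le[of A \<nu> B] by simp
  define approx where "approx A \<longleftrightarrow> A \<in> S \<and> (\<forall>e>0. \<exists>B\<in>G. m (sym_diff A B) < e)" for A
  have approxD: "\<exists>B\<in>G. m (sym_diff A B) < e" if "approx A" "0 < e" for A e
    using that unfolding approx_def by metis
  have sym_in: "sym_diff A B \<in> S" if "A \<in> S" "B \<in> S" for A B
    using that by (intro S_ops)
  have approx_G: "approx A" if "A \<in> G" for A
    using that GS unfolding approx_def by (auto simp: m_def intro!: bexI[of _ A])
  have approx_Un: "approx (A \<union> A')" if "approx A" "approx A'" for A A'
    unfolding approx_def
  proof (intro conjI allI impI)
    show "A \<union> A' \<in> S" using that S_ops unfolding approx_def by blast
    fix e :: real assume "0 < e"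
    then have "0 < e/2" by simp
    from approxD[OF that(1) this] approxD[OF that(2) this]
    obtain B B' where B: "B \<in> G" "B' \<in> G" "m (sym_diff A B) < e/2" "m (sym_diff A' B') < e/2"
      by metis
    have S: "A \<in> S" "A' \<in> S" "B \<in> S" "B' \<in> S" using that B GS unfolding approx_def by auto
    have "m (sym_diff (A \<union> A') (B \<union> B')) \<le> m (sym_diff A B \<union> sym_diff A' B')"
      using S by (intro m_mono S_ops) auto
    also have "\<dots> \<le> m (sym_diff A B) + m (sym_diff A' B')"
      using S by (intro m_Un S_ops) auto
    finally show "\<exists>B\<in>G. m (sym_diff (A \<union> A') B) < e"
      using B by (intro bexI[of _ "B \<union> B'"]) auto
  qed
  have "approx A"
    using A
  proof (induction rule: sigma_sets.induct)
    case (Basic a) then show ?case by (rule approx_G)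
  next
    case Empty show ?case by (rule approx_G) auto
  next
    case (Compl a)
    show ?case unfolding approx_def
    proof (intro conjI allI impI)
      have aS: "a \<in> S" using Compl by (auto simp: approx_def)
      then have a: "a \<subseteq> \<Omega>" unfolding S_def using G.space_closed sigma_sets_into_sp by blast
      show "\<Omega> - a \<in> S" using Compl(1) unfolding S_def by (rule sigma_sets.Compl)
      fix e :: real assume "0 < e"
      then obtain B where B: "B \<in> G" "m (sym_diff a B) < e" using approxD[OF Compl(2)] by metis
      have "sym_diff (\<Omega> - a) (\<Omega> - B) = sym_diff a B"
        using a G.sets_into_space[OF B(1)] by auto
      then show "\<exists>B\<in>G. m (sym_diff (\<Omega> - a) B) < e" using B by (metis G.compl_sets)
    qed
  next
    case (Union a)
    show ?case unfolding approx_def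
    proof (intro conjI allI impI)
      have aS: "a i \<in> S" for i using Union by (auto simp: approx_def)
      show U: "\<Union> (range a) \<in> S" unfolding S_def by (rule sigma_sets.Union) (use aS S_def in auto)
      fix e :: real assume e: "0 < e"
      define F where "F N = (\<Union>i\<le>N. a i)" for N :: nat
      have F: "approx (F N)" for N
        by (induction N) (use Union approx_Un in \<open>auto simp: F_def atMost_Suc Un_commute\<close>)
      have FS: "F N \<in> S" for N using F by (auto simp: approx_def)
      have UF: "(\<Union>N. F N) = \<Union> (range a)" by (auto simp: F_def)
      have inc: "incseq F" by (auto simp: incseq_def F_def) (meson atMost_iff order_trans)
      have "(\<lambda>N. m (F N)) \<longlonglongrightarrow> m (\<Union> (range a))"
        unfolding m_def UF[symmetric] using FS inc
        by (intro tendsto_add mu.finite_Lim_measure_incseq nu.finite_Lim_measure_incseq) auto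
      from order_tendstoD(1)[OF this, of "m (\<Union> (range a)) - e/2"] e
      obtain N where N: "m (\<Union> (range a)) - e/2 < m (F N)"
        by (auto simp: eventually_sequentially)
      have FN: "F N \<subseteq> \<Union> (range a)" by (auto simp: F_def)
      have dif: "m (\<Union> (range a) - F N) = m (\<Union> (range a)) - m (F N)"
        unfolding m_def using U FS FN by (simp add: mu.finite_measure_Diff nu.finite_measure_Diff)
      obtain B where B: "B \<in> G" "m (sym_diff (F N) B) < e/2"
        using approxD[OF F, of "e/2" N] e by (metis half_gt_zero)
      have BS: "B \<in> S" using B GS by auto
      have "m (sym_diff (\<Union> (range a)) B) \<le> m ((\<Union> (range a) - F N) \<union> sym_diff (F N) B)"
        using U FS BS FN by (intro m_mono S_ops) auto
      also have "\<dots> \<le> m (\<Union> (range a) - F N) + m (sym_diff (F N) B)"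
        using U FS BS by (intro m_Un S_ops) auto
      also have "\<dots> < e" using N B dif by linarith
      finally show "\<exists>B\<in>G. m (sym_diff (\<Union> (range a)) B) < e" using B by blast
    qed
  qed
  then show ?thesis using e unfolding approx_def m_def by blast
qed

text \<open>For equality a generating intersection-stable family would do; an inequality needs
  approximation in measure from an algebra.\<close>

lemma measure_le_from_algebra:
  assumes G: "algebra \<Omega> G"
    and fin: "finite_measure \<mu>" "finite_measure \<nu>"
    and sets: "sets \<mu> = sigma_sets \<Omega> G" "sets \<nu> = sigma_sets \<Omega> G"
    and le: "\<And>B. B \<in> G \<Longrightarrow> measure \<mu> B \<le> measure \<nu> B"
    and A: "A \<in> sigma_sets \<Omega> G"
  shows "measure \<mu> A \<le> measure \<nu> A"
proof (rule field_le_epsilon)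
  interpret mu: finite_measure \<mu> by fact
  interpret nu: finite_measure \<nu> by fact
  fix e :: real assume e: "0 < e"
  obtain B where B: "B \<in> G" "measure \<mu> (sym_diff A B) + measure \<nu> (sym_diff A B) < e"
    using algebra_approximation[OF G fin sets A e] by blast
  have BS: "B \<in> sigma_sets \<Omega> G" using B by auto
  have AB: "A \<in> sets \<mu>" "B \<in> sets \<mu>" "A \<in> sets \<nu>" "B \<in> sets \<nu>" using A BS sets by auto
  have "measure \<mu> A \<le> measure \<mu> (B \<union> sym_diff A B)"
    using AB by (intro mu.finite_measure_mono) auto
  also have "\<dots> \<le> measure \<mu> B + measure \<mu> (sym_diff A B)"
    using AB by (intro measure_Un_le) auto
  also have "measure \<mu> B \<le> measure \<nu> B" by (rule le[OF B(1)])
  also have "measure \<nu> B \<le> measure \<nu> (A \<union> sym_diff A B)"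
    using AB by (intro nu.finite_measure_mono) auto
  also have "\<dots> \<le> measure \<nu> A + measure \<nu> (sym_diff A B)"
    using AB by (intro measure_Un_le) auto
  finally show "measure \<mu> A \<le> measure \<nu> A + e" using B(2) by linarith
qed

section \<open>Poisson weights and increments of Poisson processes\<close>

definition poisson_weight :: "real \<Rightarrow> nat \<Rightarrow> real" where
  "poisson_weight p k = p ^ k / fact k * exp (- p)"

lemma poisson_weight_pmf: "0 < p \<Longrightarrow> pmf (poisson_pmf p) k = poisson_weight p k"
  by (simp add: poisson_weight_def)

lemma poisson_weight_nonneg: "0 \<le> p \<Longrightarrow> 0 \<le> poisson_weight p k"
  by (simp add: poisson_weight_def)

lemma poisson_weight_0: "poisson_weight 0 k = (if k = 0 then 1 else 0)"
  by (simp add: poisson_weight_def)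

lemma poisson_weight_convolution:
  "(\<Sum>v\<le>s. poisson_weight p v * poisson_weight q (s - v)) = poisson_weight (p + q) s"
proof -
  have "(\<Sum>v\<le>s. poisson_weight p v * poisson_weight q (s - v)) =
     (\<Sum>v\<le>s. of_nat (s choose v) * p ^ v * q ^ (s - v)) * (exp (- p) * exp (- q) / fact s)"
    unfolding sum_distrib_right
    by (intro sum.cong refl) (simp add: poisson_weight_def binomial_fact field_simps)
  also have "\<dots> = poisson_weight (p + q) s"
    by (simp add: poisson_weight_def binomial_ring exp_add[symmetric])
  finally show ?thesis .
qed

lemma prod_poisson_weight_convolution:
  assumes "finite A"
  shows "(\<Sum>v\<in>PiE A (\<lambda>l. {..s l}). \<Prod>l\<in>A. poisson_weight (p l) (v l) * poisson_weight (q l) (s l - v l)) =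
    (\<Prod>l\<in>A. poisson_weight (p l + q l) (s l))"
  using prod_sum_PiE[of A "\<lambda>l. {..s l}" "\<lambda>l v. poisson_weight (p l) v * poisson_weight (q l) (s l - v)"] assms
  by (simp add: poisson_weight_convolution)

text \<open>Everything that the likelihood comparison uses about the increments of a single process is
  contained in this formula.\<close>

lemma poisson_process_increments:
  assumes N: "poisson_process M T lam N"
    and t: "\<And>i. i \<le> K \<Longrightarrow> t i \<in> T" "\<And>i. i < K \<Longrightarrow> t i < t (Suc i)"
    and pos: "\<And>i. i < K \<Longrightarrow> 0 < (LINT x:{t i..t (Suc i)}|lborel. lam x)"
  shows "measure M {\<omega>\<in>space M. \<forall>l<K. N (t (Suc l)) \<omega> - N (t l) \<omega> = d l} =
    (\<Prod>l<K. poisson_weight (LINT x:{t l..t (Suc l)}|lborel. lam x) (d l))"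
proof -
  interpret prob_space M using N by (simp add: poisson_process_def)
  show ?thesis
  proof (cases "K = 0")
    case True then show ?thesis by (simp add: prob_space)
  next
    case False
    have ind: "indep_vars (\<lambda>_. count_space UNIV) (\<lambda>i \<omega>. N (t (Suc i)) \<omega> - N (t i) \<omega>) {..<K}"
      using N t unfolding poisson_process_def by blast
    have one: "prob ((\<lambda>\<omega>. N (t (Suc l)) \<omega> - N (t l) \<omega>) -` {d l} \<inter> space M) =
        poisson_weight (LINT x:{t l..t (Suc l)}|lborel. lam x) (d l)" if l: "l < K" for l
    proof -
      have m: "(\<lambda>\<omega>. N (t (Suc l)) \<omega> - N (t l) \<omega>) \<in> measurable M (count_space UNIV)"
        using ind l by (auto simp: indep_vars_def)
      have "prob ((\<lambda>\<omega>. N (t (Suc l)) \<omega> - N (t l) \<omega>) -` {d l} \<inter> space M) =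
         measure (distr M (count_space UNIV) (\<lambda>\<omega>. N (t (Suc l)) \<omega> - N (t l) \<omega>)) {d l}"
        using m by (simp add: measure_distr)
      also have "\<dots> = measure (measure_pmf (poisson_pmf (LINT x:{t l..t (Suc l)}|lborel. lam x))) {d l}"
        using N t l unfolding poisson_process_def by (metis Suc_leI less_imp_le_nat)
      also have "\<dots> = poisson_weight (LINT x:{t l..t (Suc l)}|lborel. lam x) (d l)"
        using poisson_weight_pmf[OF pos[OF l], of "d l"] by (simp add: measure_pmf_single)
      finally show ?thesis .
    qed
    have "{\<omega>\<in>space M. \<forall>l<K. N (t (Suc l)) \<omega> - N (t l) \<omega> = d l} =
        (\<Inter>l\<in>{..<K}. (\<lambda>\<omega>. N (t (Suc l)) \<omega> - N (t l) \<omega>) -` {d l} \<inter> space M)"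
      using False by auto
    then show ?thesis
      using indep_varsD_finite[OF ind, of "\<lambda>l. {d l}"] False one by auto
  qed
qed

section \<open>Samples of Poisson processes\<close>

abbreviation mean_measure :: "(real \<Rightarrow> real) \<Rightarrow> real \<Rightarrow> real \<Rightarrow> real" where
  "mean_measure lam s t \<equiv> (LINT x:{s..t}|lborel. lam x)"

locale poisson_sample = prob_space M for M :: "'w measure" +
  fixes n :: nat and \<tau> :: real and lam :: "real \<Rightarrow> real" and X :: "nat \<Rightarrow> real \<Rightarrow> 'w \<Rightarrow> nat"
  assumes n_pos: "1 \<le> n"
    and tau_nonneg: "0 \<le> \<tau>"
    and poisson: "\<And>j. j \<in> {1..n} \<Longrightarrow> poisson_process M {0..\<tau>} lam (X j)"
    and indep: "indep_vars (\<lambda>_. path_space {0..\<tau>}) (\<lambda>j. path_of {0..\<tau>} (X j)) {1..n}"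
    and mean_pos: "\<And>s t. 0 \<le> s \<Longrightarrow> s < t \<Longrightarrow> t \<le> \<tau> \<Longrightarrow> 0 < mean_measure lam s t"

lemma space_path_space: "space (path_space T) = PiE T (\<lambda>_. UNIV)"
  by (simp add: path_space_def space_PiM)

lemma path_of_apply [simp]: "t \<in> T \<Longrightarrow> path_of T N \<omega> t = N t \<omega>"
  by (simp add: path_of_def)

lemma measurable_eval_path:
  "t \<in> T \<Longrightarrow> (\<lambda>x. x t) \<in> measurable (path_space T) (count_space UNIV)"
  unfolding path_space_def by (rule measurable_component_singleton)

lemma measurable_path_of:
  assumes "\<And>t. t \<in> T \<Longrightarrow> N t \<in> measurable M (count_space UNIV)"
  shows "path_of T N \<in> measurable M (path_space T)"
  unfolding path_of_def path_space_def by (rule measurable_restrict) (use assms in auto)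

lemma measurable_nat_diff:
  fixes f g :: "'a \<Rightarrow> nat"
  assumes [measurable]: "f \<in> measurable M (count_space UNIV)" "g \<in> measurable M (count_space UNIV)"
  shows "(\<lambda>x. f x - g x) \<in> measurable M (count_space UNIV)"
  by measurable

lemma measurable_nat_sum:
  fixes f :: "'i \<Rightarrow> 'a \<Rightarrow> nat"
  assumes "\<And>i. i \<in> I \<Longrightarrow> f i \<in> measurable M (count_space UNIV)"
  shows "(\<lambda>x. \<Sum>i\<in>I. f i x) \<in> measurable M (count_space UNIV)"
proof (cases "finite I")
  case True
  then show ?thesis using assms
  proof (induction I)
    case (insert i I)
    have [measurable]: "f i \<in> measurable M (count_space UNIV)"
      "(\<lambda>x. \<Sum>i\<in>I. f i x) \<in> measurable M (count_space UNIV)" using insert by auto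
    have "(\<lambda>x. f i x + (\<Sum>i\<in>I. f i x)) \<in> measurable M (count_space UNIV)" by measurable
    then show ?case using insert by simp
  qed simp
qed simp

lemma measurable_nat_eq:
  fixes f :: "'a \<Rightarrow> nat"
  assumes "f \<in> measurable M (count_space UNIV)"
  shows "{x \<in> space M. f x = k} \<in> sets M"
  using measurable_sets[OF assms, of "{k}"] by (simp add: vimage_def Int_def conj_commute)

lemma increment_event:
  assumes "\<And>i. i \<le> K \<Longrightarrow> t i \<in> T"
  shows "{x \<in> space (path_space T). \<forall>l<K. x (t (Suc l)) - x (t l) = d l} \<in> sets (path_space T)"
proof -
  have "{x \<in> space (path_space T). x (t (Suc l)) - x (t l) = d l} \<in> sets (path_space T)"
    if "l < K" for l
  proof -
    have "(\<lambda>x. x (t (Suc l)) - x (t l)) \<in> measurable (path_space T) (count_space UNIV)"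
      using assms[of l] assms[of "Suc l"] that
      by (intro measurable_nat_diff measurable_eval_path) auto
    from measurable_sets[OF this, of "{d l}"] show ?thesis
      by (simp add: vimage_def Int_def conj_commute)
  qed
  then have "{x \<in> space (path_space T). \<forall>l\<in>{..<K}. x (t (Suc l)) - x (t l) = d l} \<in> sets (path_space T)"
    by (intro sets.sets_Collect_finite_All) auto
  then show ?thesis by (simp only: ball_simps lessThan_iff Ball_def)
qed

lemma path_of_increment_iff:
  assumes "\<And>i. i \<le> K \<Longrightarrow> t i \<in> T"
  shows "path_of T N \<omega> \<in> {x \<in> space (path_space T). \<forall>l<K. x (t (Suc l)) - x (t l) = d l} \<longleftrightarrow>
    (\<forall>l<K. N (t (Suc l)) \<omega> - N (t l) \<omega> = d l)"
  using assms by (auto simp: space_path_space path_of_def)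

context poisson_sample
begin

abbreviation path :: "nat \<Rightarrow> 'w \<Rightarrow> real \<Rightarrow> nat" where
  "path j \<equiv> path_of {0..\<tau>} (X j)"

lemma X_measurable [measurable]:
  "j \<in> {1..n} \<Longrightarrow> t \<in> {0..\<tau>} \<Longrightarrow> X j t \<in> measurable M (count_space UNIV)"
  using poisson by (auto simp: poisson_process_def)

lemma path_measurable [measurable]:
  "j \<in> {1..n} \<Longrightarrow> path j \<in> measurable M (path_space {0..\<tau>})"
  by (rule measurable_path_of) simp

lemma X_mono:
  assumes "j \<in> {1..n}" "\<omega> \<in> space M" "0 \<le> s" "s \<le> t" "t \<le> \<tau>"
  shows "X j s \<omega> \<le> X j t \<omega>"
proof -
  have "mono_on {0..\<tau>} (\<lambda>t. X j t \<omega>)"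
    using poisson[OF assms(1)] assms(2) unfolding poisson_process_def by blast
  from mono_onD[OF this, of s t] show ?thesis using assms by simp
qed

lemma X_0: "j \<in> {1..n} \<Longrightarrow> \<omega> \<in> space M \<Longrightarrow> X j 0 \<omega> = 0"
  using poisson by (auto simp: poisson_process_def)

lemma prob_increments:
  assumes t: "\<And>i. i \<le> K \<Longrightarrow> t i \<in> {0..\<tau>}" "\<And>i. i < K \<Longrightarrow> t i < t (Suc i)"
    and j: "j \<in> {1..n}"
  shows "prob {\<omega>\<in>space M. \<forall>l<K. X j (t (Suc l)) \<omega> - X j (t l) \<omega> = d l} =
    (\<Prod>l<K. poisson_weight (mean_measure lam (t l) (t (Suc l))) (d l))"
proof (rule poisson_process_increments[OF poisson[OF j]])
  show "0 < mean_measure lam (t i) (t (Suc i))" if "i < K" for i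
    using t(1)[of i] t(1)[of "Suc i"] t(2)[of i] that by (intro mean_pos) auto
qed (use t in auto)

lemma prob_paths:
  assumes "J \<subseteq> {1..n}" "\<And>j. j \<in> J \<Longrightarrow> B j \<in> sets (path_space {0..\<tau>})"
  shows "prob {\<omega>\<in>space M. \<forall>j\<in>J. path j \<omega> \<in> B j} = (\<Prod>j\<in>J. prob {\<omega>\<in>space M. path j \<omega> \<in> B j})"
proof (cases "J = {}")
  case True then show ?thesis by (simp add: prob_space)
next
  case False
  have "{\<omega>\<in>space M. \<forall>j\<in>J. path j \<omega> \<in> B j} = (\<Inter>j\<in>J. path j -` B j \<inter> space M)"
    using False by auto
  moreover have "{\<omega>\<in>space M. path j \<omega> \<in> B j} = path j -` B j \<inter> space M" for j by auto
  ultimately show ?thesis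
    using indep_varsD[OF indep, of J B] False assms finite_subset[OF assms(1)] by simp
qed

lemma prob_increment_matrix:
  assumes t: "\<And>i. i \<le> K \<Longrightarrow> t i \<in> {0..\<tau>}" "\<And>i. i < K \<Longrightarrow> t i < t (Suc i)"
  shows "prob {\<omega>\<in>space M. \<forall>j\<in>{1..n}. \<forall>l<K. X j (t (Suc l)) \<omega> - X j (t l) \<omega> = d j l} =
    (\<Prod>j\<in>{1..n}. \<Prod>l<K. poisson_weight (mean_measure lam (t l) (t (Suc l))) (d j l))"
proof -
  let ?B = "\<lambda>j. {x \<in> space (path_space {0..\<tau>}). \<forall>l<K. x (t (Suc l)) - x (t l) = d j l}"
  have iff: "path j \<omega> \<in> ?B j \<longleftrightarrow> (\<forall>l<K. X j (t (Suc l)) \<omega> - X j (t l) \<omega> = d j l)" for j \<omega>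
    by (rule path_of_increment_iff) (rule t(1))
  have "prob {\<omega>\<in>space M. \<forall>j\<in>{1..n}. path j \<omega> \<in> ?B j} = (\<Prod>j\<in>{1..n}. prob {\<omega>\<in>space M. path j \<omega> \<in> ?B j})"
    by (intro prob_paths increment_event t(1)) auto
  also have "\<dots> = (\<Prod>j\<in>{1..n}. \<Prod>l<K. poisson_weight (mean_measure lam (t l) (t (Suc l))) (d j l))"
    unfolding iff by (intro prod.cong refl prob_increments[where K = K and t = t, OF t])
  finally show ?thesis unfolding iff .
qed

text \<open>The total increments of the first m processes follow by induction on m, adding one process by
  the convolution of Poisson weights. The events B j for the processes not yet added let
  the independence of single paths suffice: in the step, the event of the new path is
  specialised to prescribed increments.\<close>

lemma prob_total_increments_and_paths:
  assumes t: "\<And>i. i \<le> K \<Longrightarrow> t i \<in> {0..\<tau>}" "\<And>i. i < K \<Longrightarrow> t i < t (Suc i)"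
    and m: "m \<le> n" and B: "\<And>j. j \<in> {m<..n} \<Longrightarrow> B j \<in> sets (path_space {0..\<tau>})"
  shows "prob {\<omega>\<in>space M. (\<forall>l<K. (\<Sum>j\<in>{1..m}. X j (t (Suc l)) \<omega> - X j (t l) \<omega>) = s l) \<and>
        (\<forall>j\<in>{m<..n}. path j \<omega> \<in> B j)} =
    (\<Prod>l<K. poisson_weight (real m * mean_measure lam (t l) (t (Suc l))) (s l)) *
    (\<Prod>j\<in>{m<..n}. prob {\<omega>\<in>space M. path j \<omega> \<in> B j})"
  using m B
proof (induction m arbitrary: s B)
  case 0
  have eq: "{0<..n} = {1..n}" by auto
  have B: "prob {\<omega>\<in>space M. \<forall>j\<in>{1..n}. path j \<omega> \<in> B j} = (\<Prod>j\<in>{1..n}. prob {\<omega>\<in>space M. path j \<omega> \<in> B j})"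
    using 0 by (intro prob_paths) auto
  show ?case
  proof (cases "\<forall>l<K. s l = 0")
    case True
    then have "(\<Prod>l<K. poisson_weight 0 (s l)) = 1" by (auto simp: poisson_weight_0 intro!: prod.neutral)
    then show ?thesis using B True unfolding eq by simp
  next
    case False
    then obtain l where l: "l < K" "s l \<noteq> 0" by blast
    then have "(\<Prod>l<K. poisson_weight 0 (s l)) = 0" by (auto simp: poisson_weight_0 prod_zero_iff)
    moreover have none: "{\<omega>\<in>space M. (\<forall>l<K. (\<Sum>j\<in>{1..0}. X j (t (Suc l)) \<omega> - X j (t l) \<omega>) = s l) \<and>
        (\<forall>j\<in>{0<..n}. path j \<omega> \<in> B j)} = {}"
      using l by auto
    ultimately show ?thesis unfolding none by simp
  qed
next
  case (Suc m)
  let ?Bv = "\<lambda>v::nat \<Rightarrow> nat. {x \<in> space (path_space {0..\<tau>}). \<forall>l<K. x (t (Suc l)) - x (t l) = v l}"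
  let ?V = "PiE {..<K} (\<lambda>l. {..s l})"
  let ?L = "\<lambda>l. mean_measure lam (t l) (t (Suc l))"
  define D where "D j l \<omega> = X j (t (Suc l)) \<omega> - X j (t l) \<omega>" for j l \<omega>
  have jn: "Suc m \<in> {1..n}" using Suc.prems by auto
  define E where "E v = {\<omega>\<in>space M. (\<forall>l<K. (\<Sum>j\<in>{1..m}. D j l \<omega>) = s l - v l) \<and>
      (\<forall>j\<in>{m<..n}. path j \<omega> \<in> (B(Suc m := ?Bv v)) j)}" for v
  have IH: "prob {\<omega>\<in>space M. (\<forall>l<K. (\<Sum>j\<in>{1..m}. X j (t (Suc l)) \<omega> - X j (t l) \<omega>) = u l) \<and>
        (\<forall>j\<in>{m<..n}. path j \<omega> \<in> C j)} =
      (\<Prod>l<K. poisson_weight (real m * mean_measure lam (t l) (t (Suc l))) (u l)) *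
      (\<Prod>j\<in>{m<..n}. prob {\<omega>\<in>space M. path j \<omega> \<in> C j})"
    if "\<And>j. j \<in> {m<..n} \<Longrightarrow> C j \<in> sets (path_space {0..\<tau>})" for C u
    by (rule Suc.IH) (use Suc.prems(1) that in \<open>simp_all only: Suc_leD\<close>)
  have ins: "{m<..n} = insert (Suc m) {Suc m<..n}" using Suc.prems by auto
  have E_iff: "\<omega> \<in> E v \<longleftrightarrow> \<omega> \<in> space M \<and> (\<forall>l<K. (\<Sum>j\<in>{1..m}. D j l \<omega>) = s l - v l) \<and>
      (\<forall>l<K. D (Suc m) l \<omega> = v l) \<and> (\<forall>j\<in>{Suc m<..n}. path j \<omega> \<in> B j)" for v \<omega>
    unfolding E_def ins using path_of_increment_iff[of K t "{0..\<tau>}" "X (Suc m)" \<omega> v, OF t(1)]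
    by (auto simp: D_def)
  have eq: "{\<omega>\<in>space M. (\<forall>l<K. (\<Sum>j\<in>{1..Suc m}. D j l \<omega>) = s l) \<and>
        (\<forall>j\<in>{Suc m<..n}. path j \<omega> \<in> B j)} = (\<Union>v\<in>?V. E v)" (is "?l = _")
  proof (intro set_eqI iffI)
    fix \<omega> assume w: "\<omega> \<in> ?l"
    have "s l = (\<Sum>j\<in>{1..m}. D j l \<omega>) + D (Suc m) l \<omega>" if "l < K" for l
      using w that by auto
    then show "\<omega> \<in> (\<Union>v\<in>?V. E v)"
      using w by (intro UN_I[of "\<lambda>l\<in>{..<K}. D (Suc m) l \<omega>"]) (auto simp: E_iff)
  next
    fix \<omega> assume "\<omega> \<in> (\<Union>v\<in>?V. E v)"
    then obtain v where v: "v \<in> ?V" "\<omega> \<in> E v" by auto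
    have "v l \<le> s l" if "l < K" for l using v that by (auto simp: PiE_def Pi_def)
    then show "\<omega> \<in> ?l" using v(2) by (auto simp: E_iff)
  qed
  have prob_E: "prob (E v) = (\<Prod>l<K. poisson_weight (real m * ?L l) (s l - v l)) *
     ((\<Prod>l<K. poisson_weight (?L l) (v l)) * (\<Prod>j\<in>{Suc m<..n}. prob {\<omega>\<in>space M. path j \<omega> \<in> B j}))" for v
  proof -
    \<comment> \<open>The increments of the new path are prescribed through its event in the induction hypothesis.\<close>
    define B' where "B' = B(Suc m := ?Bv v)"
    have B': "B' j \<in> sets (path_space {0..\<tau>})" if "j \<in> {m<..n}" for j
    proof (cases "j = Suc m")
      case True
      show ?thesis unfolding True B'_def fun_upd_same by (rule increment_event) (rule t(1))
    next
      case False
      then show ?thesis using Suc.prems(2)[of j] that unfolding B'_def fun_upd_other[OF False] by auto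
    qed
    have "prob (E v) = (\<Prod>l<K. poisson_weight (real m * ?L l) (s l - v l)) *
       (\<Prod>j\<in>{m<..n}. prob {\<omega>\<in>space M. path j \<omega> \<in> B' j})"
      unfolding E_def D_def B'_def[symmetric] using IH[of B' "\<lambda>l. s l - v l", OF B'] .
    also have "(\<Prod>j\<in>{m<..n}. prob {\<omega>\<in>space M. path j \<omega> \<in> B' j}) =
       prob {\<omega>\<in>space M. path (Suc m) \<omega> \<in> B' (Suc m)} * (\<Prod>j\<in>{Suc m<..n}. prob {\<omega>\<in>space M. path j \<omega> \<in> B' j})"
      unfolding ins by (rule prod.insert[of "{Suc m<..n}" "Suc m" "\<lambda>j. prob {\<omega>\<in>space M. path j \<omega> \<in> B' j}"]) simp_all
    also have "(\<Prod>j\<in>{Suc m<..n}. prob {\<omega>\<in>space M. path j \<omega> \<in> B' j}) =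
       (\<Prod>j\<in>{Suc m<..n}. prob {\<omega>\<in>space M. path j \<omega> \<in> B j})"
      by (intro prod.cong refl) (simp add: B'_def)
    also have "{\<omega>\<in>space M. path (Suc m) \<omega> \<in> B' (Suc m)} =
        {\<omega>\<in>space M. \<forall>l<K. X (Suc m) (t (Suc l)) \<omega> - X (Suc m) (t l) \<omega> = v l}"
      unfolding B'_def fun_upd_same by (intro Collect_cong conj_cong refl path_of_increment_iff t(1))
    also have "prob \<dots> = (\<Prod>l<K. poisson_weight (?L l) (v l))"
      by (rule prob_increments[where K = K and t = t, OF t jn])
    finally show ?thesis .
  qed
  have meas: "E v \<in> events" for v
  proof -
    have D: "D j l \<in> measurable M (count_space UNIV)" if "j \<in> {1..n}" "l < K" for j l
      unfolding D_def using that t(1)[of l] t(1)[of "Suc l"] by (intro measurable_nat_diff X_measurable) auto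
    have "{\<omega>\<in>space M. \<forall>l\<in>{..<K}. (\<Sum>j\<in>{1..m}. D j l \<omega>) = s l - v l} \<in> events"
      by (intro sets.sets_Collect_finite_All measurable_nat_eq measurable_nat_sum D)
        (use Suc.prems in auto)
    moreover have "{\<omega>\<in>space M. \<forall>l\<in>{..<K}. D (Suc m) l \<omega> = v l} \<in> events"
      by (intro sets.sets_Collect_finite_All measurable_nat_eq D jn) auto
    moreover have "{\<omega>\<in>space M. \<forall>j\<in>{Suc m<..n}. path j \<omega> \<in> B j} \<in> events"
    proof (intro sets.sets_Collect_finite_All)
      fix j assume "j \<in> {Suc m<..n}"
      then show "{\<omega>\<in>space M. path j \<omega> \<in> B j} \<in> events"
        using Suc.prems(2)[of j] measurable_sets[OF path_measurable[of j], of "B j"]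
        by (auto simp: vimage_def Int_def conj_commute)
    qed auto
    ultimately have "{\<omega>\<in>space M. \<forall>l\<in>{..<K}. (\<Sum>j\<in>{1..m}. D j l \<omega>) = s l - v l} \<inter>
        ({\<omega>\<in>space M. \<forall>l\<in>{..<K}. D (Suc m) l \<omega> = v l} \<inter>
        {\<omega>\<in>space M. \<forall>j\<in>{Suc m<..n}. path j \<omega> \<in> B j}) \<in> events" by (intro sets.Int)
    also have "{\<omega>\<in>space M. \<forall>l\<in>{..<K}. (\<Sum>j\<in>{1..m}. D j l \<omega>) = s l - v l} \<inter>
        ({\<omega>\<in>space M. \<forall>l\<in>{..<K}. D (Suc m) l \<omega> = v l} \<inter>
        {\<omega>\<in>space M. \<forall>j\<in>{Suc m<..n}. path j \<omega> \<in> B j}) = E v"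
      by (rule set_eqI) (simp only: E_iff Int_iff mem_Collect_eq Ball_def lessThan_iff, blast)
    finally show ?thesis .
  qed
  have disj: "disjoint_family_on E ?V"
    unfolding disjoint_family_on_def
  proof (intro ballI impI)
    fix v w assume vw: "v \<in> ?V" "w \<in> ?V" "v \<noteq> w"
    have "\<exists>l<K. v l \<noteq> w l"
    proof (rule ccontr)
      assume "\<not> (\<exists>l<K. v l \<noteq> w l)"
      then have "v = w" using vw(1,2) by (intro PiE_ext[of v "{..<K}" _ w]) simp_all
      then show False using vw(3) by simp
    qed
    then obtain l where l: "l < K" "v l \<noteq> w l" by blast
    have False if "\<omega> \<in> E v" "\<omega> \<in> E w" for \<omega>
      using that l unfolding E_iff by metis
    then show "E v \<inter> E w = {}" by blast
  qed
  have fin: "finite ?V" by (intro finite_PiE) simp_all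
  have "prob (\<Union>v\<in>?V. E v) = (\<Sum>v\<in>?V. prob (E v))"
    by (rule finite_measure_finite_Union[OF fin _ disj]) (use meas in blast)
  also have "\<dots> = (\<Sum>v\<in>?V. \<Prod>l<K. poisson_weight (?L l) (v l) * poisson_weight (real m * ?L l) (s l - v l)) *
      (\<Prod>j\<in>{Suc m<..n}. prob {\<omega>\<in>space M. path j \<omega> \<in> B j})"
    unfolding prob_E sum_distrib_right by (intro sum.cong refl) (simp only: prod.distrib mult_ac)
  also have "(\<Sum>v\<in>?V. \<Prod>l<K. poisson_weight (?L l) (v l) * poisson_weight (real m * ?L l) (s l - v l)) =
      (\<Prod>l<K. poisson_weight (?L l + real m * ?L l) (s l))"
    by (rule prod_poisson_weight_convolution) simp
  also have "(\<lambda>l. ?L l + real m * ?L l) = (\<lambda>l. real (Suc m) * ?L l)"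
    by (simp add: algebra_simps)
  finally show ?case unfolding eq[symmetric] D_def .
qed

lemma prob_total_increments:
  assumes t: "\<And>i. i \<le> K \<Longrightarrow> t i \<in> {0..\<tau>}" "\<And>i. i < K \<Longrightarrow> t i < t (Suc i)"
  shows "prob {\<omega>\<in>space M. \<forall>l<K. (\<Sum>j\<in>{1..n}. X j (t (Suc l)) \<omega> - X j (t l) \<omega>) = s l} =
    (\<Prod>l<K. poisson_weight (real n * mean_measure lam (t l) (t (Suc l))) (s l))"
proof -
  have "prob {\<omega>\<in>space M. (\<forall>l<K. (\<Sum>j\<in>{1..n}. X j (t (Suc l)) \<omega> - X j (t l) \<omega>) = s l) \<and>
        (\<forall>j\<in>{n<..n}. path j \<omega> \<in> {})} =
    (\<Prod>l<K. poisson_weight (real n * mean_measure lam (t l) (t (Suc l))) (s l)) *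
    (\<Prod>j\<in>{n<..n}. prob {\<omega>\<in>space M. path j \<omega> \<in> {}})"
    by (rule prob_total_increments_and_paths[where B = "\<lambda>_. {}"]) (use t in blast)+
  then show ?thesis
    unfolding greaterThanAtMost_empty[OF order_refl[of n]] prod.empty mult_1_right Ball_def empty_iff simp_thms .
qed

end

section \<open>Laws of samples on cylinder sets\<close>

lemma space_sample_space: "space (sample_space n \<tau>) = PiE {1..n} (\<lambda>_. PiE {0..\<tau>} (\<lambda>_. UNIV))"
  by (simp add: sample_space_def space_PiM space_path_space)

text \<open>Stated through pairs of samples, which avoids projections to finite products and unions of
  their index sets.\<close>

definition determined_by :: "nat \<Rightarrow> real \<Rightarrow> real set \<Rightarrow> (nat \<Rightarrow> real \<Rightarrow> nat) set \<Rightarrow> bool" where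
  "determined_by n \<tau> F A \<longleftrightarrow> (\<forall>x\<in>space (sample_space n \<tau>). \<forall>y\<in>space (sample_space n \<tau>).
     (\<forall>j\<in>{1..n}. \<forall>t\<in>F. x j t = y j t) \<longrightarrow> (x \<in> A \<longleftrightarrow> y \<in> A))"

definition cylinders :: "nat \<Rightarrow> real \<Rightarrow> (nat \<Rightarrow> real \<Rightarrow> nat) set set" where
  "cylinders n \<tau> = {A \<in> sets (sample_space n \<tau>). \<exists>F. finite F \<and> F \<subseteq> {0..\<tau>} \<and> determined_by n \<tau> F A}"

lemma determined_byD:
  "determined_by n \<tau> F A \<Longrightarrow> x \<in> space (sample_space n \<tau>) \<Longrightarrow> y \<in> space (sample_space n \<tau>) \<Longrightarrow>
    (\<And>j t. j \<in> {1..n} \<Longrightarrow> t \<in> F \<Longrightarrow> x j t = y j t) \<Longrightarrow> x \<in> A \<longleftrightarrow> y \<in> A"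
  unfolding determined_by_def by blast

lemma determined_byI:
  assumes "\<And>x y. x \<in> space (sample_space n \<tau>) \<Longrightarrow> y \<in> space (sample_space n \<tau>) \<Longrightarrow>
    (\<And>j t. j \<in> {1..n} \<Longrightarrow> t \<in> F \<Longrightarrow> x j t = y j t) \<Longrightarrow> x \<in> A \<longleftrightarrow> y \<in> A"
  shows "determined_by n \<tau> F A"
  unfolding determined_by_def by (intro ballI impI, rule assms) blast+

lemma determined_by_mono:
  assumes "determined_by n \<tau> F A" "F \<subseteq> G"
  shows "determined_by n \<tau> G A"
  by (rule determined_byI, rule determined_byD[OF assms(1)]) (use assms(2) in auto)

lemma determined_by_Int:
  assumes "determined_by n \<tau> F A" "determined_by n \<tau> F B"
  shows "determined_by n \<tau> F (A \<inter> B)"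
proof (rule determined_byI)
  fix x y assume xy: "x \<in> space (sample_space n \<tau>)" "y \<in> space (sample_space n \<tau>)"
    "\<And>j t. j \<in> {1..n} \<Longrightarrow> t \<in> F \<Longrightarrow> x j t = y j t"
  show "x \<in> A \<inter> B \<longleftrightarrow> y \<in> A \<inter> B"
    using determined_byD[OF assms(1) xy] determined_byD[OF assms(2) xy] by simp
qed

lemma determined_by_Un:
  assumes "determined_by n \<tau> F A" "determined_by n \<tau> F B"
  shows "determined_by n \<tau> F (A \<union> B)"
proof (rule determined_byI)
  fix x y assume xy: "x \<in> space (sample_space n \<tau>)" "y \<in> space (sample_space n \<tau>)"
    "\<And>j t. j \<in> {1..n} \<Longrightarrow> t \<in> F \<Longrightarrow> x j t = y j t"
  show "x \<in> A \<union> B \<longleftrightarrow> y \<in> A \<union> B"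
    using determined_byD[OF assms(1) xy] determined_byD[OF assms(2) xy] by simp
qed

lemma determined_by_Compl:
  assumes "determined_by n \<tau> F A"
  shows "determined_by n \<tau> F (space (sample_space n \<tau>) - A)"
proof (rule determined_byI)
  fix x y assume xy: "x \<in> space (sample_space n \<tau>)" "y \<in> space (sample_space n \<tau>)"
    "\<And>j t. j \<in> {1..n} \<Longrightarrow> t \<in> F \<Longrightarrow> x j t = y j t"
  show "x \<in> space (sample_space n \<tau>) - A \<longleftrightarrow> y \<in> space (sample_space n \<tau>) - A"
    using determined_byD[OF assms xy] xy by simp
qed

lemma algebra_cylinders: "algebra (space (sample_space n \<tau>)) (cylinders n \<tau>)"
  unfolding algebra_iff_Un
proof (intro conjI ballI)
  show "cylinders n \<tau> \<subseteq> Pow (space (sample_space n \<tau>))"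
    unfolding cylinders_def using sets.sets_into_space by blast
  show "{} \<in> cylinders n \<tau>"
    unfolding cylinders_def determined_by_def by auto
next
  fix A assume A: "A \<in> cylinders n \<tau>"
  then obtain F where F: "finite F" "F \<subseteq> {0..\<tau>}" "determined_by n \<tau> F A" "A \<in> sets (sample_space n \<tau>)"
    unfolding cylinders_def by blast
  have "determined_by n \<tau> F (space (sample_space n \<tau>) - A)"
    by (rule determined_by_Compl[OF F(3)])
  then show "space (sample_space n \<tau>) - A \<in> cylinders n \<tau>"
    using F unfolding cylinders_def by blast
  fix B assume "B \<in> cylinders n \<tau>"
  then obtain F' where F': "finite F'" "F' \<subseteq> {0..\<tau>}" "determined_by n \<tau> F' B" "B \<in> sets (sample_space n \<tau>)"
    unfolding cylinders_def by blast
  have "determined_by n \<tau> (F \<union> F') (A \<union> B)"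
    by (intro determined_by_Un determined_by_mono[OF F(3)] determined_by_mono[OF F'(3)]) auto
  moreover have "finite (F \<union> F')" "F \<union> F' \<subseteq> {0..\<tau>}" "A \<union> B \<in> sets (sample_space n \<tau>)"
    using F F' by auto
  ultimately show "A \<union> B \<in> cylinders n \<tau>" unfolding cylinders_def by blast
qed

lemma measurable_eval_sample:
  assumes "j \<in> {1..n}" "t \<in> {0..\<tau>}"
  shows "(\<lambda>x. x j t) \<in> measurable (sample_space n \<tau>) (count_space UNIV)"
proof -
  have "(\<lambda>x. x j) \<in> measurable (sample_space n \<tau>) (path_space {0..\<tau>})"
    unfolding sample_space_def by (rule measurable_component_singleton) (rule assms(1))
  from measurable_compose[OF this measurable_eval_path[OF assms(2)]] show ?thesis .
qed

text \<open>The identity is measurable from the sigma-algebra generated by the cylinders to the product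
  sigma-algebra, because its coordinates are.\<close>

lemma sigma_sets_cylinders:
  "sigma_sets (space (sample_space n \<tau>)) (cylinders n \<tau>) = sets (sample_space n \<tau>)"
proof
  show "sigma_sets (space (sample_space n \<tau>)) (cylinders n \<tau>) \<subseteq> sets (sample_space n \<tau>)"
    by (rule sets.sigma_sets_subset) (auto simp: cylinders_def)
  define N where "N = sigma (space (sample_space n \<tau>)) (cylinders n \<tau>)"
  have cyl: "cylinders n \<tau> \<subseteq> Pow (space (sample_space n \<tau>))"
    using sets.sets_into_space by (auto simp: cylinders_def)
  have space_N: "space N = space (sample_space n \<tau>)" and
    sets_N: "sets N = sigma_sets (space (sample_space n \<tau>)) (cylinders n \<tau>)"
    unfolding N_def using cyl by auto
  have coord: "(\<lambda>x. x j t) \<in> measurable N (count_space UNIV)" if jt: "j \<in> {1..n}" "t \<in> {0..\<tau>}" for j t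
  proof (rule measurableI)
    fix B :: "nat set"
    have "(\<lambda>x. x j t) -` B \<inter> space N \<in> cylinders n \<tau>"
      unfolding cylinders_def
    proof (intro CollectI conjI exI[of _ "{t}"])
      show "(\<lambda>x. x j t) -` B \<inter> space N \<in> sets (sample_space n \<tau>)"
        using measurable_sets[OF measurable_eval_sample[OF jt], of B] space_N by simp
      show "determined_by n \<tau> {t} ((\<lambda>x. x j t) -` B \<inter> space N)"
        unfolding space_N by (rule determined_byI) (use jt in simp)
    qed (use jt in auto)
    then show "(\<lambda>x. x j t) -` B \<inter> space N \<in> sets N"
      unfolding sets_N by (rule sigma_sets.Basic)
  qed simp
  have paths: "(\<lambda>x. x j) \<in> measurable N (path_space {0..\<tau>})" if j: "j \<in> {1..n}" for j
    unfolding path_space_def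
  proof (rule measurable_PiM_single'[of _ "\<lambda>t x. x j t"])
    show "(\<lambda>\<omega> t. \<omega> j t) \<in> space N \<rightarrow> (\<Pi>\<^sub>E i\<in>{0..\<tau>}. space (count_space UNIV))"
      unfolding space_N space_sample_space using j by auto
  qed (use coord j in auto)
  have "(\<lambda>x. x) \<in> measurable N (sample_space n \<tau>)"
    unfolding sample_space_def
  proof (rule measurable_PiM_single'[of _ "\<lambda>j x. x j"])
    show "(\<lambda>\<omega> j. \<omega> j) \<in> space N \<rightarrow> (\<Pi>\<^sub>E i\<in>{1..n}. space (path_space {0..\<tau>}))"
      unfolding space_N space_sample_space space_path_space by auto
  qed (use paths in auto)
  then show "sets (sample_space n \<tau>) \<subseteq> sigma_sets (space (sample_space n \<tau>)) (cylinders n \<tau>)"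
    using measurable_sets[of "\<lambda>x. x" N "sample_space n \<tau>"] sets.sets_into_space[of _ "sample_space n \<tau>"]
    by (auto simp: space_N sets_N[symmetric] vimage_def Int_absorb1 dest!: subsetD)
qed

lemma increasing_less:
  fixes t :: "nat \<Rightarrow> real"
  assumes t: "\<And>i. i < K \<Longrightarrow> t i < t (Suc i)" and "i < j" "j \<le> K"
  shows "t i < t j"
  using assms(2,3)
proof (induction j)
  case (Suc j)
  show ?case
  proof (cases "i = j")
    case False
    then have "t i < t j" using Suc by simp
    also have "t j < t (Suc j)" using Suc by (intro t) simp
    finally show ?thesis .
  qed (use Suc t in simp)
qed simp

lemma increasing_le_iff:
  fixes t :: "nat \<Rightarrow> real"
  assumes t: "\<And>i. i < K \<Longrightarrow> t i < t (Suc i)" and ij: "i \<le> K" "j \<le> K"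
  shows "t i \<le> t j \<longleftrightarrow> i \<le> j"
  using increasing_less[where t = t and K = K and i = i and j = j, OF t]
    increasing_less[where t = t and K = K and i = j and j = i, OF t] ij
  by (metis linorder_not_le nat_less_le order_less_imp_le order_refl)

lemma increasing_enumeration:
  fixes F :: "real set"
  assumes F: "finite F" "0 \<in> F" "F \<subseteq> {0..\<tau>}"
  obtains K t where "t 0 = 0" "\<And>i. i < K \<Longrightarrow> t i < t (Suc i)" "t ` {..K} = F"
proof -
  define xs where "xs = sorted_list_of_set F"
  have xs: "sorted_wrt (<) xs" "set xs = F" unfolding xs_def using F by simp_all
  then have "length xs \<noteq> 0" using F by auto
  then obtain K where K: "length xs = Suc K" using not0_implies_Suc by blast
  have inc: "xs ! i < xs ! Suc i" if "i < K" for i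
    using sorted_wrt_nth_less[OF xs(1), of i "Suc i"] that K by simp
  have im: "(!) xs ` {..K} = F"
    unfolding xs(2)[symmetric] set_conv_nth K by (auto simp: less_Suc_eq_le)
  obtain i where i: "i \<le> K" "xs ! i = 0" using im F(2) by (auto simp: image_iff)
  have "xs ! 0 \<le> xs ! i" using increasing_le_iff[where t = "(!) xs" and K = K and i = 0 and j = i, OF inc] i by simp
  moreover have "0 \<le> xs ! 0" using im F(3) by force
  ultimately have "xs ! 0 = 0" using i by simp
  then show ?thesis using that[of "(!) xs" K] inc im by blast
qed

text \<open>A canonical sample with increments d along t: each path jumps only at the times t (Suc l). On
  the event that the observed increments are d, membership in a set determined by the times t
  can be read off from this sample. It does not depend on the probability space, so that samples
  with different laws can be compared.\<close>

definition step_sample :: "nat \<Rightarrow> real \<Rightarrow> nat \<Rightarrow> (nat \<Rightarrow> real) \<Rightarrow> (nat \<Rightarrow> nat \<Rightarrow> nat) \<Rightarrow> nat \<Rightarrow> real \<Rightarrow> nat" where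
  "step_sample n \<tau> K t d =
     (\<lambda>j\<in>{1..n}. \<lambda>s\<in>{0..\<tau>}. \<Sum>l\<in>{l. l < K \<and> t (Suc l) \<le> s}. d j l)"

lemma step_sample_in_space: "step_sample n \<tau> K t d \<in> space (sample_space n \<tau>)"
  unfolding space_sample_space step_sample_def by auto

lemma step_sample_at:
  assumes t: "\<And>i. i < K \<Longrightarrow> t i < t (Suc i)" and "t p \<in> {0..\<tau>}" "p \<le> K" "j \<in> {1..n}"
  shows "step_sample n \<tau> K t d j (t p) = (\<Sum>l<p. d j l)"
proof -
  have "{l. l < K \<and> t (Suc l) \<le> t p} = {..<p}"
    using assms(3) increasing_le_iff[where t = t and K = K and j = p, OF t] by (auto simp: Suc_le_eq)
  then show ?thesis using assms by (simp add: step_sample_def)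
qed

context poisson_sample
begin

abbreviation law :: "(nat \<Rightarrow> real \<Rightarrow> nat) measure" where
  "law \<equiv> sample_law n \<tau> M X"

definition sample :: "'w \<Rightarrow> nat \<Rightarrow> real \<Rightarrow> nat" where
  "sample \<omega> = (\<lambda>j\<in>{1..n}. path_of {0..\<tau>} (X j) \<omega>)"

lemma sample_measurable: "sample \<in> measurable M (sample_space n \<tau>)"
  unfolding sample_space_def sample_def
  by (rule measurable_restrict) (rule path_measurable)

lemma law_eq: "law = distr M (sample_space n \<tau>) sample"
  unfolding sample_law_def sample_def ..

lemma prob_space_law: "prob_space law"
  unfolding law_eq by (rule prob_space_distr) (rule sample_measurable)

lemma sets_law [simp]: "sets law = sets (sample_space n \<tau>)"
  by (simp add: law_eq)

lemma emeasure_law: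
  "A \<in> sets (sample_space n \<tau>) \<Longrightarrow> emeasure law A = emeasure M {\<omega>\<in>space M. sample \<omega> \<in> A}"
  unfolding law_eq by (simp add: emeasure_distr sample_measurable vimage_def Int_def conj_commute)

lemma sample_apply: "j \<in> {1..n} \<Longrightarrow> t \<in> {0..\<tau>} \<Longrightarrow> sample \<omega> j t = X j t \<omega>"
  by (simp add: sample_def)

lemma sample_in_space: "\<omega> \<in> space M \<Longrightarrow> sample \<omega> \<in> space (sample_space n \<tau>)"
  using measurable_space[OF sample_measurable] .

definition atom :: "nat \<Rightarrow> (nat \<Rightarrow> real) \<Rightarrow> (nat \<Rightarrow> nat \<Rightarrow> nat) \<Rightarrow> 'w set" where
  "atom K t d = {\<omega>\<in>space M. \<forall>j\<in>{1..n}. \<forall>l<K. X j (t (Suc l)) \<omega> - X j (t l) \<omega> = d j l}"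

lemma atom_events:
  assumes t: "\<And>i. i \<le> K \<Longrightarrow> t i \<in> {0..\<tau>}"
  shows "atom K t d \<in> events"
proof -
  have "{\<omega>\<in>space M. \<forall>j\<in>{1..n}. \<forall>l\<in>{..<K}. X j (t (Suc l)) \<omega> - X j (t l) \<omega> = d j l} \<in> events"
    by (intro sets.sets_Collect_finite_All measurable_nat_eq measurable_nat_diff X_measurable t) auto
  then show ?thesis unfolding atom_def by (simp only: ball_simps lessThan_iff Ball_def)
qed

lemma X_at_atom:
  assumes t: "t 0 = 0" "\<And>i. i \<le> K \<Longrightarrow> t i \<in> {0..\<tau>}" "\<And>i. i < K \<Longrightarrow> t i < t (Suc i)"
    and w: "\<omega> \<in> atom K t d" and j: "j \<in> {1..n}" and p: "p \<le> K"
  shows "X j (t p) \<omega> = (\<Sum>l<p. d j l)"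
  using p
proof (induction p)
  case 0
  then show ?case using X_0[OF j, of \<omega>] w t by (simp add: atom_def)
next
  case (Suc p)
  have wM: "\<omega> \<in> space M" using w by (simp add: atom_def)
  have "X j (t p) \<omega> \<le> X j (t (Suc p)) \<omega>"
    using t(2)[of p] t(2)[of "Suc p"] t(3)[of p] Suc.prems by (intro X_mono j wM) auto
  moreover have "X j (t (Suc p)) \<omega> - X j (t p) \<omega> = d j p"
    using w j Suc.prems unfolding atom_def by auto
  ultimately show ?case using Suc by simp
qed

text \<open>The increment matrices d split the probability space into countably many atoms, on each of
  which membership of the sample in A is constant.\<close>

lemma emeasure_law_determined:
  assumes t: "t 0 = 0" "\<And>i. i \<le> K \<Longrightarrow> t i \<in> {0..\<tau>}" "\<And>i. i < K \<Longrightarrow> t i < t (Suc i)"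
    and A: "A \<in> sets (sample_space n \<tau>)" "determined_by n \<tau> (t ` {..K}) A"
  shows "emeasure law A = (\<integral>\<^sup>+ d. ennreal (\<Prod>j\<in>{1..n}. \<Prod>l<K. poisson_weight (mean_measure lam (t l) (t (Suc l))) (d j l))
     \<partial>count_space {d \<in> PiE {1..n} (\<lambda>_. PiE {..<K} (\<lambda>_. UNIV)). step_sample n \<tau> K t d \<in> A})"
proof -
  let ?D = "{d \<in> PiE {1..n} (\<lambda>_. PiE {..<K} (\<lambda>_. UNIV)). step_sample n \<tau> K t d \<in> A}"
  have agree: "sample \<omega> \<in> A \<longleftrightarrow> step_sample n \<tau> K t d \<in> A" if w: "\<omega> \<in> atom K t d" for \<omega> d
  proof -
    have wM: "\<omega> \<in> space M" using w by (simp add: atom_def)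
    have "sample \<omega> j s = step_sample n \<tau> K t d j s" if js: "j \<in> {1..n}" "s \<in> t ` {..K}" for j s
    proof -
      obtain p where p: "p \<le> K" "s = t p" using js(2) by auto
      show ?thesis unfolding p(2) using p(1)
        by (simp only: sample_apply[OF js(1) t(2)[OF p(1)]]
            step_sample_at[where t = t and K = K, OF t(3) t(2)[OF p(1)] p(1) js(1)]
            X_at_atom[where t = t and K = K, OF t w js(1) p(1)])
    qed
    then show ?thesis
      by (intro determined_byD[OF A(2) sample_in_space[OF wM] step_sample_in_space])
  qed
  have eq: "{\<omega>\<in>space M. sample \<omega> \<in> A} = (\<Union>d\<in>?D. atom K t d)"
  proof (intro set_eqI iffI)
    fix \<omega> assume w: "\<omega> \<in> {\<omega>\<in>space M. sample \<omega> \<in> A}"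
    define d where "d = (\<lambda>j\<in>{1..n}. \<lambda>l\<in>{..<K}. X j (t (Suc l)) \<omega> - X j (t l) \<omega>)"
    have "\<omega> \<in> atom K t d" using w unfolding atom_def d_def by simp
    moreover from this have "d \<in> ?D" using agree[of \<omega> d] w unfolding d_def by auto
    ultimately show "\<omega> \<in> (\<Union>d\<in>?D. atom K t d)" by blast
  next
    fix \<omega> assume "\<omega> \<in> (\<Union>d\<in>?D. atom K t d)"
    then obtain d where "d \<in> ?D" "\<omega> \<in> atom K t d" by blast
    then show "\<omega> \<in> {\<omega>\<in>space M. sample \<omega> \<in> A}" using agree by (auto simp: atom_def)
  qed
  have count: "countable ?D"
    by (rule countable_subset[of _ "PiE {1..n} (\<lambda>_. PiE {..<K} (\<lambda>_. UNIV))"]) (auto intro!: countable_PiE)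
  have disj: "disjoint_family_on (atom K t) ?D"
    unfolding disjoint_family_on_def
  proof (intro ballI impI)
    fix d e assume de: "d \<in> ?D" "e \<in> ?D" "d \<noteq> e"
    have "d = e" if w: "\<omega> \<in> atom K t d" "\<omega> \<in> atom K t e" for \<omega>
    proof (rule PiE_ext)
      show "d \<in> PiE {1..n} (\<lambda>_. PiE {..<K} (\<lambda>_. UNIV))" "e \<in> PiE {1..n} (\<lambda>_. PiE {..<K} (\<lambda>_. UNIV))"
        using de by blast+
      fix j assume j: "j \<in> {1..n}"
      show "d j = e j"
      proof (rule PiE_ext)
        show "d j \<in> PiE {..<K} (\<lambda>_. UNIV)" "e j \<in> PiE {..<K} (\<lambda>_. UNIV)"
          using de j by blast+
        show "d j l = e j l" if "l \<in> {..<K}" for l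
          using w j that unfolding atom_def by auto
      qed
    qed
    then show "atom K t d \<inter> atom K t e = {}" using de(3) by blast
  qed
  have "emeasure law A = emeasure M (\<Union>d\<in>?D. atom K t d)"
    unfolding emeasure_law[OF A(1)] eq ..
  also have "\<dots> = (\<integral>\<^sup>+ d. emeasure M (atom K t d) \<partial>count_space ?D)"
    by (rule emeasure_UN_countable[OF _ count disj]) (rule atom_events[OF t(2)])
  also have "(\<lambda>d. emeasure M (atom K t d)) =
      (\<lambda>d. ennreal (\<Prod>j\<in>{1..n}. \<Prod>l<K. poisson_weight (mean_measure lam (t l) (t (Suc l))) (d j l)))"
    unfolding emeasure_eq_measure atom_def
    by (subst prob_increment_matrix[where K = K and t = t, OF t(2,3)]) simp_all
  finally show ?thesis .
qed

end

text \<open>An inequality between the products of Poisson weights, for every refinement t of the finitely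
  many times \<Gamma> that determine E, becomes an inequality between the laws restricted to E. A
  cylinder C is handled by refining \<Gamma> with its own times; general C follow by approximation.\<close>

lemma sample_law_le:
  fixes M1 :: "'w measure" and M2 :: "'v measure"
  assumes S1: "poisson_sample M1 n \<tau> lam1 X1" and S2: "poisson_sample M2 n \<tau> lam2 X2"
    and \<Gamma>: "finite \<Gamma>" "\<Gamma> \<subseteq> {0..\<tau>}"
    and E: "E \<in> sets (sample_space n \<tau>)" "determined_by n \<tau> \<Gamma> E"
    and c: "0 \<le> c"
    and weights: "\<And>K t d. t 0 = 0 \<Longrightarrow> (\<And>i. i \<le> K \<Longrightarrow> t i \<in> {0..\<tau>}) \<Longrightarrow> (\<And>i. i < K \<Longrightarrow> t i < t (Suc i)) \<Longrightarrow>
      \<Gamma> \<subseteq> t ` {..K} \<Longrightarrow> step_sample n \<tau> K t d \<in> E \<Longrightarrow>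
      c * (\<Prod>j\<in>{1..n}. \<Prod>l<K. poisson_weight (mean_measure lam2 (t l) (t (Suc l))) (d j l)) \<le>
      (\<Prod>j\<in>{1..n}. \<Prod>l<K. poisson_weight (mean_measure lam1 (t l) (t (Suc l))) (d j l))"
    and C: "C \<in> sets (sample_space n \<tau>)"
  shows "ennreal c * emeasure (sample_law n \<tau> M2 X2) (C \<inter> E) \<le> emeasure (sample_law n \<tau> M1 X1) (C \<inter> E)"
proof -
  interpret S1: poisson_sample M1 n \<tau> lam1 X1 by fact
  interpret S2: poisson_sample M2 n \<tau> lam2 X2 by fact
  interpret L1: prob_space S1.law by (rule S1.prob_space_law)
  interpret L2: prob_space S2.law by (rule S2.prob_space_law)
  have tau: "0 \<le> \<tau>" by (rule S1.tau_nonneg)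
  have cyl: "ennreal c * emeasure S2.law (C \<inter> E) \<le> emeasure S1.law (C \<inter> E)"
    if C: "C \<in> cylinders n \<tau>" for C
  proof -
    obtain F where F: "finite F" "F \<subseteq> {0..\<tau>}" "determined_by n \<tau> F C" "C \<in> sets (sample_space n \<tau>)"
      using C unfolding cylinders_def by blast
    have "finite (insert 0 (F \<union> \<Gamma>))" "0 \<in> insert 0 (F \<union> \<Gamma>)" "insert 0 (F \<union> \<Gamma>) \<subseteq> {0..\<tau>}"
      using F \<Gamma> tau by auto
    then obtain K t where t: "t 0 = 0" "\<And>i. i < K \<Longrightarrow> t i < t (Suc i)" and im: "t ` {..K} = insert 0 (F \<union> \<Gamma>)"
      by (rule increasing_enumeration) blast
    have t': "t i \<in> {0..\<tau>}" if "i \<le> K" for i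
      using im that F(2) \<Gamma>(2) tau by (metis (no_types, lifting) Un_subset_iff atLeastAtMost_iff atMost_iff image_eqI insert_iff order_refl subset_iff)
    have det: "determined_by n \<tau> (t ` {..K}) (C \<inter> E)"
      unfolding im by (intro determined_by_Int determined_by_mono[OF F(3)] determined_by_mono[OF E(2)]) auto
    have sets: "C \<inter> E \<in> sets (sample_space n \<tau>)" using F(4) E(1) by blast
    let ?D = "{d \<in> PiE {1..n} (\<lambda>_. PiE {..<K} (\<lambda>_. UNIV)). step_sample n \<tau> K t d \<in> C \<inter> E}"
    let ?w = "\<lambda>lam d. \<Prod>j\<in>{1..n}. \<Prod>l<K. poisson_weight (mean_measure lam (t l) (t (Suc l))) (d j l)"
    have "ennreal c * emeasure S2.law (C \<inter> E) = ennreal c * (\<integral>\<^sup>+ d. ennreal (?w lam2 d) \<partial>count_space ?D)"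
      by (subst S2.emeasure_law_determined[where K = K and t = t]) (use t t' sets det in auto)
    also have "\<dots> = (\<integral>\<^sup>+ d. ennreal c * ennreal (?w lam2 d) \<partial>count_space ?D)"
      by (rule nn_integral_cmult[symmetric]) simp
    also have "\<dots> \<le> (\<integral>\<^sup>+ d. ennreal (?w lam1 d) \<partial>count_space ?D)"
    proof (rule nn_integral_mono)
      fix d assume "d \<in> space (count_space ?D)"
      then have "step_sample n \<tau> K t d \<in> E" by simp
      then have "c * ?w lam2 d \<le> ?w lam1 d" using t t' im by (intro weights) auto
      then show "ennreal c * ennreal (?w lam2 d) \<le> ennreal (?w lam1 d)"
        using c by (simp add: ennreal_mult'[symmetric] ennreal_leI)
    qed
    also have "\<dots> = emeasure S1.law (C \<inter> E)"
      by (subst S1.emeasure_law_determined[where K = K and t = t]) (use t t' sets det in auto)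
    finally show ?thesis .
  qed
  define \<mu> where "\<mu> = scale_measure (ennreal c) (density S2.law (indicator E))"
  define \<nu> where "\<nu> = density S1.law (indicator E)"
  have mu: "emeasure \<mu> A = ennreal c * emeasure S2.law (A \<inter> E)" if "A \<in> sets (sample_space n \<tau>)" for A
    using that E(1) by (simp add: \<mu>_def emeasure_restricted Int_commute)
  have nu: "emeasure \<nu> A = emeasure S1.law (A \<inter> E)" if "A \<in> sets (sample_space n \<tau>)" for A
    using that E(1) by (simp add: \<nu>_def emeasure_restricted Int_commute)
  have spaces: "space \<mu> = space (sample_space n \<tau>)" "space \<nu> = space (sample_space n \<tau>)"
    by (rule sets_eq_imp_space_eq, simp add: \<mu>_def \<nu>_def)+
  have fmu: "finite_measure \<mu>"
    by (rule finite_measureI) (simp add: spaces mu ennreal_mult_eq_top_iff)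
  have fnu: "finite_measure \<nu>"
    by (rule finite_measureI) (simp add: spaces nu)
  have "measure \<mu> C \<le> measure \<nu> C"
  proof (rule measure_le_from_algebra[OF algebra_cylinders fmu fnu])
    show "sets \<mu> = sigma_sets (space (sample_space n \<tau>)) (cylinders n \<tau>)"
      "sets \<nu> = sigma_sets (space (sample_space n \<tau>)) (cylinders n \<tau>)"
      unfolding sigma_sets_cylinders \<mu>_def \<nu>_def by simp_all
    show "C \<in> sigma_sets (space (sample_space n \<tau>)) (cylinders n \<tau>)"
      unfolding sigma_sets_cylinders by (rule C)
    fix B assume B: "B \<in> cylinders n \<tau>"
    then have "emeasure \<mu> B \<le> emeasure \<nu> B"
      using cyl[OF B] mu[of B] nu[of B] by (simp add: cylinders_def)
    then show "measure \<mu> B \<le> measure \<nu> B"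
      using finite_measure.emeasure_eq_measure[OF fmu] finite_measure.emeasure_eq_measure[OF fnu] by simp
  qed
  then have "emeasure \<mu> C \<le> emeasure \<nu> C"
    using finite_measure.emeasure_eq_measure[OF fmu] finite_measure.emeasure_eq_measure[OF fnu]
    by (simp add: ennreal_leI)
  then show ?thesis using mu[OF C] nu[OF C] by simp
qed

section \<open>The ramp intensities\<close>

text \<open>The antiderivative, vanishing on the negative half-line, of the function that rises linearly
  from 0 to 1 on the interval from 0 to d. Written as a difference of squares of positive parts it is smooth
  enough for the fundamental theorem of calculus without a case distinction at 0 and d.\<close>

definition ramp :: "real \<Rightarrow> real \<Rightarrow> real" where
  "ramp d x = ((max 0 x)\<^sup>2 - (max 0 (x - d))\<^sup>2) / (2 * d)"

lemma ramp_left: "x \<le> 0 \<Longrightarrow> 0 < d \<Longrightarrow> ramp d x = 0"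
  by (simp add: ramp_def max_def)

lemma ramp_right: "d \<le> x \<Longrightarrow> 0 < d \<Longrightarrow> ramp d x = x - d / 2"
  by (simp add: ramp_def max_def field_simps power2_eq_square)

lemma has_real_derivative_max_0_square:
  "((\<lambda>x. (max 0 x)\<^sup>2) has_real_derivative 2 * max 0 x) (at x)" for x :: real
proof (cases x "0::real" rule: linorder_cases)
  case less
  have "((\<lambda>x. 0) has_real_derivative 2 * max 0 x) (at x)" using less by simp
  moreover have "eventually (\<lambda>y. y < 0) (nhds x)" 
    using less by (auto simp: eventually_nhds intro!: exI[of _ "{..<0}"])
  ultimately show ?thesis
    by (subst DERIV_cong_ev[OF refl _ refl, where g = "\<lambda>x. 0"]) (auto elim!: eventually_mono)
next
  case greater
  have "((\<lambda>x. x\<^sup>2) has_real_derivative 2 * max 0 x) (at x)" using greater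
    by (auto intro!: derivative_eq_intros)
  moreover have "eventually (\<lambda>y. y > 0) (nhds x)"
    using greater by (auto simp: eventually_nhds intro!: exI[of _ "{0<..}"])
  ultimately show ?thesis
    by (subst DERIV_cong_ev[OF refl _ refl, where g = "\<lambda>x. x\<^sup>2"]) (auto elim!: eventually_mono)
next
  case equal
  have "((\<lambda>h. (max 0 h)\<^sup>2 / h) \<longlongrightarrow> 0) (at (0::real))"
  proof (rule Lim_null_comparison)
    show "\<forall>\<^sub>F h in at (0::real). norm ((max 0 h)\<^sup>2 / h) \<le> \<bar>h\<bar>"
      by (auto simp: max_def power2_eq_square eventually_at_filter)
    show "((\<lambda>h::real. \<bar>h\<bar>) \<longlongrightarrow> 0) (at 0)" by (rule tendsto_eq_intros | simp)+
  qed
  then show ?thesis using equal by (simp add: DERIV_def)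
qed

lemma has_real_derivative_ramp:
  assumes "0 < d"
  shows "(ramp d has_real_derivative (max 0 x - max 0 (x - d)) / d) (at x)"
proof -
  have "((\<lambda>x. (max 0 (x - d))\<^sup>2) has_real_derivative 2 * max 0 (x - d) * 1) (at x)"
    by (rule DERIV_chain2[OF has_real_derivative_max_0_square]) (auto intro!: derivative_eq_intros)
  from DERIV_diff[OF has_real_derivative_max_0_square[of x] this]
  have "((\<lambda>x. ((max 0 x)\<^sup>2 - (max 0 (x - d))\<^sup>2) / (2 * d)) has_real_derivative
      (2 * max 0 x - 2 * max 0 (x - d) * 1) / (2 * d)) (at x)"
    by (rule DERIV_cdivide)
  moreover have "(2 * max 0 x - 2 * max 0 (x - d) * 1) / (2 * d) = (max 0 x - max 0 (x - d)) / d"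
    using assms by (simp add: field_simps)
  moreover have "ramp d = (\<lambda>x. ((max 0 x)\<^sup>2 - (max 0 (x - d))\<^sup>2) / (2 * d))"
    by (simp add: fun_eq_iff ramp_def)
  ultimately show ?thesis by simp
qed

lemma intensity_eq:
  assumes "0 < d" "0 \<le> t" "t \<le> \<tau>"
  shows "intensity \<psi> r \<tau> d \<theta> t = \<psi> t + r * ((max 0 (t - \<theta>) - max 0 (t - \<theta> - d)) / d)"
  using assms by (auto simp: intensity_def indicator_def max_def field_simps)

lemma mean_measure_intensity:
  assumes d: "0 < d" and psi: "continuous_on {0..\<tau>} \<psi>" and st: "0 \<le> s" "s \<le> t" "t \<le> \<tau>"
  shows "mean_measure (intensity \<psi> r \<tau> d \<theta>) s t =
    mean_measure \<psi> s t + r * (ramp d (t - \<theta>) - ramp d (s - \<theta>))"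
proof -
  let ?c = "\<lambda>x. (max 0 (x - \<theta>) - max 0 (x - \<theta> - d)) / d"
  have deriv: "((\<lambda>x. ramp d (x - \<theta>)) has_real_derivative ?c x) (at x)" for x
  proof -
    have "((\<lambda>x. x - \<theta>) has_real_derivative 1) (at x)" by (auto intro!: derivative_eq_intros)
    from DERIV_chain2[OF has_real_derivative_ramp[OF d] this] show ?thesis by simp
  qed
  have cont: "continuous_on {s..t} ?c" using d by (intro continuous_intros) auto
  have vd: "((\<lambda>x. ramp d (x - \<theta>)) has_vector_derivative ?c x) (at x within {s..t})" for x
    using deriv[of x] has_vector_derivative_at_within
    by (simp add: has_real_derivative_iff_has_vector_derivative has_vector_derivative_at_within)
  have int_c: "set_integrable lborel {s..t} ?c"
    by (rule borel_integrable_atLeastAtMost') (rule cont)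
  have "continuous_on {s..t} \<psi>" using psi st by (auto intro: continuous_on_subset)
  then have int_psi: "set_integrable lborel {s..t} \<psi>" by (rule borel_integrable_atLeastAtMost')
  have val: "(LINT x:{s..t}|lborel. ?c x) = ramp d (t - \<theta>) - ramp d (s - \<theta>)"
    unfolding set_lebesgue_integral_def by (rule integral_FTC_Icc[OF st(2) vd cont])
  have "mean_measure (intensity \<psi> r \<tau> d \<theta>) s t = (LINT x:{s..t}|lborel. \<psi> x + r * ?c x)"
    by (rule set_lebesgue_integral_cong) (use d st in \<open>auto simp: intensity_eq\<close>)
  also have "\<dots> = mean_measure \<psi> s t + (LINT x:{s..t}|lborel. r * ?c x)"
    by (rule set_integral_add(2)[OF int_psi set_integrable_mult_right]) (use int_c in simp)
  also have "(LINT x:{s..t}|lborel. r * ?c x) = r * (ramp d (t - \<theta>) - ramp d (s - \<theta>))"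
    unfolding val[symmetric] by (rule set_integral_mult_right)
  finally show ?thesis .
qed

locale change_model =
  fixes \<tau> r :: real and \<psi> :: "real \<Rightarrow> real"
  assumes tau_pos: "0 < \<tau>"
    and psi_cont: "continuous_on {0..\<tau>} \<psi>"
    and psi_pos: "\<forall>t\<in>{0..\<tau>}. \<psi> t > 0"
    and r_lower: "r > - (INF t\<in>{0..\<tau>}. \<psi> t)"
begin

abbreviation mean_count :: "real \<Rightarrow> real \<Rightarrow> real \<Rightarrow> real \<Rightarrow> real" where
  "mean_count d \<theta> \<equiv> mean_measure (intensity \<psi> r \<tau> d \<theta>)"

lemma psi_integrable:
  assumes "0 \<le> s" "t \<le> \<tau>"
  shows "set_integrable lborel {s..t} \<psi>"
  by (rule borel_integrable_atLeastAtMost') (use psi_cont assms in \<open>auto intro: continuous_on_subset\<close>)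

lemma psi_bounds:
  obtains \<kappa> C where "0 < \<kappa>" "\<And>t. t \<in> {0..\<tau>} \<Longrightarrow> \<kappa> \<le> \<psi> t \<and> \<kappa> \<le> \<psi> t + r \<and> \<psi> t \<le> C \<and> \<psi> t + r \<le> C"
proof -
  have ne: "{0..\<tau>} \<noteq> {}" using tau_pos by simp
  obtain a where a: "a \<in> {0..\<tau>}" "\<And>t. t \<in> {0..\<tau>} \<Longrightarrow> \<psi> a \<le> \<psi> t"
    using continuous_attains_inf[OF compact_Icc ne psi_cont] by blast
  obtain b where b: "b \<in> {0..\<tau>}" "\<And>t. t \<in> {0..\<tau>} \<Longrightarrow> \<psi> t \<le> \<psi> b"
    using continuous_attains_sup[OF compact_Icc ne psi_cont] by blast
  have "(INF t\<in>{0..\<tau>}. \<psi> t) = \<psi> a"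
    by (rule cInf_eq_minimum) (use a in auto)
  then have "0 < \<psi> a + r" using r_lower by simp
  moreover have "0 < \<psi> a" using psi_pos a(1) by blast
  ultimately have pos: "0 < min (\<psi> a) (\<psi> a + r)" by simp
  have "min (\<psi> a) (\<psi> a + r) \<le> \<psi> t \<and> min (\<psi> a) (\<psi> a + r) \<le> \<psi> t + r \<and>
      \<psi> t \<le> max (\<psi> b) (\<psi> b + r) \<and> \<psi> t + r \<le> max (\<psi> b) (\<psi> b + r)" if "t \<in> {0..\<tau>}" for t
    using a(2)[OF that] b(2)[OF that] by (simp add: min_le_iff_disj le_max_iff_disj)
  then show ?thesis using that[OF pos] by blast
qed

lemma intensity_convex:
  assumes "0 < d" "t \<in> {0..\<tau>}"
  obtains u where "0 \<le> u" "u \<le> 1" "intensity \<psi> r \<tau> d \<theta> t = (1 - u) * \<psi> t + u * (\<psi> t + r)"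
proof -
  define u where "u = (max 0 (t - \<theta>) - max 0 (t - \<theta> - d)) / d"
  have "0 \<le> u" "u \<le> 1" using assms(1) unfolding u_def by (auto simp: max_def field_simps)
  moreover have "intensity \<psi> r \<tau> d \<theta> t = \<psi> t + r * u"
    using assms unfolding u_def by (intro intensity_eq) auto
  moreover have "\<psi> t + r * u = (1 - u) * \<psi> t + u * (\<psi> t + r)" by (simp add: algebra_simps)
  ultimately show ?thesis using that[of u] by simp
qed

lemma intensity_bounds:
  obtains \<kappa> C where "0 < \<kappa>" "\<And>d \<theta> t. 0 < d \<Longrightarrow> t \<in> {0..\<tau>} \<Longrightarrow> \<kappa> \<le> intensity \<psi> r \<tau> d \<theta> t \<and> intensity \<psi> r \<tau> d \<theta> t \<le> C"
proof -
  obtain \<kappa> C where k: "0 < \<kappa>" "\<And>t. t \<in> {0..\<tau>} \<Longrightarrow> \<kappa> \<le> \<psi> t \<and> \<kappa> \<le> \<psi> t + r \<and> \<psi> t \<le> C \<and> \<psi> t + r \<le> C"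
    using psi_bounds by blast
  have "\<kappa> \<le> intensity \<psi> r \<tau> d \<theta> t \<and> intensity \<psi> r \<tau> d \<theta> t \<le> C" if dt: "0 < d" "t \<in> {0..\<tau>}" for d \<theta> t
  proof -
    obtain u where u: "0 \<le> u" "u \<le> 1" "intensity \<psi> r \<tau> d \<theta> t = (1 - u) * \<psi> t + u * (\<psi> t + r)"
      using intensity_convex[OF dt] by blast
    have "(1 - u) * \<kappa> + u * \<kappa> \<le> (1 - u) * \<psi> t + u * (\<psi> t + r)"
      using u k(2)[OF dt(2)] by (intro add_mono mult_left_mono) auto
    moreover have "(1 - u) * \<psi> t + u * (\<psi> t + r) \<le> (1 - u) * C + u * C"
      using u k(2)[OF dt(2)] by (intro add_mono mult_left_mono) auto
    ultimately show ?thesis using u(3) by (simp add: algebra_simps)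
  qed
  then show ?thesis using that k(1) by blast
qed

lemma intensity_integrable:
  assumes "0 < d" "0 \<le> s" "t \<le> \<tau>"
  shows "set_integrable lborel {s..t} (intensity \<psi> r \<tau> d \<theta>)"
proof (rule borel_integrable_atLeastAtMost')
  have "continuous_on {s..t} \<psi>" using psi_cont assms by (auto intro: continuous_on_subset)
  then have "continuous_on {s..t} (\<lambda>x. \<psi> x + r * ((max 0 (x - \<theta>) - max 0 (x - \<theta> - d)) / d))"
    using assms by (intro continuous_intros) auto
  then show "continuous_on {s..t} (intensity \<psi> r \<tau> d \<theta>)"
    by (rule continuous_on_cong[THEN iffD1, rotated -1]) (use assms in \<open>auto simp: intensity_eq\<close>)
qed

lemma mean_intensity_bounds:
  obtains \<kappa> C where "0 < \<kappa>" "\<And>d \<theta> s t. 0 < d \<Longrightarrow> 0 \<le> s \<Longrightarrow> s \<le> t \<Longrightarrow> t \<le> \<tau> \<Longrightarrow>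
     \<kappa> * (t - s) \<le> mean_count d \<theta> s t \<and>
     mean_count d \<theta> s t \<le> C * (t - s)"
proof -
  obtain \<kappa> C where k: "0 < \<kappa>" "\<And>d \<theta> t. 0 < d \<Longrightarrow> t \<in> {0..\<tau>} \<Longrightarrow> \<kappa> \<le> intensity \<psi> r \<tau> d \<theta> t \<and> intensity \<psi> r \<tau> d \<theta> t \<le> C"
    using intensity_bounds by blast
  have "\<kappa> * (t - s) \<le> mean_count d \<theta> s t \<and>
     mean_count d \<theta> s t \<le> C * (t - s)"
    if a: "0 < d" "0 \<le> s" "s \<le> t" "t \<le> \<tau>" for d \<theta> s t
  proof -
    have i: "set_integrable lborel {s..t} (\<lambda>_. c)" for c :: real
      by (rule borel_integrable_atLeastAtMost') simp
    have v: "(LINT x:{s..t}|lborel. c) = c * (t - s)" for c :: real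
      using a by (simp add: set_lebesgue_integral_def)
    have "(LINT x:{s..t}|lborel. \<kappa>) \<le> mean_count d \<theta> s t"
      "mean_count d \<theta> s t \<le> (LINT x:{s..t}|lborel. C)"
      using a k(2) by (auto intro!: set_integral_mono i intensity_integrable)
    then show ?thesis unfolding v by simp
  qed
  then show ?thesis using that k(1) by blast
qed

lemma mean_intensity_pos:
  assumes "0 < d" "0 \<le> s" "s < t" "t \<le> \<tau>"
  shows "0 < mean_count d \<theta> s t"
proof -
  obtain \<kappa> C where "0 < \<kappa>" "\<And>d \<theta> s t. 0 < d \<Longrightarrow> 0 \<le> s \<Longrightarrow> s \<le> t \<Longrightarrow> t \<le> \<tau> \<Longrightarrow>
     \<kappa> * (t - s) \<le> mean_count d \<theta> s t \<and>
     mean_count d \<theta> s t \<le> C * (t - s)"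
    using mean_intensity_bounds by metis
  then have "0 < \<kappa> * (t - s)" "\<kappa> * (t - s) \<le> mean_count d \<theta> s t"
    using assms by auto
  then show ?thesis by linarith
qed

lemma mean_psi_ratio:
  assumes "0 \<le> s" "s \<le> t" "t \<le> \<tau>" and \<rho>: "\<And>x. x \<in> {s..t} \<Longrightarrow> \<rho> * \<psi> x \<le> \<psi> x + r"
  shows "\<rho> * mean_measure \<psi> s t \<le> mean_measure \<psi> s t + r * (t - s)"
proof -
  have i: "set_integrable lborel {s..t} \<psi>" using assms by (intro psi_integrable)
  have ir: "set_integrable lborel {s..t} (\<lambda>_. r)" by (rule borel_integrable_atLeastAtMost') simp
  have "\<rho> * mean_measure \<psi> s t = (LINT x:{s..t}|lborel. \<rho> * \<psi> x)" by simp
  also have "\<dots> \<le> (LINT x:{s..t}|lborel. \<psi> x + r)"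
    using i ir \<rho> by (intro set_integral_mono set_integral_add) auto
  also have "\<dots> = mean_measure \<psi> s t + (LINT x:{s..t}|lborel. r)" by (rule set_integral_add(2)[OF i ir])
  also have "(LINT x:{s..t}|lborel. r) = r * (t - s)"
    using assms by (simp add: set_lebesgue_integral_def)
  finally show ?thesis .
qed

text \<open>The factor exp (- (p - q)) is the exact ratio of the normalising constants, and each of the k
  points contributes p / q, which is at least c.\<close>

lemma poisson_weight_ratio:
  assumes "0 \<le> q" "0 \<le> c" "c * q \<le> p"
  shows "exp (- (p - q)) * c ^ k * poisson_weight q k \<le> poisson_weight p k"
proof -
  have "exp (- (p - q)) * c ^ k * poisson_weight q k = (c * q) ^ k / fact k * exp (- p)"
    by (simp add: poisson_weight_def power_mult_distrib mult_exp_exp exp_diff exp_minus field_simps)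
  also have "\<dots> \<le> p ^ k / fact k * exp (- p)"
    using assms by (intro mult_right_mono divide_right_mono power_mono) auto
  finally show ?thesis by (simp add: poisson_weight_def)
qed

text \<open>Outside the ramps that start at the two change points, the intensities agree except between
  \<theta> + d and \<theta>', where \<psi> + r faces \<psi>. Inside a ramp the ratio of the intensities is not
  controlled by \<rho>, and the interval has to be free of points.\<close>

lemma interval_weight_ratio:
  assumes d: "0 < d" and th: "\<theta> + d \<le> \<theta>'" and st: "0 \<le> s" "s < t" "t \<le> \<tau>"
    and c: "0 < \<rho>" "\<And>x. x \<in> {\<theta>..\<theta>'} \<Longrightarrow> x \<in> {0..\<tau>} \<Longrightarrow> \<rho> * \<psi> x \<le> \<psi> x + r"
    and pos: "t \<le> \<theta> \<or> (\<theta> + d \<le> s \<and> t \<le> \<theta>') \<or> \<theta>' + d \<le> s \<or> k = 0"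
  shows "exp (- (mean_count d \<theta> s t - mean_count d \<theta>' s t)) *
      (if \<theta> \<le> s \<and> t \<le> \<theta>' then \<rho> ^ k else 1) * poisson_weight (mean_count d \<theta>' s t) k
    \<le> poisson_weight (mean_count d \<theta> s t) k" (is "exp (- (?p - ?q)) * ?c * _ \<le> _")
proof -
  have q: "0 < ?q" and p: "0 < ?p" using mean_intensity_pos[OF d st] by auto
  note mean = mean_measure_intensity[OF d psi_cont, of s t, OF st(1) less_imp_le[OF st(2)] st(3)]
  consider (zero) "k = 0" | (out) "?p = ?q" "\<not> (\<theta> \<le> s \<and> t \<le> \<theta>')"
    | (inside) "\<rho> * ?q \<le> ?p" "\<theta> \<le> s \<and> t \<le> \<theta>'"
  proof -
    consider "k = 0" | "t \<le> \<theta>" | "\<theta> + d \<le> s" "t \<le> \<theta>'" | "\<theta>' + d \<le> s" using pos by blast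
    then show thesis
    proof cases
      case 2
      then show ?thesis using out d th st by (simp add: mean ramp_left)
    next
      case 3
      have "?p = mean_measure \<psi> s t + r * (t - s)" "?q = mean_measure \<psi> s t"
        using 3 d st th by (simp_all add: mean ramp_left ramp_right)
      moreover have "\<rho> * mean_measure \<psi> s t \<le> mean_measure \<psi> s t + r * (t - s)"
        using 3 d st by (intro mean_psi_ratio c(2)) auto
      ultimately show ?thesis using inside 3 d by simp
    next
      case 4
      then show ?thesis using out d th st by (simp add: mean ramp_right)
    qed (use zero in blast)
  qed
  then show ?thesis
  proof cases
    case zero
    then show ?thesis by (simp add: poisson_weight_def mult_exp_exp)
  next
    case out
    have c1: "?c = 1" using out(2) by (rule if_not_P)
    show ?thesis unfolding c1 out(1) by simp
  next
    case inside
    then show ?thesis using poisson_weight_ratio[of ?q \<rho> ?p k] q c(1) by simp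
  qed
qed

text \<open>The comparison of two change points. The exponential factors of all intervals multiply up to
  the exponential of the total difference n r (\<theta>' - \<theta>) of the mean measures, and the factors \<rho>
  collect the m points between the change points. The area of a ramp is the same for both change
  points, which is why the width d does not show in the exponent.\<close>

lemma law_le:
  fixes M1 :: "'w measure" and M2 :: "'v measure"
  assumes S1: "poisson_sample M1 n \<tau> (intensity \<psi> r \<tau> d \<theta>) X1"
    and S2: "poisson_sample M2 n \<tau> (intensity \<psi> r \<tau> d \<theta>') X2"
    and d: "0 < d" and th: "0 \<le> \<theta>" "\<theta> + d \<le> \<theta>'" "\<theta>' + d \<le> \<tau>"
    and c: "0 < \<rho>" "\<And>x. x \<in> {\<theta>..\<theta>'} \<Longrightarrow> x \<in> {0..\<tau>} \<Longrightarrow> \<rho> * \<psi> x \<le> \<psi> x + r"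
    and \<Gamma>: "finite \<Gamma>" "\<Gamma> \<subseteq> {0..\<tau>}" "{\<theta>, \<theta> + d, \<theta>', \<theta>' + d} \<subseteq> \<Gamma>"
    and E: "E \<in> sets (sample_space n \<tau>)" "determined_by n \<tau> \<Gamma> E"
    and no_points: "\<And>x j. x \<in> E \<Longrightarrow> j \<in> {1..n} \<Longrightarrow> x j (\<theta> + d) - x j \<theta> = 0 \<and> x j (\<theta>' + d) - x j \<theta>' = 0"
    and count: "\<And>x. x \<in> E \<Longrightarrow> (\<And>j. j \<in> {1..n} \<Longrightarrow> mono_on {0..\<tau>} (x j)) \<Longrightarrow> (\<Sum>j\<in>{1..n}. x j \<theta>' - x j \<theta>) = m"
    and C: "C \<in> sets (sample_space n \<tau>)"
  shows "ennreal (exp (- (real n * r * (\<theta>' - \<theta>))) * \<rho> ^ m) * emeasure (sample_law n \<tau> M2 X2) (C \<inter> E)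
    \<le> emeasure (sample_law n \<tau> M1 X1) (C \<inter> E)"
proof (rule sample_law_le[OF S1 S2 \<Gamma>(1,2) E _ _ C])
  show "0 \<le> exp (- (real n * r * (\<theta>' - \<theta>))) * \<rho> ^ m" using c(1) by simp
next
  fix K :: nat and t :: "nat \<Rightarrow> real" and e :: "nat \<Rightarrow> nat \<Rightarrow> nat"
  assume t: "t 0 = 0" "\<And>i. i \<le> K \<Longrightarrow> t i \<in> {0..\<tau>}" "\<And>i. i < K \<Longrightarrow> t i < t (Suc i)" "\<Gamma> \<subseteq> t ` {..K}"
    and eE: "step_sample n \<tau> K t e \<in> E"
  let ?x = "step_sample n \<tau> K t e"
  define P where "P l = mean_count d \<theta> (t l) (t (Suc l))" for l
  define Q where "Q l = mean_count d \<theta>' (t l) (t (Suc l))" for l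
  define L where "L = {l. l < K \<and> \<theta> \<le> t l \<and> t (Suc l) \<le> \<theta>'}"
  have le_iff: "t i \<le> t j \<longleftrightarrow> i \<le> j" if "i \<le> K" "j \<le> K" for i j
    using increasing_le_iff[where t = t and K = K, OF t(3) that] .
  have "\<theta> \<in> t ` {..K}" "\<theta> + d \<in> t ` {..K}" "\<theta>' \<in> t ` {..K}" "\<theta>' + d \<in> t ` {..K}"
    using \<Gamma>(3) t(4) by auto
  then obtain p p1 q q1 where idx: "p \<le> K" "p1 \<le> K" "q \<le> K" "q1 \<le> K"
    "t p = \<theta>" "t p1 = \<theta> + d" "t q = \<theta>'" "t q1 = \<theta>' + d"
    by (auto simp: image_iff)
  have ord: "p \<le> p1" "p1 \<le> q" "q \<le> q1" using le_iff idx d th by (metis add.commute add_le_same_cancel2 less_imp_le order.trans le_add_same_cancel1)+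
  have x_at: "?x j (t i) = (\<Sum>l<i. e j l)" if "j \<in> {1..n}" "i \<le> K" for i j
    using step_sample_at[where t = t and K = K, OF t(3) t(2)[OF that(2)] that(2,1)] .
  have x_diff: "?x j (t i') - ?x j (t i) = (\<Sum>l\<in>{i..<i'}. e j l)" if "j \<in> {1..n}" "i \<le> i'" "i' \<le> K" for i i' j
  proof -
    have "{..<i'} = {..<i} \<union> {i..<i'}" using that by auto
    then have "(\<Sum>l<i'. e j l) = (\<Sum>l<i. e j l) + (\<Sum>l\<in>{i..<i'}. e j l)"
      by (simp add: sum.union_disjoint ivl_disj_int)
    then show ?thesis using that by (simp add: x_at)
  qed
  have zero: "e j l = 0" if "j \<in> {1..n}" "l \<in> {p..<p1} \<union> {q..<q1}" for j l
    using no_points[OF eE that(1)] that(2) x_diff[OF that(1), of p p1] x_diff[OF that(1), of q q1] idx ord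
    by auto
  have L_eq: "L = {p..<q}"
    using idx le_iff unfolding L_def by (auto simp: Suc_le_eq)
  have mono: "mono_on {0..\<tau>} (?x j)" if "j \<in> {1..n}" for j
    unfolding step_sample_def using that by (intro mono_onI) (auto intro!: sum_mono2)
  have m: "m = (\<Sum>j\<in>{1..n}. \<Sum>l\<in>L. e j l)"
  proof -
    have "m = (\<Sum>j\<in>{1..n}. ?x j (t q) - ?x j (t p))"
      using count[OF eE mono] idx by simp
    also have "\<dots> = (\<Sum>j\<in>{1..n}. \<Sum>l\<in>L. e j l)"
      unfolding L_eq using idx ord by (intro sum.cong refl x_diff) auto
    finally show ?thesis .
  qed
  have one: "exp (- (P l - Q l)) * (if l \<in> L then \<rho> ^ e j l else 1) * poisson_weight (Q l) (e j l) \<le> poisson_weight (P l) (e j l)"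
    if jl: "j \<in> {1..n}" "l < K" for j l
  proof -
    \<comment> \<open>The ends of the ramps are among the times, so no interval straddles them.\<close>
    have cases: "t (Suc l) \<le> \<theta> \<or> (\<theta> + d \<le> t l \<and> t (Suc l) \<le> \<theta>') \<or> \<theta>' + d \<le> t l \<or> e j l = 0"
    proof (rule ccontr)
      assume *: "\<not> ?thesis"
      then have "\<not> Suc l \<le> p" "\<not> (p1 \<le> l \<and> Suc l \<le> q)" "\<not> q1 \<le> l"
        using le_iff[of "Suc l" p] le_iff[of p1 l] le_iff[of "Suc l" q] le_iff[of q1 l] idx jl by auto
      then have "l \<in> {p..<p1} \<union> {q..<q1}" by auto
      then have "e j l = 0" by (rule zero[OF jl(1)])
      then show False using * by simp
    qed
    have st: "0 \<le> t l" "t l < t (Suc l)" "t (Suc l) \<le> \<tau>" using t jl by auto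
    have "l \<in> L \<longleftrightarrow> \<theta> \<le> t l \<and> t (Suc l) \<le> \<theta>'" using jl(2) unfolding L_def by simp
    then show ?thesis
      using interval_weight_ratio[OF d th(2) st c(1) _ cases] c(2) unfolding P_def Q_def by presburger
  qed
  have Psum: "(\<Sum>l<i. P l - Q l) = r * (ramp d (t i - \<theta>) - ramp d (t i - \<theta>'))" if "i \<le> K" for i
    using that
  proof (induction i)
    case 0
    then show ?case using d th by (simp add: t(1) ramp_left)
  next
    case (Suc i)
    have st: "0 \<le> t i" "t i \<le> t (Suc i)" "t (Suc i) \<le> \<tau>" using t(2)[of i] t(2)[of "Suc i"] t(3)[of i] Suc by auto
    show ?case using Suc unfolding P_def Q_def
      by (simp add: mean_measure_intensity[OF d psi_cont st] algebra_simps)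
  qed
  have "t q1 \<le> t K" using le_iff idx by blast
  then have total: "(\<Sum>l<K. P l - Q l) = r * (\<theta>' - \<theta>)"
    using Psum[of K] d th idx by (simp add: ramp_right)
  have row: "exp (- (r * (\<theta>' - \<theta>))) * \<rho> ^ (\<Sum>l\<in>L. e j l) * (\<Prod>l<K. poisson_weight (Q l) (e j l))
     \<le> (\<Prod>l<K. poisson_weight (P l) (e j l))" if j: "j \<in> {1..n}" for j
  proof -
    have "exp (- (r * (\<theta>' - \<theta>))) = (\<Prod>l<K. exp (- (P l - Q l)))"
      unfolding total[symmetric] by (simp add: exp_sum[symmetric] sum_negf[symmetric])
    moreover have "\<rho> ^ (\<Sum>l\<in>L. e j l) = (\<Prod>l<K. if l \<in> L then \<rho> ^ e j l else 1)"
    proof -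
      have "(\<Prod>l<K. if l \<in> L then \<rho> ^ e j l else 1) = (\<Prod>l\<in>{..<K} \<inter> L. \<rho> ^ e j l)"
        by (rule prod.inter_restrict[symmetric]) simp
      also have "{..<K} \<inter> L = L" unfolding L_def by auto
      finally show ?thesis by (simp add: power_sum)
    qed
    ultimately have "exp (- (r * (\<theta>' - \<theta>))) * \<rho> ^ (\<Sum>l\<in>L. e j l) * (\<Prod>l<K. poisson_weight (Q l) (e j l)) =
       (\<Prod>l<K. exp (- (P l - Q l)) * (if l \<in> L then \<rho> ^ e j l else 1) * poisson_weight (Q l) (e j l))"
      by (simp only: prod.distrib)
    also have "\<dots> \<le> (\<Prod>l<K. poisson_weight (P l) (e j l))"
    proof (intro prod_mono conjI)
      fix l assume l: "l \<in> {..<K}"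
      have "0 < Q l" unfolding Q_def using t(2)[of l] t(2)[of "Suc l"] t(3)[of l] l by (intro mean_intensity_pos d) auto
      then show "0 \<le> exp (- (P l - Q l)) * (if l \<in> L then \<rho> ^ e j l else 1) * poisson_weight (Q l) (e j l)"
        using c(1) by (simp add: poisson_weight_def)
      show "exp (- (P l - Q l)) * (if l \<in> L then \<rho> ^ e j l else 1) * poisson_weight (Q l) (e j l) \<le> poisson_weight (P l) (e j l)"
        using one[OF j] l by blast
    qed
    finally show ?thesis .
  qed
  have "exp (- (real n * r * (\<theta>' - \<theta>))) * \<rho> ^ m * (\<Prod>j\<in>{1..n}. \<Prod>l<K. poisson_weight (Q l) (e j l)) =
     (\<Prod>j\<in>{1..n}. exp (- (r * (\<theta>' - \<theta>))) * \<rho> ^ (\<Sum>l\<in>L. e j l) * (\<Prod>l<K. poisson_weight (Q l) (e j l)))"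
    unfolding m power_sum prod.distrib by (simp add: exp_of_nat_mult[symmetric])
  also have "\<dots> \<le> (\<Prod>j\<in>{1..n}. \<Prod>l<K. poisson_weight (P l) (e j l))"
  proof (intro prod_mono conjI row)
    fix j
    have "0 < Q l" if "l < K" for l unfolding Q_def
      using t(2)[of l] t(2)[of "Suc l"] t(3)[of l] that by (intro mean_intensity_pos d) auto
    then show "0 \<le> exp (- (r * (\<theta>' - \<theta>))) * \<rho> ^ (\<Sum>l\<in>L. e j l) * (\<Prod>l<K. poisson_weight (Q l) (e j l))"
      using c(1) by (intro mult_nonneg_nonneg prod_nonneg) (auto simp: poisson_weight_nonneg less_imp_le)
  qed
  finally show "exp (- (real n * r * (\<theta>' - \<theta>))) * \<rho> ^ m *
      (\<Prod>j\<in>{1..n}. \<Prod>l<K. poisson_weight (mean_count d \<theta>' (t l) (t (Suc l))) (e j l))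
      \<le> (\<Prod>j\<in>{1..n}. \<Prod>l<K. poisson_weight (mean_count d \<theta> (t l) (t (Suc l))) (e j l))"
    unfolding P_def Q_def .
qed

end

section \<open>Bayes risks\<close>

definition bayes_mean :: "'i set \<Rightarrow> ('i \<Rightarrow> real) \<Rightarrow> ('i \<Rightarrow> real) \<Rightarrow> real" where
  "bayes_mean I u z = (\<Sum>i\<in>I. u i * z i) / (\<Sum>i\<in>I. z i)"

definition bayes_risk :: "'i set \<Rightarrow> ('i \<Rightarrow> real) \<Rightarrow> ('i \<Rightarrow> real) \<Rightarrow> real" where
  "bayes_risk I u z = (\<Sum>i\<in>I. z i * (bayes_mean I u z - u i)\<^sup>2)"

lemma bayes_risk_nonneg: "(\<And>i. i \<in> I \<Longrightarrow> 0 \<le> z i) \<Longrightarrow> 0 \<le> bayes_risk I u z"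
  unfolding bayes_risk_def by (intro sum_nonneg mult_nonneg_nonneg) auto

text \<open>The weighted mean minimises the weighted squared deviation: the cross term in the expansion
  around it vanishes.\<close>

lemma bayes_risk_le:
  assumes "0 < (\<Sum>i\<in>I. z i)"
  shows "bayes_risk I u z \<le> (\<Sum>i\<in>I. z i * (y - u i)\<^sup>2)"
proof -
  let ?m = "bayes_mean I u z"
  have "(\<Sum>i\<in>I. z i * (?m - u i)) = (\<Sum>i\<in>I. z i) * ?m - (\<Sum>i\<in>I. u i * z i)"
    by (simp add: right_diff_distrib sum_subtractf sum_distrib_right mult.commute)
  then have m: "(\<Sum>i\<in>I. z i * (?m - u i)) = 0"
    using assms by (simp add: bayes_mean_def)
  have "(\<Sum>i\<in>I. z i * (y - u i)\<^sup>2) =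
      (\<Sum>i\<in>I. z i * (?m - u i)\<^sup>2 + (2 * (y - ?m)) * (z i * (?m - u i)) + (y - ?m)\<^sup>2 * z i)"
    by (intro sum.cong refl) (simp add: power2_eq_square algebra_simps)
  also have "\<dots> = bayes_risk I u z + 2 * (y - ?m) * (\<Sum>i\<in>I. z i * (?m - u i)) + (y - ?m)\<^sup>2 * (\<Sum>i\<in>I. z i)"
    by (simp add: sum.distrib bayes_risk_def sum_distrib_left)
  finally show ?thesis using m assms by simp
qed

lemma nn_integral_restrict_le:
  assumes sets: "sets P = sets R" and E: "E \<in> sets R"
    and dom: "\<And>C. C \<in> sets R \<Longrightarrow> ennreal c * emeasure R (C \<inter> E) \<le> emeasure P (C \<inter> E)"
    and g: "g \<in> borel_measurable R"
  shows "ennreal c * (\<integral>\<^sup>+x. g x * indicator E x \<partial>R) \<le> (\<integral>\<^sup>+x. g x * indicator E x \<partial>P)"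
proof -
  let ?R = "scale_measure (ennreal c) (density R (indicator E))"
  let ?P = "density P (indicator E)"
  have gP: "g \<in> borel_measurable P" "E \<in> sets P" using g E sets by (auto cong: measurable_cong_sets)
  have "emeasure ?R A \<le> emeasure ?P A" for A
  proof (cases "A \<in> sets R")
    case True
    then show ?thesis using dom[OF True] E gP sets by (simp add: emeasure_restricted Int_commute)
  next
    case False
    then show ?thesis by (simp add: emeasure_notin_sets)
  qed
  then have "?R \<le> ?P"
    using sets sets_eq_imp_space_eq[OF sets] by (simp add: le_measure_iff le_fun_def space_scale_measure)
  then have "(\<integral>\<^sup>+x. g x \<partial>?R) \<le> (\<integral>\<^sup>+x. g x \<partial>?P)"
    using sets by (intro nn_integral_mono_measure) auto
  moreover have "(\<integral>\<^sup>+x. g x \<partial>?R) = ennreal c * (\<integral>\<^sup>+x. g x * indicator E x \<partial>R)"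
    using g E by (simp add: nn_integral_scale_measure nn_integral_density mult.commute)
  moreover have "(\<integral>\<^sup>+x. g x \<partial>?P) = (\<integral>\<^sup>+x. g x * indicator E x \<partial>P)"
    using gP by (simp add: nn_integral_density mult.commute)
  ultimately show ?thesis by simp
qed

text \<open>On each event E k all laws dominate multiples of one measure R. Hence the sum of the risks is
  at least the integral over R of a weighted squared loss, which the posterior mean minimises
  pointwise.\<close>

lemma bayes_lower_bound:
  fixes P :: "'i \<Rightarrow> 'a measure" and R :: "'a measure" and E :: "'k \<Rightarrow> 'a set" and u :: "'i \<Rightarrow> real"
  assumes I: "finite I" and sets: "\<And>i. i \<in> I \<Longrightarrow> sets (P i) = sets R"
    and KK: "finite KK" and E: "\<And>k. k \<in> KK \<Longrightarrow> E k \<in> sets R" and disj: "disjoint_family_on E KK"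
    and z: "\<And>i k. i \<in> I \<Longrightarrow> k \<in> KK \<Longrightarrow> 0 \<le> z k i" "\<And>k. k \<in> KK \<Longrightarrow> 0 < (\<Sum>i\<in>I. z k i)"
    and dom: "\<And>i k C. i \<in> I \<Longrightarrow> k \<in> KK \<Longrightarrow> C \<in> sets R \<Longrightarrow>
      ennreal (z k i) * emeasure R (C \<inter> E k) \<le> emeasure (P i) (C \<inter> E k)"
    and y: "y \<in> borel_measurable R"
  shows "(\<Sum>k\<in>KK. emeasure R (E k) * ennreal (bayes_risk I u (z k)))
     \<le> (\<Sum>i\<in>I. \<integral>\<^sup>+x. ennreal ((y x - u i)\<^sup>2) \<partial>P i)"
proof -
  let ?g = "\<lambda>i x. ennreal ((y x - u i)\<^sup>2)"
  have g: "?g i \<in> borel_measurable R" for i using y by simp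
  have "(\<Sum>k\<in>KK. emeasure R (E k) * ennreal (bayes_risk I u (z k))) =
     (\<Sum>k\<in>KK. \<integral>\<^sup>+x. ennreal (bayes_risk I u (z k)) * indicator (E k) x \<partial>R)"
    using E by (intro sum.cong refl, subst nn_integral_cmult_indicator) (auto simp: mult.commute)
  also have "\<dots> \<le> (\<Sum>k\<in>KK. \<integral>\<^sup>+x. (\<Sum>i\<in>I. ennreal (z k i) * (?g i x * indicator (E k) x)) \<partial>R)"
  proof (intro sum_mono nn_integral_mono)
    fix k x assume k: "k \<in> KK"
    have "ennreal (bayes_risk I u (z k)) \<le> ennreal (\<Sum>i\<in>I. z k i * (y x - u i)\<^sup>2)"
      by (rule ennreal_leI, rule bayes_risk_le, rule z(2)[OF k])
    also have "\<dots> = (\<Sum>i\<in>I. ennreal (z k i) * ?g i x)"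
      using z(1)[OF _ k] by (subst sum_ennreal[symmetric]) (auto simp: ennreal_mult)
    finally show "ennreal (bayes_risk I u (z k)) * indicator (E k) x \<le>
        (\<Sum>i\<in>I. ennreal (z k i) * (?g i x * indicator (E k) x))"
      by (auto simp: indicator_def)
  qed
  also have "\<dots> = (\<Sum>k\<in>KK. \<Sum>i\<in>I. ennreal (z k i) * (\<integral>\<^sup>+x. ?g i x * indicator (E k) x \<partial>R))"
  proof (intro sum.cong refl)
    fix k assume k: "k \<in> KK"
    have m: "(\<lambda>x. ?g i x * indicator (E k) x) \<in> borel_measurable R" for i
      using g E[OF k] by simp
    show "(\<integral>\<^sup>+x. (\<Sum>i\<in>I. ennreal (z k i) * (?g i x * indicator (E k) x)) \<partial>R) =
       (\<Sum>i\<in>I. ennreal (z k i) * (\<integral>\<^sup>+x. ?g i x * indicator (E k) x \<partial>R))"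
      using m by (subst nn_integral_sum) (auto simp: nn_integral_cmult)
  qed
  also have "\<dots> \<le> (\<Sum>k\<in>KK. \<Sum>i\<in>I. \<integral>\<^sup>+x. ?g i x * indicator (E k) x \<partial>P i)"
    by (intro sum_mono nn_integral_restrict_le sets E dom g)
  also have "\<dots> = (\<Sum>i\<in>I. \<integral>\<^sup>+x. (\<Sum>k\<in>KK. ?g i x * indicator (E k) x) \<partial>P i)"
  proof (subst sum.swap, intro sum.cong refl)
    fix i assume i: "i \<in> I"
    have "(\<lambda>x. ?g i x * indicator (E k) x) \<in> borel_measurable (P i)" if "k \<in> KK" for k
      using g E[OF that] sets[OF i] by (auto cong: measurable_cong_sets)
    then show "(\<Sum>k\<in>KK. \<integral>\<^sup>+x. ?g i x * indicator (E k) x \<partial>P i) =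
      (\<integral>\<^sup>+x. (\<Sum>k\<in>KK. ?g i x * indicator (E k) x) \<partial>P i)"
      by (intro nn_integral_sum[symmetric]) auto
  qed
  also have "\<dots> \<le> (\<Sum>i\<in>I. \<integral>\<^sup>+x. ?g i x \<partial>P i)"
  proof (intro sum_mono nn_integral_mono)
    fix i x
    have "(\<Sum>k\<in>KK. indicator (E k) x) \<le> (1::ennreal)"
    proof (cases "\<exists>k\<in>KK. x \<in> E k")
      case True
      then obtain k where k: "k \<in> KK" "x \<in> E k" by blast
      have "(\<Sum>k\<in>KK. indicator (E k) x) = (\<Sum>k'\<in>KK. if k' = k then 1 else (0::ennreal))"
        using disj k by (intro sum.cong refl) (auto simp: disjoint_family_on_def indicator_def)
      then show ?thesis using KK k by simp
    next
      case False
      then have "(\<Sum>k\<in>KK. indicator (E k) x) = (0::ennreal)" by (intro sum.neutral) auto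
      then show ?thesis by simp
    qed
    then have "?g i x * (\<Sum>k\<in>KK. indicator (E k) x) \<le> ?g i x * 1" by (rule mult_left_mono) simp
    then show "(\<Sum>k\<in>KK. ?g i x * indicator (E k) x) \<le> ?g i x" by (simp add: sum_distrib_left)
  qed
  finally show ?thesis .
qed

section \<open>A finite grid of change points\<close>

lemma sum_telescope_nat:
  fixes f :: "nat \<Rightarrow> nat"
  assumes "a \<le> b" "\<And>c. a \<le> c \<Longrightarrow> c < b \<Longrightarrow> f c \<le> f (Suc c)"
  shows "(\<Sum>c\<in>{a..<b}. f (Suc c) - f c) = f b - f a"
  using assms
proof (induction b rule: dec_induct)
  case (step b)
  have "f a \<le> f b" using step(1) step.prems
  proof (induction b rule: dec_induct)
    case (step m) then show ?case by (meson Suc_lessD less_Suc_eq order_trans less_imp_le_nat)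
  qed simp
  moreover have "f b \<le> f (Suc b)" using step by simp
  ultimately show ?case using step by simp
qed simp

lemma sum_even_odd_cells:
  fixes k :: "nat \<Rightarrow> nat"
  assumes "i \<le> N"
  shows "(\<Sum>c\<in>{2*i..<2*N}. if even c then 0 else k (c div 2)) = (\<Sum>s\<in>{i..<N}. k s)"
  using assms by (induction N rule: dec_induct) auto

definition grid_point :: "real \<Rightarrow> real \<Rightarrow> nat \<Rightarrow> real" where
  "grid_point \<theta> g i = \<theta> + real i * g"

text \<open>The even break points are the grid points and the odd ones the ends of their ramps, so that
  the even intervals are ramps and the odd ones are cells.\<close>

definition break_point :: "real \<Rightarrow> real \<Rightarrow> real \<Rightarrow> nat \<Rightarrow> real" where
  "break_point d \<theta> g c = grid_point \<theta> g (c div 2) + (if odd c then d else 0)"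

text \<open>No points in the ramps, k s points in the cell between the s-th ramp and the next grid point.\<close>

definition counts :: "(nat \<Rightarrow> nat) \<Rightarrow> nat \<Rightarrow> nat" where
  "counts k c = (if even c then 0 else k (c div 2))"

lemma break_point_even: "break_point d \<theta> g (2 * i) = grid_point \<theta> g i"
  and break_point_odd: "break_point d \<theta> g (Suc (2 * i)) = grid_point \<theta> g i + d"
  by (simp_all add: break_point_def)

locale change_grid = change_model +
  fixes n N :: nat and d \<theta>\<^sub>0 g :: real
    and M :: "nat \<Rightarrow> 'w measure" and X :: "nat \<Rightarrow> nat \<Rightarrow> real \<Rightarrow> 'w \<Rightarrow> nat"
  assumes d_pos: "0 < d" and d_less: "d < g"
    and base: "0 \<le> \<theta>\<^sub>0" "\<theta>\<^sub>0 + real N * g + d \<le> \<tau>"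
    and samples: "\<And>i. i \<le> N \<Longrightarrow> poisson_sample (M i) n \<tau> (intensity \<psi> r \<tau> d (\<theta>\<^sub>0 + real i * g)) (X i)"
begin

abbreviation grid :: "nat \<Rightarrow> real" where "grid \<equiv> grid_point \<theta>\<^sub>0 g"

abbreviation breakpoint :: "nat \<Rightarrow> real" where "breakpoint \<equiv> break_point d \<theta>\<^sub>0 g"

definition cell_event :: "(nat \<Rightarrow> nat) \<Rightarrow> (nat \<Rightarrow> real \<Rightarrow> nat) set" where
  "cell_event k = {x \<in> space (sample_space n \<tau>). \<forall>c<2*N+1.
     (\<Sum>j\<in>{1..n}. x j (breakpoint (Suc c)) - x j (breakpoint c)) = counts k c}"

lemma cell_eventD:
  "x \<in> cell_event k \<Longrightarrow> c < 2*N+1 \<Longrightarrow>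
    (\<Sum>j\<in>{1..n}. x j (breakpoint (Suc c)) - x j (breakpoint c)) = counts k c"
  unfolding cell_event_def by blast

lemma breakpoint_less: "breakpoint c < breakpoint (Suc c)"
proof (cases "even c")
  case True
  then obtain i where i: "c = 2 * i" by (rule evenE)
  show ?thesis unfolding i break_point_even break_point_odd using d_pos by simp
next
  case False
  then obtain i where i: "c = Suc (2 * i)" by (auto elim!: oddE)
  have c: "Suc c = 2 * Suc i" using i by simp
  show ?thesis unfolding c break_point_even unfolding i break_point_odd
    using d_less by (simp add: grid_point_def algebra_simps)
qed

lemma breakpoint_in: "c \<le> 2 * N + 1 \<Longrightarrow> breakpoint c \<in> {0..\<tau>}"
proof -
  assume c: "c \<le> 2 * N + 1"
  have "real (c div 2) \<le> real N" using c by simp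
  then have "real (c div 2) * g \<le> real N * g" "0 \<le> real (c div 2) * g"
    using d_pos d_less by (auto intro!: mult_right_mono)
  then show ?thesis using base d_pos by (auto simp: break_point_def grid_point_def)
qed

lemma sample_at: "i \<le> N \<Longrightarrow> poisson_sample (M i) n \<tau> (intensity \<psi> r \<tau> d (grid i)) (X i)"
  using samples by (simp add: grid_point_def)

abbreviation law :: "nat \<Rightarrow> (nat \<Rightarrow> real \<Rightarrow> nat) measure" where
  "law i \<equiv> sample_law n \<tau> (M i) (X i)"

lemma sets_law: "i \<le> N \<Longrightarrow> sets (law i) = sets (sample_space n \<tau>)"
  using poisson_sample.sets_law[OF sample_at] .

lemma cell_event_sets: "cell_event k \<in> sets (sample_space n \<tau>)"
proof -
  have "{x \<in> space (sample_space n \<tau>). \<forall>c\<in>{..<2*N+1}.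
     (\<Sum>j\<in>{1..n}. x j (breakpoint (Suc c)) - x j (breakpoint c)) = counts k c} \<in> sets (sample_space n \<tau>)"
    by (intro sets.sets_Collect_finite_All measurable_nat_eq measurable_nat_sum measurable_nat_diff
        measurable_eval_sample breakpoint_in) auto
  then show ?thesis unfolding cell_event_def by (simp only: ball_simps lessThan_iff Ball_def)
qed

lemma cell_event_determined: "determined_by n \<tau> (breakpoint ` {..2*N+1}) (cell_event k)"
proof (rule determined_byI)
  fix x y assume sp: "x \<in> space (sample_space n \<tau>)" "y \<in> space (sample_space n \<tau>)"
    and xy: "\<And>j t. j \<in> {1..n} \<Longrightarrow> t \<in> breakpoint ` {..2*N+1} \<Longrightarrow> x j t = y j t"
  have "(\<Sum>j\<in>{1..n}. x j (breakpoint (Suc c)) - x j (breakpoint c)) =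
      (\<Sum>j\<in>{1..n}. y j (breakpoint (Suc c)) - y j (breakpoint c))" if "c < 2*N+1" for c
    using that by (intro sum.cong refl arg_cong2[where f = "(-)"] xy) auto
  then show "x \<in> cell_event k \<longleftrightarrow> y \<in> cell_event k"
    unfolding cell_event_def using sp by simp
qed

lemma emeasure_cell_event:
  assumes i: "i \<le> N"
  shows "emeasure (law i) (cell_event k) = ennreal (\<Prod>c<2*N+1. poisson_weight
     (real n * mean_count d (grid i) (breakpoint c) (breakpoint (Suc c))) (counts k c))"
proof -
  interpret S: poisson_sample "M i" n \<tau> "intensity \<psi> r \<tau> d (grid i)" "X i" by (rule sample_at[OF i])
  have "{\<omega>\<in>space (M i). S.sample \<omega> \<in> cell_event k} =
     {\<omega>\<in>space (M i). \<forall>c<2*N+1. (\<Sum>j\<in>{1..n}. X i j (breakpoint (Suc c)) \<omega> - X i j (breakpoint c) \<omega>) = counts k c}"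
  proof (intro Collect_cong conj_cong refl)
    fix \<omega> assume w: "\<omega> \<in> space (M i)"
    have "(\<Sum>j\<in>{1..n}. S.sample \<omega> j (breakpoint (Suc c)) - S.sample \<omega> j (breakpoint c)) =
      (\<Sum>j\<in>{1..n}. X i j (breakpoint (Suc c)) \<omega> - X i j (breakpoint c) \<omega>)" if "c < 2*N+1" for c
      using that by (intro sum.cong refl arg_cong2[where f = "(-)"] S.sample_apply breakpoint_in) auto
    then show "S.sample \<omega> \<in> cell_event k \<longleftrightarrow>
      (\<forall>c<2*N+1. (\<Sum>j\<in>{1..n}. X i j (breakpoint (Suc c)) \<omega> - X i j (breakpoint c) \<omega>) = counts k c)"
      unfolding cell_event_def using S.sample_in_space[OF w] by simp
  qed
  then show ?thesis
    unfolding S.emeasure_law[OF cell_event_sets] S.emeasure_eq_measure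
    by (subst S.prob_total_increments[where t = breakpoint and K = "2*N+1", symmetric])
      (auto intro!: breakpoint_less simp del: atLeastAtMost_iff intro: breakpoint_in)
qed

lemma disjoint_cell_events:
  assumes "KK \<subseteq> PiE {..<N} (\<lambda>_. UNIV)"
  shows "disjoint_family_on cell_event KK"
  unfolding disjoint_family_on_def
proof (intro ballI impI)
  fix k k' assume k: "k \<in> KK" "k' \<in> KK" "k \<noteq> k'"
  have "k = k'" if x: "x \<in> cell_event k" "x \<in> cell_event k'" for x
  proof (rule PiE_ext)
    show "k \<in> PiE {..<N} (\<lambda>_. UNIV)" "k' \<in> PiE {..<N} (\<lambda>_. UNIV)" using k assms by auto
    fix s assume s: "s \<in> {..<N}"
    then have "Suc (2 * s) < 2 * N + 1" by simp
    then have "counts k (Suc (2 * s)) = counts k' (Suc (2 * s))"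
      using cell_eventD[OF x(1)] cell_eventD[OF x(2)] by metis
    then show "k s = k' s" by (simp add: counts_def)
  qed
  then show "cell_event k \<inter> cell_event k' = {}" using k(3) by blast
qed

lemma cell_event_no_points:
  assumes x: "x \<in> cell_event k" and i: "i \<le> N" and j: "j \<in> {1..n}"
  shows "x j (grid i + d) - x j (grid i) = 0"
proof -
  have "(\<Sum>j\<in>{1..n}. x j (breakpoint (Suc (2*i))) - x j (breakpoint (2*i))) = counts k (2*i)"
    by (rule cell_eventD[OF x]) (use i in simp)
  then have "(\<Sum>j\<in>{1..n}. x j (grid i + d) - x j (grid i)) = 0"
    unfolding break_point_even break_point_odd by (simp only: counts_def even_mult_iff even_numeral if_True simp_thms)
  then show ?thesis using j unfolding sum_eq_0_iff[OF finite_atLeastAtMost] by blast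
qed

text \<open>For monotone paths the increments telescope. Elements of the sample space need not be
  monotone, and truncated subtraction would then lose points.\<close>

lemma cell_event_count:
  assumes x: "x \<in> cell_event k" and i: "i \<le> N" and mono: "\<And>j. j \<in> {1..n} \<Longrightarrow> mono_on {0..\<tau>} (x j)"
  shows "(\<Sum>j\<in>{1..n}. x j (grid N) - x j (grid i)) = (\<Sum>s\<in>{i..<N}. k s)"
proof -
  have "x j (grid N) - x j (grid i) = (\<Sum>c\<in>{2*i..<2*N}. x j (breakpoint (Suc c)) - x j (breakpoint c))"
    if j: "j \<in> {1..n}" for j
  proof -
    have "x j (breakpoint c) \<le> x j (breakpoint (Suc c))" if "c < 2 * N" for c
      using that by (intro mono_onD[OF mono[OF j]] breakpoint_in less_imp_le[OF breakpoint_less]) auto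
    then have "(\<Sum>c\<in>{2*i..<2*N}. x j (breakpoint (Suc c)) - x j (breakpoint c)) =
        x j (breakpoint (2*N)) - x j (breakpoint (2*i))"
      using i by (intro sum_telescope_nat) auto
    then show ?thesis unfolding break_point_even by (rule sym)
  qed
  then have "(\<Sum>j\<in>{1..n}. x j (grid N) - x j (grid i)) =
      (\<Sum>c\<in>{2*i..<2*N}. \<Sum>j\<in>{1..n}. x j (breakpoint (Suc c)) - x j (breakpoint c))"
    by (simp only: sum.swap[of _ "{2*i..<2*N}"] cong: sum.cong)
  also have "\<dots> = (\<Sum>c\<in>{2*i..<2*N}. counts k c)"
    by (intro sum.cong refl cell_eventD[OF x]) simp
  also have "\<dots> = (\<Sum>s\<in>{i..<N}. k s)" unfolding counts_def by (rule sum_even_odd_cells[OF i])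
  finally show ?thesis .
qed

text \<open>The last grid point serves as the reference: compared with it, an earlier change point shifts
  the intensity by r on all cells between the two and, apart from the ramps, nowhere else.\<close>

lemma law_grid_le:
  assumes i: "i \<le> N" and \<rho>: "0 < \<rho>" "\<And>x. x \<in> {grid 0..grid N} \<Longrightarrow> \<rho> * \<psi> x \<le> \<psi> x + r"
    and C: "C \<in> sets (sample_space n \<tau>)"
  shows "ennreal (exp (- (real n * r * (real (N - i) * g))) * \<rho> ^ (\<Sum>s\<in>{i..<N}. k s)) *
      emeasure (law N) (C \<inter> cell_event k) \<le> emeasure (law i) (C \<inter> cell_event k)"
proof (cases "i = N")
  case True
  then show ?thesis by simp
next
  case False
  then have iN: "i < N" using i by simp
  have g: "0 < g" using d_pos d_less by simp
  have diff: "grid N - grid i = real (N - i) * g"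
    using i by (simp add: grid_point_def of_nat_diff algebra_simps)
  have "1 * g \<le> real (N - i) * g" using iN g by (intro mult_right_mono) auto
  then have ord: "grid i + d \<le> grid N" using diff d_less by simp
  have i0: "grid 0 \<le> grid i" using g by (simp add: grid_point_def)
  show ?thesis unfolding diff[symmetric]
  proof (rule law_le[OF sample_at[OF i] sample_at[OF order_refl] d_pos _ ord _ \<rho>(1) _ _ _ _
        cell_event_sets cell_event_determined _ _ C])
    show "0 \<le> grid i" using base g by (simp add: grid_point_def)
    show "grid N + d \<le> \<tau>" using base by (simp add: grid_point_def)
    show "\<rho> * \<psi> x \<le> \<psi> x + r" if "x \<in> {grid i..grid N}" for x
      using that i0 by (intro \<rho>(2)) auto
    show "finite (breakpoint ` {..2 * N + 1})" by simp
    show "breakpoint ` {..2 * N + 1} \<subseteq> {0..\<tau>}" using breakpoint_in by blast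
    have "breakpoint (2*i) \<in> breakpoint ` {..2*N+1}" "breakpoint (Suc (2*i)) \<in> breakpoint ` {..2*N+1}"
      "breakpoint (2*N) \<in> breakpoint ` {..2*N+1}" "breakpoint (Suc (2*N)) \<in> breakpoint ` {..2*N+1}"
      using iN by (intro imageI; simp)+
    then have "grid i \<in> breakpoint ` {..2*N+1}" "grid i + d \<in> breakpoint ` {..2*N+1}"
      "grid N \<in> breakpoint ` {..2*N+1}" "grid N + d \<in> breakpoint ` {..2*N+1}"
      unfolding break_point_even break_point_odd .
    then show "{grid i, grid i + d, grid N, grid N + d} \<subseteq> breakpoint ` {..2 * N + 1}" by simp
    show "x j (grid i + d) - x j (grid i) = 0 \<and> x j (grid N + d) - x j (grid N) = 0"
      if "x \<in> cell_event k" "j \<in> {1..n}" for x j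
      using cell_event_no_points[OF that(1) _ that(2)] i by blast
    show "(\<Sum>j = 1..n. x j (grid N) - x j (grid i)) = (\<Sum>s\<in>{i..<N}. k s)"
      if "x \<in> cell_event k" "\<And>j. j \<in> {1..n} \<Longrightarrow> mono_on {0..\<tau>} (x j)" for x
      using cell_event_count[OF that(1) i that(2)] .
  qed
qed

lemma grid_bayes_bound:
  assumes \<rho>: "0 < \<rho>" "\<And>x. x \<in> {grid 0..grid N} \<Longrightarrow> \<rho> * \<psi> x \<le> \<psi> x + r"
    and KK: "finite KK" "KK \<subseteq> PiE {..<N} (\<lambda>_. UNIV)"
    and y: "y \<in> borel_measurable (sample_space n \<tau>)"
  shows "(\<Sum>k\<in>KK. ennreal (\<Prod>c<2*N+1. poisson_weight
       (real n * mean_count d (grid N) (breakpoint c) (breakpoint (Suc c))) (counts k c)) *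
      ennreal (bayes_risk {..N} u (\<lambda>i. exp (- (real n * r * (real (N - i) * g))) * \<rho> ^ (\<Sum>s\<in>{i..<N}. k s))))
     \<le> (\<Sum>i\<le>N. \<integral>\<^sup>+x. ennreal ((y x - u i)\<^sup>2) \<partial>law i)"
proof -
  let ?z = "\<lambda>k i. exp (- (real n * r * (real (N - i) * g))) * \<rho> ^ (\<Sum>s\<in>{i..<N}. k s)"
  have sN: "sets (law N) = sets (sample_space n \<tau>)" by (rule sets_law) simp
  have "(\<Sum>k\<in>KK. emeasure (law N) (cell_event k) * ennreal (bayes_risk {..N} u (?z k)))
     \<le> (\<Sum>i\<le>N. \<integral>\<^sup>+x. ennreal ((y x - u i)\<^sup>2) \<partial>law i)"
  proof (rule bayes_lower_bound)
    show "sets (law i) = sets (law N)" if "i \<in> {..N}" for i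
      using that sets_law[of i] sN by simp
    show "cell_event k \<in> sets (law N)" for k unfolding sN by (rule cell_event_sets)
    show "disjoint_family_on cell_event KK" by (rule disjoint_cell_events[OF KK(2)])
    show "0 < (\<Sum>i\<le>N. ?z k i)" for k using \<rho>(1) by (intro sum_pos) auto
    show "ennreal (?z k i) * emeasure (law N) (C \<inter> cell_event k) \<le> emeasure (law i) (C \<inter> cell_event k)"
      if "i \<in> {..N}" "C \<in> sets (law N)" for i k C
      using that \<rho> unfolding sN by (intro law_grid_le) auto
    show "y \<in> borel_measurable (law N)" using y sN by (simp cong: measurable_cong_sets)
  qed (use KK \<rho>(1) in auto)
  then show ?thesis by (simp only: emeasure_cell_event[OF order_refl])
qed

end

section \<open>The asymptotic minimax risk dominates Bayes risks of Poisson counts\<close>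

definition minimax_risk ::
  "real \<Rightarrow> real \<Rightarrow> real \<Rightarrow> real \<Rightarrow> (nat \<Rightarrow> real \<Rightarrow> 'w measure) \<Rightarrow>
    (nat \<Rightarrow> real \<Rightarrow> nat \<Rightarrow> real \<Rightarrow> 'w \<Rightarrow> nat) \<Rightarrow> real \<Rightarrow> nat \<Rightarrow> ennreal" where
  "minimax_risk \<alpha> \<beta> \<tau> \<theta>0 M X \<epsilon> n =
     (INF f\<in>borel_measurable (sample_space n \<tau>).
        SUP \<theta>\<in>{\<theta>\<in>{\<alpha><..<\<beta>}. \<bar>\<theta> - \<theta>0\<bar> < \<epsilon>}.
          ennreal ((real n)\<^sup>2) *
            (\<integral>\<^sup>+ x. ennreal ((f x - \<theta>)\<^sup>2) \<partial>sample_law n \<tau> (M n \<theta>) (X n \<theta>)))"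

lemma tendsto_poisson_weight:
  "(f \<longlongrightarrow> p) F \<Longrightarrow> ((\<lambda>x. poisson_weight (f x) k) \<longlongrightarrow> poisson_weight p k) F"
  unfolding poisson_weight_def by (intro tendsto_intros) simp_all

lemma prod_counts:
  "(\<Prod>c<2*N+1. poisson_weight (if even c then 0 else p) (counts k c)) = (\<Prod>s<N. poisson_weight p (k s))"
  by (induction N) (simp_all add: counts_def poisson_weight_0 mult_ac)

context change_model
begin

lemma mean_measure_near:
  assumes "0 \<le> s" "s \<le> t" "t \<le> \<tau>" and "\<And>x. x \<in> {s..t} \<Longrightarrow> \<bar>\<psi> x - c\<bar> \<le> \<eta>"
  shows "\<bar>mean_measure \<psi> s t - c * (t - s)\<bar> \<le> \<eta> * (t - s)"
proof -
  have i: "set_integrable lborel {s..t} \<psi>" using assms by (intro psi_integrable)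
  have ic: "set_integrable lborel {s..t} (\<lambda>_. e)" for e :: real by (rule borel_integrable_atLeastAtMost') simp
  have v: "(LINT x:{s..t}|lborel. e) = e * (t - s)" for e :: real
    using assms by (simp add: set_lebesgue_integral_def)
  have "mean_measure \<psi> s t \<le> (LINT x:{s..t}|lborel. c + \<eta>)" "(LINT x:{s..t}|lborel. c - \<eta>) \<le> mean_measure \<psi> s t"
    by (intro set_integral_mono i ic; use assms(4) in \<open>force simp: abs_le_iff\<close>)+
  then show ?thesis unfolding v by (simp add: algebra_simps abs_le_iff)
qed

text \<open>Under the last grid point, a ramp has mean of order n times \<delta> n, and a cell, of length
  h / n - \<delta> n, lies before the change and has mean close to h times \<psi> \<theta>0 by continuity of \<psi>.\<close>

lemma cell_mean_tendsto:
  fixes \<delta> :: "nat \<Rightarrow> real" and h :: real and N c :: nat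
  assumes th: "\<theta>0 \<in> {0<..<\<tau>}" and h: "0 < h"
    and d: "\<And>n. 1 \<le> n \<Longrightarrow> 0 < \<delta> n" "(\<lambda>n. real n * \<delta> n) \<longlonglongrightarrow> 0"
    and c: "c < 2*N+1"
  shows "(\<lambda>n. real n * mean_count (\<delta> n) (grid_point \<theta>0 (h / real n) N)
      (break_point (\<delta> n) \<theta>0 (h / real n) c) (break_point (\<delta> n) \<theta>0 (h / real n) (Suc c)))
    \<longlonglongrightarrow> (if even c then 0 else h * \<psi> \<theta>0)" (is "?L \<longlonglongrightarrow> _")
proof -
  define D where "D = real N * h"
  have small: "\<forall>\<^sub>F n in sequentially. D / real n < e" if "0 < e" for e :: real
    using lim_const_over_n[of D] that by (rule order_tendstoD(2))
  have dsmall: "\<forall>\<^sub>F n in sequentially. real n * \<delta> n < e" if "0 < e" for e :: real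
    using d(2) that by (rule order_tendstoD(2))
  have d_le: "\<delta> n \<le> real n * \<delta> n" if "1 \<le> n" for n
    using d(1)[OF that] that by (simp add: mult_le_cancel_right1)
  define G where "G n = grid_point \<theta>0 (h / real n)" for n
  have G: "G n i = \<theta>0 + real i * h / real n" for n i
    by (simp add: G_def grid_point_def)
  have G_near: "\<bar>G n i - \<theta>0\<bar> \<le> D / real n" if "i \<le> N" for n i
  proof -
    have "\<bar>real i * h\<bar> \<le> D"
      using that h unfolding D_def abs_mult by (intro mult_mono) auto
    then show ?thesis unfolding G by (simp add: abs_divide divide_right_mono)
  qed
  have G_step: "G n (Suc i) - G n i = h / real n" for n i
    unfolding G by (simp add: diff_divide_distrib[symmetric] algebra_simps add_divide_distrib)
  \<comment> \<open>Half of the distance to the boundary is left for the grid and half for the last ramp.\<close>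
  define e0 where "e0 = min \<theta>0 (\<tau> - \<theta>0) / 2"
  have e0: "0 < e0" "2 * e0 \<le> \<theta>0" "2 * e0 \<le> \<tau> - \<theta>0" using th by (auto simp: e0_def)
  show ?thesis
  proof (cases "even c")
    case True
    then obtain i where i: "c = 2 * i" by (rule evenE)
    then have iN: "i \<le> N" using c by simp
    obtain \<kappa> C where C: "0 < \<kappa>" "\<And>d \<theta> s t. 0 < d \<Longrightarrow> 0 \<le> s \<Longrightarrow> s \<le> t \<Longrightarrow> t \<le> \<tau> \<Longrightarrow>
       \<kappa> * (t - s) \<le> mean_count d \<theta> s t \<and>
       mean_count d \<theta> s t \<le> C * (t - s)"
      by (rule mean_intensity_bounds) blast
    have "\<forall>\<^sub>F n in sequentially. norm (?L n) \<le> C * (real n * \<delta> n)"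
      using eventually_ge_at_top[of 1] small[OF e0(1)] dsmall[OF e0(1)]
    proof eventually_elim
      case (elim n)
      have "\<delta> n < e0" using d_le[OF elim(1)] elim(3) by linarith
      then have st: "0 \<le> G n i" "G n i \<le> G n i + \<delta> n" "G n i + \<delta> n \<le> \<tau>"
        using G_near[OF iN, of n] elim e0 d(1)[OF elim(1)] by (auto simp: abs_le_iff)
      have L: "?L n = real n * mean_count (\<delta> n) (G n N) (G n i) (G n i + \<delta> n)"
        unfolding i break_point_even break_point_odd G_def ..
      have "0 \<le> mean_count (\<delta> n) (G n N) (G n i) (G n i + \<delta> n)"
        "mean_count (\<delta> n) (G n N) (G n i) (G n i + \<delta> n) \<le> C * \<delta> n"
        using C(2)[OF d(1)[OF elim(1)] st, of "G n N"] C(1) d(1)[OF elim(1)]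
        by (auto intro: order_trans[OF mult_nonneg_nonneg[of \<kappa> "\<delta> n"]])
      then show ?case unfolding L by (simp add: abs_mult mult_left_mono mult.left_commute[of C])
    qed
    moreover have "(\<lambda>n. C * (real n * \<delta> n)) \<longlonglongrightarrow> 0"
      using tendsto_mult_left[OF d(2), of C] by simp
    ultimately have "?L \<longlonglongrightarrow> 0" by (rule Lim_null_comparison)
    then show ?thesis using True by simp
  next
    case False
    then obtain i where i: "c = Suc (2 * i)" by (auto elim!: oddE)
    then have iN: "Suc i \<le> N" "i \<le> N" using c by auto
    have Sc: "Suc c = 2 * Suc i" using i by simp
    have "?L \<longlonglongrightarrow> h * \<psi> \<theta>0"
    proof (rule LIMSEQ_I)
      fix e :: real assume e: "0 < e"
      \<comment> \<open>One half of e pays for the oscillation of \<psi> on a cell of rescaled length at most h.\<close>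
      define \<eta> where "\<eta> = e / (2 * h)"
      have \<eta>: "0 < \<eta>" using e h by (simp add: \<eta>_def)
      have "isCont \<psi> \<theta>0" using psi_cont th by (intro continuous_on_interior) (auto simp: interior_atLeastAtMost_real)
      then obtain e1 where e1: "0 < e1" "\<And>x. \<bar>x - \<theta>0\<bar> < e1 \<Longrightarrow> \<bar>\<psi> x - \<psi> \<theta>0\<bar> < \<eta>"
        using \<eta> unfolding continuous_at_eps_delta by (auto simp: dist_real_def)
      \<comment> \<open>The other half pays for the length that the ramp cuts off the cell; the summand 1 avoids division by 0.\<close>
      have pos: "0 < e / (2 * (\<bar>\<psi> \<theta>0\<bar> + 1))" using e by simp
      have "\<forall>\<^sub>F n in sequentially. norm (?L n - h * \<psi> \<theta>0) < e"
        using eventually_ge_at_top[of 1] small[OF e0(1)] small[OF e1(1)] dsmall[OF h] dsmall[OF pos]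
      proof eventually_elim
        case (elim n)
        let ?s = "G n i + \<delta> n" and ?t = "G n (Suc i)"
        have dn: "0 < \<delta> n" by (rule d(1)[OF elim(1)])
        have n0: "0 < real n" using elim(1) by simp
        have "\<delta> n < h / real n" using elim(4) n0 by (simp add: field_simps)
        then have st: "?s \<le> ?t" using G_step[of n i] by linarith
        have len: "real n * (?t - ?s) = h - real n * \<delta> n"
        proof -
          have "?t - ?s = h / real n - \<delta> n" using G_step[of n i] by linarith
          then show ?thesis using n0 by (simp add: field_simps)
        qed
        have G0: "0 \<le> G n i" "?t \<le> \<tau>"
          using G_near[OF iN(1), of n] G_near[OF iN(2), of n] elim(2) e0 by (auto simp: abs_le_iff)
        have tN: "?t \<le> G n N"
          unfolding G using iN h n0 by (intro add_left_mono divide_right_mono mult_right_mono) auto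
        have mm: "mean_count (\<delta> n) (G n N) ?s ?t = mean_measure \<psi> ?s ?t"
          using mean_measure_intensity[OF dn psi_cont _ st G0(2)] G0(1) dn st tN by (simp add: ramp_left)
        have near: "\<bar>\<psi> x - \<psi> \<theta>0\<bar> \<le> \<eta>" if "x \<in> {?s..?t}" for x
        proof -
          have "\<bar>x - \<theta>0\<bar> \<le> D / real n"
            using that G_near[OF iN(1), of n] G_near[OF iN(2), of n] dn by (auto simp: abs_le_iff)
          then show ?thesis using e1(2)[of x] elim(3) by linarith
        qed
        have "\<bar>mean_measure \<psi> ?s ?t - \<psi> \<theta>0 * (?t - ?s)\<bar> \<le> \<eta> * (?t - ?s)"
          using G0 dn st near by (intro mean_measure_near) auto
        then have "real n * \<bar>mean_measure \<psi> ?s ?t - \<psi> \<theta>0 * (?t - ?s)\<bar> \<le> real n * (\<eta> * (?t - ?s))"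
          using n0 by (intro mult_left_mono) auto
        then have "\<bar>real n * mean_measure \<psi> ?s ?t - \<psi> \<theta>0 * (real n * (?t - ?s))\<bar> \<le> \<eta> * (real n * (?t - ?s))"
          using n0 by (simp add: abs_mult_pos' right_diff_distrib mult_ac)
        then have 1: "\<bar>real n * mean_measure \<psi> ?s ?t - \<psi> \<theta>0 * (h - real n * \<delta> n)\<bar> \<le> \<eta> * (h - real n * \<delta> n)"
          unfolding len .
        have "\<eta> * (h - real n * \<delta> n) \<le> \<eta> * h" using \<eta> dn n0 by (intro mult_left_mono) auto
        then have 2: "\<eta> * (h - real n * \<delta> n) \<le> e / 2" using h by (simp add: \<eta>_def)
        have "\<bar>\<psi> \<theta>0\<bar> * (real n * \<delta> n) \<le> (\<bar>\<psi> \<theta>0\<bar> + 1) * (real n * \<delta> n)"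
          using dn n0 by (intro mult_right_mono) auto
        also have "\<dots> < e / 2" using elim(5) by (simp add: field_simps)
        finally have 3: "\<bar>\<psi> \<theta>0 * (real n * \<delta> n)\<bar> < e / 2" using dn n0 by (simp add: abs_mult)
        have L: "?L n = real n * mean_measure \<psi> ?s ?t"
          unfolding mm[symmetric] unfolding Sc break_point_even unfolding i break_point_odd G_def ..
        have "real n * mean_measure \<psi> ?s ?t - h * \<psi> \<theta>0 =
            (real n * mean_measure \<psi> ?s ?t - \<psi> \<theta>0 * (h - real n * \<delta> n)) - \<psi> \<theta>0 * (real n * \<delta> n)"
          by (simp add: right_diff_distrib mult.commute)
        then show ?case unfolding L real_norm_def using 1 2 3 by linarith
      qed
      then show "\<exists>no. \<forall>n\<ge>no. norm (?L n - h * \<psi> \<theta>0) < e" by (simp add: eventually_sequentially)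
    qed
    then show ?thesis using False by simp
  qed
qed

end

lemma tendsto_bayes_risk:
  assumes "\<And>i. i \<in> I \<Longrightarrow> ((\<lambda>x. z x i) \<longlongrightarrow> z0 i) F" "(\<Sum>i\<in>I. z0 i) \<noteq> 0"
  shows "((\<lambda>x. bayes_risk I u (z x)) \<longlongrightarrow> bayes_risk I u z0) F"
  unfolding bayes_risk_def bayes_mean_def
  by (intro tendsto_intros assms)

context change_model
begin

text \<open>The weights in \<open>law_grid_le\<close> for the spacing h / n: the factor n cancels.\<close>

definition limit_likelihood :: "real \<Rightarrow> nat \<Rightarrow> real \<Rightarrow> (nat \<Rightarrow> nat) \<Rightarrow> nat \<Rightarrow> real" where
  "limit_likelihood h N \<rho> k i = exp (- (r * (real (N - i) * h))) * \<rho> ^ (\<Sum>s\<in>{i..<N}. k s)"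

text \<open>For large n the grid lies in the neighbourhood, the ramps are shorter than the spacing, and \<rho>
  bounds (\<psi> + r) / \<psi> from below on the grid by continuity at \<theta>0. After rescaling an estimator f to
  n (f - \<theta>0), the parameter of the i-th grid point is i h, and only the probabilities of the
  cell events depend on n.\<close>

lemma minimax_ge_limit_bayes:
  fixes M :: "nat \<Rightarrow> real \<Rightarrow> 'w measure" and \<delta> :: "nat \<Rightarrow> real"
  assumes ab: "0 < \<alpha>" "\<beta> < \<tau>" and th: "\<theta>0 \<in> {\<alpha><..<\<beta>}"
    and d: "\<And>n. 1 \<le> n \<Longrightarrow> 0 < \<delta> n" "(\<lambda>n. real n * \<delta> n) \<longlonglongrightarrow> 0"
    and samples: "\<And>n \<theta>. 1 \<le> n \<Longrightarrow> \<theta> \<in> {\<alpha><..<\<beta>} \<Longrightarrow>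
      poisson_sample (M n \<theta>) n \<tau> (intensity \<psi> r \<tau> (\<delta> n) \<theta>) (X n \<theta>)"
    and h: "0 < h" and \<epsilon>: "0 < \<epsilon>" and \<rho>: "0 < \<rho>" "\<rho> * \<psi> \<theta>0 < \<psi> \<theta>0 + r"
    and KK: "finite KK" "KK \<subseteq> PiE {..<N} (\<lambda>_. UNIV)"
  shows "ennreal (\<Sum>k\<in>KK. (\<Prod>s<N. poisson_weight (h * \<psi> \<theta>0) (k s)) *
      bayes_risk {..N} (\<lambda>i. real i * h) (limit_likelihood h N \<rho> k))
    \<le> of_nat (N + 1) * liminf (minimax_risk \<alpha> \<beta> \<tau> \<theta>0 M X \<epsilon>)"
proof -
  define u where "u i = real i * h" for i
  define D where "D = real N * h"
  have small: "\<forall>\<^sub>F n in sequentially. D / real n < e" if "0 < e" for e :: real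
    using lim_const_over_n[of D] that by (rule order_tendstoD(2))
  have dsmall: "\<forall>\<^sub>F n in sequentially. real n * \<delta> n < e" if "0 < e" for e :: real
    using d(2) that by (rule order_tendstoD(2))
  have d_le: "\<delta> n \<le> real n * \<delta> n" if "1 \<le> n" for n
    using d(1)[OF that] that by (simp add: mult_le_cancel_right1)
  have u_bound: "\<bar>u i\<bar> \<le> D" if "i \<le> N" for i
    using that h unfolding u_def D_def abs_mult by (intro mult_mono) auto
  have grid: "grid_point \<theta>0 (h / real n) i = \<theta>0 + u i / real n" for n i
    by (simp add: grid_point_def u_def)
  define W where "W n k = (\<Prod>c<2*N+1. poisson_weight (real n *
      mean_count (\<delta> n) (grid_point \<theta>0 (h / real n) N)
      (break_point (\<delta> n) \<theta>0 (h / real n) c) (break_point (\<delta> n) \<theta>0 (h / real n) (Suc c))) (counts k c))"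
    for n k
  define B where "B n = (\<Sum>k\<in>KK. W n k * bayes_risk {..N} u (limit_likelihood h N \<rho> k))" for n
  have th': "\<theta>0 \<in> {0<..<\<tau>}" using th ab by auto
  have "(\<lambda>n. W n k) \<longlonglongrightarrow> (\<Prod>c<2*N+1. poisson_weight (if even c then 0 else h * \<psi> \<theta>0) (counts k c))" for k
    unfolding W_def
  proof (intro tendsto_prod tendsto_poisson_weight)
    fix c assume "c \<in> {..<2*N+1}"
    then show "(\<lambda>n. real n * mean_count (\<delta> n) (grid_point \<theta>0 (h / real n) N)
      (break_point (\<delta> n) \<theta>0 (h / real n) c) (break_point (\<delta> n) \<theta>0 (h / real n) (Suc c)))
      \<longlonglongrightarrow> (if even c then 0 else h * \<psi> \<theta>0)"
      by (intro cell_mean_tendsto[OF th' h d]) auto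
  qed
  then have lim: "B \<longlonglongrightarrow> (\<Sum>k\<in>KK. (\<Prod>s<N. poisson_weight (h * \<psi> \<theta>0) (k s)) *
      bayes_risk {..N} u (limit_likelihood h N \<rho> k))"
    unfolding B_def prod_counts by (intro tendsto_intros)
  define e0 where "e0 = min \<epsilon> (min (\<theta>0 - \<alpha>) (\<beta> - \<theta>0))"
  have e0: "0 < e0" "e0 \<le> \<epsilon>" "e0 \<le> \<theta>0 - \<alpha>" "e0 \<le> \<beta> - \<theta>0" using \<epsilon> th by (auto simp: e0_def)
  have "isCont \<psi> \<theta>0" using psi_cont th' by (intro continuous_on_interior) (auto simp: interior_atLeastAtMost_real)
  then have "isCont (\<lambda>x. \<psi> x + r - \<rho> * \<psi> x) \<theta>0" by (intro continuous_intros)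
  moreover have "0 < \<psi> \<theta>0 + r - \<rho> * \<psi> \<theta>0" using \<rho>(2) by simp
  ultimately obtain e1 where e1: "0 < e1" and near1: "\<And>x. \<bar>x - \<theta>0\<bar> < e1 \<Longrightarrow>
      \<bar>(\<psi> x + r - \<rho> * \<psi> x) - (\<psi> \<theta>0 + r - \<rho> * \<psi> \<theta>0)\<bar> < \<psi> \<theta>0 + r - \<rho> * \<psi> \<theta>0"
    unfolding continuous_at_eps_delta dist_real_def by metis
  have pos1: "0 < \<psi> x + r - \<rho> * \<psi> x" if "\<bar>x - \<theta>0\<bar> < e1" for x
    using near1[OF that] by linarith
  have "\<forall>\<^sub>F n in sequentially. ennreal (B n / real (N + 1)) \<le> minimax_risk \<alpha> \<beta> \<tau> \<theta>0 M X \<epsilon> n"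
    using eventually_ge_at_top[of 1] small[OF e0(1)] small[OF e1] dsmall[OF h]
      dsmall[of "\<tau> - \<beta>", simplified, OF ab(2)]
  proof eventually_elim
    case (elim n)
    have dn: "0 < \<delta> n" by (rule d(1)[OF elim(1)])
    have n0: "0 < real n" using elim(1) by simp
    define \<theta> where "\<theta> i = \<theta>0 + u i / real n" for i
    have near: "\<bar>\<theta> i - \<theta>0\<bar> \<le> D / real n" if "i \<le> N" for i
      using u_bound[OF that] n0 by (simp add: \<theta>_def abs_divide divide_right_mono)
    have in_window: "\<theta> i \<in> {\<theta>\<in>{\<alpha><..<\<beta>}. \<bar>\<theta> - \<theta>0\<bar> < \<epsilon>}" if "i \<le> N" for i
      using near[OF that] elim(2) e0 by (auto simp: abs_le_iff)
    have eq: "\<theta>0 + real i * (h / real n) = \<theta> i" for i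
      using grid[of n i] by (simp add: grid_point_def \<theta>_def)
    have base: "\<theta>0 = \<theta> 0" using eq[of 0] by simp
    interpret change_grid \<tau> r \<psi> n N "\<delta> n" "\<theta>0" "h / real n" "\<lambda>i. M n (\<theta> i)" "\<lambda>i. X n (\<theta> i)"
    proof (rule change_grid.intro[OF change_model_axioms], rule change_grid_axioms.intro)
      show "0 < \<delta> n" by (rule dn)
      show "\<delta> n < h / real n" using elim(4) n0 by (simp add: field_simps)
      show "0 \<le> \<theta>0" using in_window[of 0] ab base by auto
      show "\<theta>0 + real N * (h / real n) + \<delta> n \<le> \<tau>"
      proof -
        have "\<delta> n < \<tau> - \<beta>" using d_le[OF elim(1)] elim(5) by linarith
        then show ?thesis using in_window[of N] unfolding eq by auto
      qed
      show "poisson_sample (M n (\<theta> i)) n \<tau> (intensity \<psi> r \<tau> (\<delta> n) (\<theta>0 + real i * (h / real n))) (X n (\<theta> i))"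
        if "i \<le> N" for i
        unfolding eq using in_window[OF that] by (intro samples elim(1)) auto
    qed
    have likelihood: "exp (- (real n * r * (real (N - i) * (h / real n)))) * \<rho> ^ (\<Sum>s\<in>{i..<N}. k s) =
      limit_likelihood h N \<rho> k i" for i k
      using n0 by (simp add: limit_likelihood_def)
    have ratio: "\<rho> * \<psi> x \<le> \<psi> x + r" if "x \<in> {grid 0..grid N}" for x
    proof -
      have "\<bar>x - \<theta>0\<bar> \<le> D / real n"
        using that near[of 0] near[of N] unfolding grid \<theta>_def[symmetric] by (auto simp: abs_le_iff)
      then have "\<bar>x - \<theta>0\<bar> < e1" using elim(3) by linarith
      from pos1[OF this] show ?thesis by simp
    qed
    show ?case
      unfolding minimax_risk_def
    proof (rule INF_greatest)
      fix f :: "(nat \<Rightarrow> real \<Rightarrow> nat) \<Rightarrow> real" assume f: "f \<in> borel_measurable (sample_space n \<tau>)"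
      let ?g = "\<lambda>\<theta>. ennreal ((real n)\<^sup>2) * (\<integral>\<^sup>+ x. ennreal ((f x - \<theta>)\<^sup>2) \<partial>sample_law n \<tau> (M n \<theta>) (X n \<theta>))"
      let ?S = "SUP \<theta>\<in>{\<theta>\<in>{\<alpha><..<\<beta>}. \<bar>\<theta> - \<theta>0\<bar> < \<epsilon>}. ?g \<theta>"
      have W0: "0 \<le> W n k" for k
        unfolding W_def using mean_intensity_pos[OF dn] breakpoint_in breakpoint_less n0
        by (intro prod_nonneg poisson_weight_nonneg mult_nonneg_nonneg less_imp_le[OF mean_intensity_pos[OF dn]]) auto
      have b0: "0 \<le> bayes_risk {..N} u (limit_likelihood h N \<rho> k)" for k
        using \<rho>(1) by (intro bayes_risk_nonneg) (simp add: limit_likelihood_def)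
      have y: "(\<lambda>x. real n * (f x - \<theta>0)) \<in> borel_measurable (sample_space n \<tau>)" using f by simp
      have "ennreal (B n) = (\<Sum>k\<in>KK. ennreal (W n k) * ennreal (bayes_risk {..N} u (limit_likelihood h N \<rho> k)))"
        unfolding B_def using W0 b0
        by (subst sum_ennreal[symmetric]) (auto simp: ennreal_mult)
      also have "\<dots> \<le> (\<Sum>i\<le>N. \<integral>\<^sup>+x. ennreal ((real n * (f x - \<theta>0) - u i)\<^sup>2) \<partial>law i)"
        using grid_bayes_bound[OF \<rho>(1) ratio KK y, of u] unfolding likelihood W_def .
      also have "\<dots> = (\<Sum>i\<le>N. ?g (\<theta> i))"
      proof (intro sum.cong refl)
        fix i assume "i \<in> {..N}"
        then have i: "i \<le> N" by simp
        have "(real n * (f x - \<theta>0) - u i)\<^sup>2 = (real n)\<^sup>2 * (f x - \<theta> i)\<^sup>2" for x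
          using n0 by (simp add: \<theta>_def power_mult_distrib[symmetric] field_simps)
        then have "(\<integral>\<^sup>+x. ennreal ((real n * (f x - \<theta>0) - u i)\<^sup>2) \<partial>law i) =
           (\<integral>\<^sup>+x. ennreal ((real n)\<^sup>2) * ennreal ((f x - \<theta> i)\<^sup>2) \<partial>law i)"
          by (simp add: ennreal_mult)
        also have "\<dots> = ?g (\<theta> i)"
        proof (rule nn_integral_cmult)
          show "(\<lambda>x. ennreal ((f x - \<theta> i)\<^sup>2)) \<in> borel_measurable (law i)"
            using f sets_law[OF i] by (simp cong: measurable_cong_sets)
        qed
        finally show "(\<integral>\<^sup>+x. ennreal ((real n * (f x - \<theta>0) - u i)\<^sup>2) \<partial>law i) = ?g (\<theta> i)" .
      qed
      also have "\<dots> \<le> (\<Sum>i\<le>N. ?S)" using in_window by (intro sum_mono SUP_upper) auto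
      also have "\<dots> = of_nat (N + 1) * ?S" by simp
      finally have "ennreal (real (N + 1)) * ennreal (B n / real (N + 1)) \<le> ennreal (real (N + 1)) * ?S"
        by (subst ennreal_mult'[symmetric]) (simp_all add: ennreal_of_nat_eq_real_of_nat)
      then show "ennreal (B n / real (N + 1)) \<le> ?S"
        by (subst (asm) ennreal_mult_le_mult_iff) auto
    qed
  qed
  then have "liminf (\<lambda>n. ennreal (B n / real (N + 1))) \<le> liminf (minimax_risk \<alpha> \<beta> \<tau> \<theta>0 M X \<epsilon>)"
    by (rule Liminf_mono)
  moreover have "(\<lambda>n. ennreal (B n / real (N + 1))) \<longlonglongrightarrow> ennreal ((\<Sum>k\<in>KK. (\<Prod>s<N. poisson_weight (h * \<psi> \<theta>0) (k s)) *
      bayes_risk {..N} u (limit_likelihood h N \<rho> k)) / real (N + 1))"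
    by (intro tendsto_ennrealI tendsto_divide lim tendsto_const) simp
  note lim_imp_Liminf[OF sequentially_bot this]
  ultimately have le: "ennreal ((\<Sum>k\<in>KK. (\<Prod>s<N. poisson_weight (h * \<psi> \<theta>0) (k s)) *
      bayes_risk {..N} u (limit_likelihood h N \<rho> k)) / real (N + 1)) \<le> liminf (minimax_risk \<alpha> \<beta> \<tau> \<theta>0 M X \<epsilon>)"
    by simp
  let ?x = "\<Sum>k\<in>KK. (\<Prod>s<N. poisson_weight (h * \<psi> \<theta>0) (k s)) *
      bayes_risk {..N} u (limit_likelihood h N \<rho> k)"
  have "ennreal ?x = ennreal (real (N + 1)) * ennreal (?x / real (N + 1))"
    by (subst ennreal_mult'[symmetric]) simp_all
  also have "\<dots> \<le> ennreal (real (N + 1)) * liminf (minimax_risk \<alpha> \<beta> \<tau> \<theta>0 M X \<epsilon>)"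
    by (rule mult_left_mono[OF le]) simp
  also have "ennreal (real (N + 1)) = of_nat (N + 1)" by (rule ennreal_of_nat_eq_real_of_nat[symmetric])
  also have "u = (\<lambda>i. real i * h)" by (rule ext) (rule u_def)
  finally show ?thesis .
qed

end

section \<open>Riemann sums of the limit likelihood ratio\<close>

lemma rounding_near:
  fixes R :: "real \<Rightarrow> int"
  assumes R: "R = floor \<or> R = ceiling" and h: "0 < h"
  shows "\<bar>h * of_int (R (u / h)) - u\<bar> \<le> h"
proof -
  have "\<bar>of_int (R (u / h)) - u / h\<bar> \<le> 1" using R by (auto; linarith)
  moreover have "\<bar>h * of_int (R (u / h)) - u\<bar> = h * \<bar>of_int (R (u / h)) - u / h\<bar>"
    using h by (simp add: abs_mult[symmetric] right_diff_distrib abs_mult_pos')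
  ultimately show ?thesis using h by (simp add: mult_le_cancel_left1)
qed

lemma rounding_cell:
  fixes R :: "real \<Rightarrow> int"
  assumes R: "R = floor \<or> R = ceiling" and h: "0 < h"
  shows "{u. R (u / h) = l} \<in> sets lborel" "emeasure lborel {u. R (u / h) = l} = ennreal h"
proof -
  have "{u. R (u / h) = l} = {real_of_int l * h..<real_of_int l * h + h} \<or>
      {u. R (u / h) = l} = {real_of_int l * h - h<..real_of_int l * h}"
    using R
  proof
    assume "R = floor"
    then have "{u. R (u / h) = l} = {real_of_int l * h..<real_of_int l * h + h}"
      using h by (auto simp: floor_eq_iff field_simps)
    then show ?thesis ..
  next
    assume "R = ceiling"
    then have "{u. R (u / h) = l} = {real_of_int l * h - h<..real_of_int l * h}"
      using h by (auto simp: ceiling_eq_iff field_simps)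
    then show ?thesis ..
  qed
  then show "{u. R (u / h) = l} \<in> sets lborel" "emeasure lborel {u. R (u / h) = l} = ennreal h"
    using h by auto
qed

text \<open>A Riemann sum is the integral of a step function, obtained by rounding the argument to the
  grid. The rounding direction R is chosen so that rounding increases Z at most by a
  constant factor; then a multiple of Z dominates the step functions, also in the tails, where
  a bound on Z over compact sets would not help.\<close>

lemma riemann_sums_tendsto:
  fixes Z \<phi> w :: "real \<Rightarrow> real" and R :: "real \<Rightarrow> int" and h :: "nat \<Rightarrow> real" and p q :: "nat \<Rightarrow> nat"
  assumes R: "R = floor \<or> R = ceiling"
    and Z: "\<And>u. 0 \<le> Z u" "Z \<in> borel_measurable borel" "countable {u. \<not> isCont Z u}"
    and dom: "\<And>u h. 0 < h \<Longrightarrow> h \<le> 1 \<Longrightarrow> Z (h * of_int (R (u / h))) \<le> C * Z u"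
    and \<phi>: "\<And>u. isCont \<phi> u" "\<And>u v. \<bar>v - u\<bar> \<le> 1 \<Longrightarrow> \<bar>\<phi> v\<bar> \<le> w u"
    and int: "integrable lborel (\<lambda>u. w u * Z u)"
    and h: "\<And>k. 0 < h k" "\<And>k. h k \<le> 1" "h \<longlonglongrightarrow> 0"
    and pq: "filterlim (\<lambda>k. h k * real (p k)) at_top sequentially"
      "filterlim (\<lambda>k. h k * real (q k)) at_top sequentially"
  shows "(\<lambda>k. h k * (\<Sum>l\<in>{- int (p k)..int (q k)}. \<phi> (of_int l * h k) * Z (of_int l * h k)))
    \<longlonglongrightarrow> (LINT u|lborel. \<phi> u * Z u)"
proof -
  define f where "f k u = (\<Sum>l\<in>{- int (p k)..int (q k)}.
      (\<phi> (of_int l * h k) * Z (of_int l * h k)) * indicator {u. R (u / h k) = l} u)" for k u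
  note cell = rounding_cell[OF R h(1)]
  have term_int: "integrable lborel (\<lambda>u. c * indicator {u. R (u / h k) = l} u)" for c :: real and k l
    using cell[of k l] by (intro integrable_mult_right integrable_real_indicator) auto
  have f_meas: "f k \<in> borel_measurable lborel" for k
    unfolding f_def by (rule borel_measurable_sum) (rule borel_measurable_integrable[OF term_int])
  have int_f: "(LINT u|lborel. f k u) =
      h k * (\<Sum>l\<in>{- int (p k)..int (q k)}. \<phi> (of_int l * h k) * Z (of_int l * h k))" for k
  proof -
    have "(LINT u|lborel. f k u) = (\<Sum>l\<in>{- int (p k)..int (q k)}.
      LINT u|lborel. (\<phi> (of_int l * h k) * Z (of_int l * h k)) * indicator {u. R (u / h k) = l} u)"
      unfolding f_def by (rule Bochner_Integration.integral_sum) (rule term_int)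
    also have "\<dots> = (\<Sum>l\<in>{- int (p k)..int (q k)}. (\<phi> (of_int l * h k) * Z (of_int l * h k)) * h k)"
    proof (intro sum.cong refl)
      fix l
      have "measure lborel {u. R (u / h k) = l} = h k"
        using cell(2)[of k l] h(1)[of k] by (simp add: measure_def)
      then show "(LINT u|lborel. (\<phi> (of_int l * h k) * Z (of_int l * h k)) * indicator {u. R (u / h k) = l} u) =
         (\<phi> (of_int l * h k) * Z (of_int l * h k)) * h k"
        using cell(1)[of k l] by simp
    qed
    finally show ?thesis by (simp add: sum_distrib_left mult.commute)
  qed
  have f_eq: "f k u = (if R (u / h k) \<in> {- int (p k)..int (q k)}
      then \<phi> (h k * of_int (R (u / h k))) * Z (h k * of_int (R (u / h k))) else 0)" for k u
  proof -
    have "f k u = (\<Sum>l\<in>{- int (p k)..int (q k)}. if l = R (u / h k)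
        then \<phi> (of_int l * h k) * Z (of_int l * h k) else 0)"
      unfolding f_def by (intro sum.cong refl) (auto simp: indicator_def)
    then show ?thesis by (simp add: mult.commute)
  qed
  note near = rounding_near[OF R h(1)]
  have bound: "norm (f k u) \<le> C * (w u * Z u)" for k u
  proof -
    have 1: "Z (h k * of_int (R (u / h k))) \<le> C * Z u" by (rule dom[OF h(1,2)])
    then have C: "0 \<le> C * Z u" using Z(1) order_trans by blast
    have 2: "\<bar>\<phi> (h k * of_int (R (u / h k)))\<bar> \<le> w u"
      using near[of k u] h(2)[of k] by (intro \<phi>(2)) linarith
    then have "0 \<le> w u" by linarith
    have "norm (f k u) \<le> \<bar>\<phi> (h k * of_int (R (u / h k)))\<bar> * Z (h k * of_int (R (u / h k)))"
      unfolding f_eq using Z(1) by (simp add: abs_mult)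
    also have "\<dots> \<le> w u * (C * Z u)" using 1 2 Z(1) \<open>0 \<le> w u\<close> by (intro mult_mono) auto
    finally show ?thesis by (simp add: mult_ac)
  qed
  have conv: "(\<lambda>k. f k u) \<longlonglongrightarrow> \<phi> u * Z u" if u: "isCont Z u" for u
  proof -
    have "(\<lambda>k. h k * of_int (R (u / h k)) - u) \<longlonglongrightarrow> 0"
      by (rule Lim_null_comparison[OF _ h(3)]) (use near in auto)
    then have lim: "(\<lambda>k. h k * of_int (R (u / h k))) \<longlonglongrightarrow> u" by (rule LIM_zero_cancel)
    have "(\<lambda>k. \<phi> (h k * of_int (R (u / h k))) * Z (h k * of_int (R (u / h k)))) \<longlonglongrightarrow> \<phi> u * Z u"
      by (intro tendsto_mult isCont_tendsto_compose[OF \<phi>(1) lim] isCont_tendsto_compose[OF u lim])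
    moreover have "\<forall>\<^sub>F k in sequentially. \<phi> (h k * of_int (R (u / h k))) * Z (h k * of_int (R (u / h k))) = f k u"
    proof -
      have ev: "\<forall>\<^sub>F k in sequentially. \<bar>u\<bar> + 1 \<le> h k * real (p k) \<and> \<bar>u\<bar> + 1 \<le> h k * real (q k)"
        using pq unfolding filterlim_at_top by (auto intro: eventually_conj)
      then show ?thesis
      proof eventually_elim
        case (elim k)
        have "\<bar>h k * of_int (R (u / h k))\<bar> \<le> \<bar>u\<bar> + 1" using near[of k u] h(2)[of k] by linarith
        then have "h k * of_int (R (u / h k)) \<le> h k * real (q k)" "h k * - real (p k) \<le> h k * of_int (R (u / h k))"
          using elim by auto
        then have "of_int (R (u / h k)) \<le> real (q k)" "- real (p k) \<le> of_int (R (u / h k))"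
          by (simp_all only: mult_le_cancel_left_pos[OF h(1)])
        then have "R (u / h k) \<in> {- int (p k)..int (q k)}" by auto
        then show ?case unfolding f_eq by simp
      qed
    qed
    ultimately show ?thesis by (rule Lim_transform_eventually)
  qed
  have "(\<lambda>k. LINT u|lborel. f k u) \<longlonglongrightarrow> (LINT u|lborel. \<phi> u * Z u)"
  proof (rule integral_dominated_convergence)
    have "\<phi> \<in> borel_measurable borel"
      using \<phi>(1) by (intro borel_measurable_continuous_onI continuous_at_imp_continuous_on) auto
    then show "(\<lambda>u. \<phi> u * Z u) \<in> borel_measurable lborel" using Z(2) by simp
    show "integrable lborel (\<lambda>u. C * (w u * Z u))" using int by simp
    have "AE u in lborel. u \<notin> {u. \<not> isCont Z u}"
      by (intro AE_not_in countable_imp_null_set_lborel Z(3))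
    then show "AE u in lborel. (\<lambda>k. f k u) \<longlonglongrightarrow> \<phi> u * Z u"
      by (rule AE_mp) (use conv in auto)
  qed (use f_meas bound in auto)
  then show ?thesis by (simp add: int_f)
qed

definition counting_path :: "(real \<Rightarrow> nat) \<Rightarrow> bool" where
  "counting_path y \<longleftrightarrow> y 0 = 0 \<and> mono_on {0..} y"

text \<open>Both branches of Zstar have the form exp (ln (a / b) * W u + (b - a) * u) with this single
  monotone function W.\<close>

definition two_sided :: "(real \<Rightarrow> nat) \<Rightarrow> (real \<Rightarrow> nat) \<Rightarrow> real \<Rightarrow> real" where
  "two_sided yp ym u = (if u \<ge> 0 then real (yp u) else - real (ym (- u)))"

lemma mono_two_sided:
  assumes "counting_path yp" "counting_path ym"
  shows "mono (two_sided yp ym)"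
proof (rule monoI)
  fix u v :: real assume uv: "u \<le> v"
  have "yp u \<le> yp v" if "0 \<le> u"
    using assms(1) uv that unfolding counting_path_def by (auto intro: mono_onD)
  moreover have "ym (- v) \<le> ym (- u)" if "v < 0"
    using assms(2) uv that unfolding counting_path_def by (auto intro: mono_onD)
  moreover have "- real (ym (- u)) \<le> real (yp v)" by (rule order_trans[of _ 0]) auto
  ultimately show "two_sided yp ym u \<le> two_sided yp ym v"
    using uv unfolding two_sided_def by auto
qed

lemma Zstar_eq:
  assumes "0 < a" "0 < b"
  shows "Zstar a b yp ym u = exp (ln (a / b) * two_sided yp ym u + (b - a) * u)"
  using assms by (auto simp: Zstar_def two_sided_def ln_div algebra_simps)

lemma Zstar_pos: "0 < Zstar a b yp ym u"
  by (simp add: Zstar_def)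

text \<open>The quotient in zeta with both integrals replaced by Riemann sums of mesh h over the grid
  points - p h, ..., q h; the factor h cancels.\<close>

definition zeta_sum :: "real \<Rightarrow> real \<Rightarrow> (real \<Rightarrow> nat) \<Rightarrow> (real \<Rightarrow> nat) \<Rightarrow> real \<Rightarrow> nat \<Rightarrow> nat \<Rightarrow> real" where
  "zeta_sum a b yp ym h p q =
     (\<Sum>l\<in>{- int p..int q}. of_int l * h * Zstar a b yp ym (of_int l * h)) /
     (\<Sum>l\<in>{- int p..int q}. Zstar a b yp ym (of_int l * h))"

text \<open>If a \<le> b then Zstar grows at most exponentially to the right, as its jumps are downward; if
  a > b the same holds to the left. This decides whether arguments are rounded up or down.\<close>

lemma zeta_sum_tendsto:
  assumes ab: "0 < a" "0 < b" and y: "counting_path yp" "counting_path ym"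
    and int: "integrable lborel (Zstar a b yp ym)" "integrable lborel (\<lambda>u. u * Zstar a b yp ym u)"
    and pos: "(LINT u|lborel. Zstar a b yp ym u) \<noteq> 0"
    and h: "\<And>k. 0 < h k" "\<And>k. h k \<le> 1" "h \<longlonglongrightarrow> 0"
    and pq: "filterlim (\<lambda>k. h k * real (p k)) at_top sequentially"
      "filterlim (\<lambda>k. h k * real (q k)) at_top sequentially"
  shows "(\<lambda>k. zeta_sum a b yp ym (h k) (p k) (q k)) \<longlonglongrightarrow> zeta a b yp ym"
proof -
  let ?Z = "Zstar a b yp ym" and ?W = "two_sided yp ym"
  define R :: "real \<Rightarrow> int" where "R = (if a \<le> b then ceiling else floor)"
  have R: "R = floor \<or> R = ceiling" by (simp add: R_def)
  have W: "mono ?W" by (rule mono_two_sided[OF y])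
  have Zeq: "?Z = (\<lambda>u. exp (ln (a / b) * ?W u + (b - a) * u))" using Zstar_eq[OF ab] by auto
  have meas: "?Z \<in> borel_measurable borel"
    unfolding Zeq using borel_measurable_mono[OF W] by measurable
  have "{u. \<not> isCont ?Z u} \<subseteq> {u. \<not> isCont ?W u}"
    unfolding Zeq by (auto intro!: continuous_intros)
  then have count: "countable {u. \<not> isCont ?Z u}"
    using mono_ctble_discont[OF W] countable_subset by blast
  have dom: "?Z (h * of_int (R (u / h))) \<le> exp \<bar>b - a\<bar> * ?Z u" if h: "0 < h" "h \<le> 1" for u h
  proof -
    let ?v = "h * of_int (R (u / h))"
    have near: "\<bar>?v - u\<bar> \<le> 1" using rounding_near[OF R h(1), of u] h(2) by linarith
    have "ln (a / b) * ?W ?v \<le> ln (a / b) * ?W u"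
    proof (cases "a \<le> b")
      case True
      have "u / h \<le> of_int (R (u / h))" unfolding R_def using True by simp
      then have "u \<le> ?v" using h(1) by (simp add: field_simps)
      then have "?W u \<le> ?W ?v" using W by (auto dest: monoD)
      moreover have "ln (a / b) \<le> 0" using True ab by simp
      ultimately show ?thesis by (intro mult_left_mono_neg)
    next
      case False
      have "of_int (R (u / h)) \<le> u / h" unfolding R_def using False by simp
      then have "?v \<le> u" using h(1) by (simp add: field_simps)
      then have "?W ?v \<le> ?W u" using W by (auto dest: monoD)
      moreover have "0 \<le> ln (a / b)" using False ab by simp
      ultimately show ?thesis by (intro mult_left_mono)
    qed
    moreover have "(b - a) * (?v - u) \<le> \<bar>b - a\<bar> * 1"
    proof -
      have "(b - a) * (?v - u) \<le> \<bar>b - a\<bar> * \<bar>?v - u\<bar>" by (simp add: abs_mult[symmetric])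
      also have "\<dots> \<le> \<bar>b - a\<bar> * 1" using near by (intro mult_left_mono) auto
      finally show ?thesis .
    qed
    ultimately show ?thesis unfolding Zeq by (simp add: mult_exp_exp algebra_simps)
  qed
  have Z0: "0 \<le> ?Z u" for u using Zstar_pos less_imp_le by blast
  have 1: "(\<lambda>k. h k * (\<Sum>l\<in>{- int (p k)..int (q k)}. 1 * ?Z (of_int l * h k)))
    \<longlonglongrightarrow> (LINT u|lborel. 1 * ?Z u)"
    by (rule riemann_sums_tendsto[OF R Z0 meas count dom _ _ _ h pq, where w = "\<lambda>_. 1"]) (use int in auto)
  have 2: "(\<lambda>k. h k * (\<Sum>l\<in>{- int (p k)..int (q k)}. (of_int l * h k) * ?Z (of_int l * h k)))
    \<longlonglongrightarrow> (LINT u|lborel. u * ?Z u)"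
  proof (rule riemann_sums_tendsto[OF R Z0 meas count dom _ _ _ h pq, where w = "\<lambda>u. \<bar>u\<bar> + 1"])
    have "(\<lambda>u. (\<bar>u\<bar> + 1) * ?Z u) = (\<lambda>u. \<bar>u * ?Z u\<bar> + ?Z u)"
      using Z0 by (simp add: fun_eq_iff abs_mult algebra_simps)
    then show "integrable lborel (\<lambda>u. (\<bar>u\<bar> + 1) * ?Z u)" using int by simp
  qed auto
  have "(\<lambda>k. (h k * (\<Sum>l\<in>{- int (p k)..int (q k)}. (of_int l * h k) * ?Z (of_int l * h k))) /
     (h k * (\<Sum>l\<in>{- int (p k)..int (q k)}. 1 * ?Z (of_int l * h k))))
     \<longlonglongrightarrow> (LINT u|lborel. u * ?Z u) / (LINT u|lborel. 1 * ?Z u)"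
    by (rule tendsto_divide[OF 2 1]) (use pos in simp)
  moreover have "h k \<noteq> 0" for k using h(1)[of k] by simp
  ultimately show ?thesis by (simp add: zeta_sum_def[abs_def] zeta_def)
qed

text \<open>If one of the integrals does not exist, or the denominator vanishes, then zeta is 0 by the
  conventions for integrals and division, and the bound is trivial. So the lower bound holds for
  every pair of counting paths, not only almost surely.\<close>

lemma zeta_le_liminf:
  assumes ab: "0 < a" "0 < b" and y: "counting_path yp" "counting_path ym"
    and h: "\<And>k. 0 < h k" "\<And>k. h k \<le> 1" "h \<longlonglongrightarrow> 0"
    and pq: "filterlim (\<lambda>k. h k * real (p k)) at_top sequentially"
      "filterlim (\<lambda>k. h k * real (q k)) at_top sequentially"
  shows "ennreal ((zeta a b yp ym)\<^sup>2) \<le> liminf (\<lambda>k. ennreal ((zeta_sum a b yp ym (h k) (p k) (q k))\<^sup>2))"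
proof (cases "zeta a b yp ym = 0")
  case False
  then have pos: "(LINT u|lborel. Zstar a b yp ym u) \<noteq> 0" and pos': "(LINT u|lborel. u * Zstar a b yp ym u) \<noteq> 0"
    by (auto simp: zeta_def)
  have "integrable lborel (Zstar a b yp ym)" "integrable lborel (\<lambda>u. u * Zstar a b yp ym u)"
    using pos pos' not_integrable_integral_eq by blast+
  then have "(\<lambda>k. zeta_sum a b yp ym (h k) (p k) (q k)) \<longlonglongrightarrow> zeta a b yp ym"
    by (intro zeta_sum_tendsto[OF ab y] pos h pq)
  then have "(\<lambda>k. ennreal ((zeta_sum a b yp ym (h k) (p k) (q k))\<^sup>2)) \<longlonglongrightarrow> ennreal ((zeta a b yp ym)\<^sup>2)"
    by (intro tendsto_ennrealI tendsto_power)
  from lim_imp_Liminf[OF sequentially_bot this] show ?thesis by (metis order_refl)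
qed simp

section \<open>The limit experiment\<close>

locale two_poisson = prob_space S for S :: "'v measure" +
  fixes a b :: real and Yp Ym :: "real \<Rightarrow> 'v \<Rightarrow> nat"
  assumes a_pos: "0 < a" and b_pos: "0 < b"
    and Yp: "poisson_process S {0..} (\<lambda>_. b) Yp"
    and Ym: "poisson_process S {0..} (\<lambda>_. a) Ym"
    and Y_indep: "indep_var (path_space {0..}) (path_of {0..} Yp) (path_space {0..}) (path_of {0..} Ym)"
begin

abbreviation Z_at :: "'v \<Rightarrow> real \<Rightarrow> real" where
  "Z_at \<omega> \<equiv> Zstar a b (\<lambda>u. Yp u \<omega>) (\<lambda>u. Ym u \<omega>)"

abbreviation zeta_at :: "'v \<Rightarrow> real \<Rightarrow> nat \<Rightarrow> nat \<Rightarrow> real" where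
  "zeta_at \<omega> \<equiv> zeta_sum a b (\<lambda>u. Yp u \<omega>) (\<lambda>u. Ym u \<omega>)"

lemma counting_path_Y:
  assumes "\<omega> \<in> space S"
  shows "counting_path (\<lambda>u. Yp u \<omega>)" "counting_path (\<lambda>u. Ym u \<omega>)"
  using Yp Ym assms unfolding poisson_process_def counting_path_def by blast+

lemma Y_measurable:
  assumes "0 \<le> u"
  shows "Yp u \<in> measurable S (count_space UNIV)" "Ym u \<in> measurable S (count_space UNIV)"
  using Yp Ym assms unfolding poisson_process_def by auto

lemma grid_increments:
  assumes N: "poisson_process S {0..} (\<lambda>_. c) N" and c: "0 < c" and h: "0 < h"
  shows "prob {\<omega>\<in>space S. \<forall>l<K. N (real (Suc l) * h) \<omega> - N (real l * h) \<omega> = d l} =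
    (\<Prod>l<K. poisson_weight (c * h) (d l))"
proof -
  have step: "real l * h < real (Suc l) * h" for l using h by simp
  have len: "(LINT x:{real l * h..real (Suc l) * h}|lborel. c) = c * h" for l
    using step[of l] by (simp add: set_lebesgue_integral_def algebra_simps)
  have "prob {\<omega>\<in>space S. \<forall>l<K. N (real (Suc l) * h) \<omega> - N (real l * h) \<omega> = d l} =
    (\<Prod>l<K. poisson_weight (LINT x:{real l * h..real (Suc l) * h}|lborel. c) (d l))"
    by (rule poisson_process_increments[OF N, where t = "\<lambda>l. real l * h"])
      (use h c step in \<open>simp_all only: len, auto\<close>)
  then show ?thesis unfolding len .
qed

text \<open>The counts of the cells s < N when the i-th grid point is the true one: cells before i are
  filled by Ym, counted backwards from i, and the others by Yp.\<close>

definition cell_count :: "real \<Rightarrow> nat \<Rightarrow> 'v \<Rightarrow> nat \<Rightarrow> nat" where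
  "cell_count h i \<omega> s =
     (if s < i then Ym (real (Suc (i - Suc s)) * h) \<omega> - Ym (real (i - Suc s) * h) \<omega>
      else Yp (real (Suc (s - i)) * h) \<omega> - Yp (real (s - i) * h) \<omega>)"

lemma cell_count_iff:
  assumes "i \<le> N"
  shows "(\<forall>s<N. cell_count h i \<omega> s = k s) \<longleftrightarrow>
    (\<forall>l<i. Ym (real (Suc l) * h) \<omega> - Ym (real l * h) \<omega> = k (i - Suc l)) \<and>
    (\<forall>l<N-i. Yp (real (Suc l) * h) \<omega> - Yp (real l * h) \<omega> = k (i + l))" (is "?L \<longleftrightarrow> ?M \<and> ?P")
proof
  assume L: ?L
  have ?M
  proof (intro allI impI)
    fix l assume l: "l < i"
    then have "i - Suc l < N" "i - Suc l < i" "i - Suc (i - Suc l) = l" using assms by auto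
    then show "Ym (real (Suc l) * h) \<omega> - Ym (real l * h) \<omega> = k (i - Suc l)"
      using L[rule_format, of "i - Suc l"] by (simp only: cell_count_def if_True simp_thms)
  qed
  moreover have ?P
  proof (intro allI impI)
    fix l assume l: "l < N - i"
    then have "i + l < N" "\<not> i + l < i" "i + l - i = l" by auto
    then show "Yp (real (Suc l) * h) \<omega> - Yp (real l * h) \<omega> = k (i + l)"
      using L[rule_format, of "i + l"] by (simp only: cell_count_def if_False simp_thms)
  qed
  ultimately show "?M \<and> ?P" ..
next
  assume MP: "?M \<and> ?P"
  show ?L
  proof (intro allI impI)
    fix s assume s: "s < N"
    show "cell_count h i \<omega> s = k s"
    proof (cases "s < i")
      case True
      then have "i - Suc s < i" "i - Suc (i - Suc s) = s" by auto
      then show ?thesis using MP True unfolding cell_count_def by metis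
    next
      case False
      then have "s - i < N - i" "i + (s - i) = s" using s by auto
      then show ?thesis using MP False unfolding cell_count_def by metis
    qed
  qed
qed

lemma prob_cell_counts:
  assumes h: "0 < h" and i: "i \<le> N"
  shows "prob {\<omega>\<in>space S. \<forall>s<N. cell_count h i \<omega> s = k s} =
    (\<Prod>s<N. poisson_weight (if s < i then a * h else b * h) (k s))"
proof -
  let ?T = "{0::real..}"
  let ?A = "{x \<in> space (path_space ?T). \<forall>l<N-i. x (real (Suc l) * h) - x (real l * h) = k (i + l)}"
  let ?B = "{x \<in> space (path_space ?T). \<forall>l<i. x (real (Suc l) * h) - x (real l * h) = k (i - Suc l)}"
  have t: "real l * h \<in> ?T" for l using h by simp
  have AB: "?A \<in> sets (path_space ?T)" "?B \<in> sets (path_space ?T)"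
    by (rule increment_event[where t = "\<lambda>l. real l * h"], rule t)+
  have iffs: "path_of ?T Yp \<omega> \<in> ?A \<longleftrightarrow> (\<forall>l<N-i. Yp (real (Suc l) * h) \<omega> - Yp (real l * h) \<omega> = k (i + l))"
    "path_of ?T Ym \<omega> \<in> ?B \<longleftrightarrow> (\<forall>l<i. Ym (real (Suc l) * h) \<omega> - Ym (real l * h) \<omega> = k (i - Suc l))" for \<omega>
    by (rule path_of_increment_iff[where t = "\<lambda>l. real l * h"], rule t)+
  have "{\<omega>\<in>space S. \<forall>s<N. cell_count h i \<omega> s = k s} =
      (\<lambda>x. (path_of ?T Yp x, path_of ?T Ym x)) -` (?A \<times> ?B) \<inter> space S"
    unfolding cell_count_iff[OF i] iffs[symmetric] by blast
  then have "prob {\<omega>\<in>space S. \<forall>s<N. cell_count h i \<omega> s = k s} =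
     prob (path_of ?T Yp -` ?A \<inter> space S) * prob (path_of ?T Ym -` ?B \<inter> space S)"
    using indep_varD[OF Y_indep AB] by simp
  also have "path_of ?T Yp -` ?A \<inter> space S =
      {\<omega>\<in>space S. \<forall>l<N-i. Yp (real (Suc l) * h) \<omega> - Yp (real l * h) \<omega> = k (i + l)}"
    unfolding iffs[symmetric] by blast
  also have "path_of ?T Ym -` ?B \<inter> space S =
      {\<omega>\<in>space S. \<forall>l<i. Ym (real (Suc l) * h) \<omega> - Ym (real l * h) \<omega> = k (i - Suc l)}"
    unfolding iffs[symmetric] by blast
  also have "prob {\<omega>\<in>space S. \<forall>l<N-i. Yp (real (Suc l) * h) \<omega> - Yp (real l * h) \<omega> = k (i + l)} =
      (\<Prod>l<N-i. poisson_weight (b * h) (k (i + l)))"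
    by (rule grid_increments[OF Yp b_pos h])
  also have "prob {\<omega>\<in>space S. \<forall>l<i. Ym (real (Suc l) * h) \<omega> - Ym (real l * h) \<omega> = k (i - Suc l)} =
      (\<Prod>l<i. poisson_weight (a * h) (k (i - Suc l)))"
    by (rule grid_increments[OF Ym a_pos h])
  also have "(\<Prod>l<i. poisson_weight (a * h) (k (i - Suc l))) = (\<Prod>s<i. poisson_weight (a * h) (k s))"
    by (rule prod.nat_diff_reindex)
  also have "(\<Prod>l<N-i. poisson_weight (b * h) (k (i + l))) = (\<Prod>s\<in>{i..<N}. poisson_weight (b * h) (k s))"
    by (rule prod.reindex_bij_witness[of _ "\<lambda>s. s - i" "\<lambda>l. i + l"]) auto
  also have "(\<Prod>s\<in>{i..<N}. poisson_weight (b * h) (k s)) * (\<Prod>s<i. poisson_weight (a * h) (k s)) =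
      (\<Prod>s<N. poisson_weight (if s < i then a * h else b * h) (k s))"
  proof -
    let ?f = "\<lambda>s. poisson_weight (if s < i then a * h else b * h) (k s)"
    have "prod ?f ({i..<N} \<union> {..<i}) = prod ?f {i..<N} * prod ?f {..<i}"
      by (rule prod.union_disjoint) auto
    moreover have "{i..<N} \<union> {..<i} = {..<N}" using i by auto
    moreover have "prod ?f {i..<N} = (\<Prod>s\<in>{i..<N}. poisson_weight (b * h) (k s))"
      "prod ?f {..<i} = (\<Prod>s<i. poisson_weight (a * h) (k s))"
      by (auto intro!: prod.cong)
    ultimately show ?thesis by simp
  qed
  finally show ?thesis .
qed

text \<open>The limit likelihood of the i-th relative to the last grid point, for the cell counts k.\<close>

definition likelihood :: "real \<Rightarrow> nat \<Rightarrow> (nat \<Rightarrow> nat) \<Rightarrow> nat \<Rightarrow> real" where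
  "likelihood h N k i = exp (- ((b - a) * (real (N - i) * h))) * (b / a) ^ (\<Sum>s\<in>{i..<N}. k s)"

lemma likelihood_pos: "0 < likelihood h N k i"
  unfolding likelihood_def using a_pos b_pos by simp

lemma poisson_weight_change_rate:
  assumes "0 < h"
  shows "poisson_weight (a * h) k * (exp (- ((b - a) * h)) * (b / a) ^ k) = poisson_weight (b * h) k"
  using assms a_pos by (simp add: poisson_weight_def power_mult_distrib power_divide field_simps mult_exp_exp)

lemma prod_poisson_weight_likelihood:
  assumes h: "0 < h" and i: "i \<le> N"
  shows "(\<Prod>s<N. poisson_weight (h * a) (k s)) * likelihood h N k i =
    (\<Prod>s<N. poisson_weight (if s < i then a * h else b * h) (k s))"
proof -
  have "likelihood h N k i = (\<Prod>s\<in>{i..<N}. exp (- ((b - a) * h)) * (b / a) ^ k s)"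
  proof -
    have "exp (- ((b - a) * (real (N - i) * h))) = exp (- ((b - a) * h)) ^ (N - i)"
      by (simp add: exp_of_nat_mult[symmetric])
    then show ?thesis by (simp add: likelihood_def prod.distrib power_sum)
  qed
  also have "\<dots> = (\<Prod>s<N. if s < i then 1 else exp (- ((b - a) * h)) * (b / a) ^ k s)"
    using i by (intro prod.mono_neutral_cong_left) auto
  finally have "(\<Prod>s<N. poisson_weight (h * a) (k s)) * likelihood h N k i =
    (\<Prod>s<N. poisson_weight (a * h) (k s) * (if s < i then 1 else exp (- ((b - a) * h)) * (b / a) ^ k s))"
    by (simp add: prod.distrib mult.commute[of h])
  also have "\<dots> = (\<Prod>s<N. poisson_weight (if s < i then a * h else b * h) (k s))"
    by (intro prod.cong refl) (use poisson_weight_change_rate[OF h] in auto)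
  finally show ?thesis .
qed

text \<open>Moving the change point from i to j exchanges the rates a and b on the cells between them. The
  points there are counted, starting from i, by Yp if j lies to the right and by Ym otherwise,
  which gives the two branches of Zstar.\<close>

lemma likelihood_ratio:
  assumes w: "\<omega> \<in> space S" and h: "0 < h" and i: "i \<le> N" and j: "j \<le> N"
    and k: "\<And>s. s < N \<Longrightarrow> k s = cell_count h i \<omega> s"
  shows "likelihood h N k j = likelihood h N k i *
    Z_at \<omega> ((real j - real i) * h)"
proof -
  note cp = counting_path_Y[OF w]
  have mono: "Yp (real l * h) \<omega> \<le> Yp (real l' * h) \<omega>" "Ym (real l * h) \<omega> \<le> Ym (real l' * h) \<omega>" if "l \<le> l'" for l l'
    using cp that h unfolding counting_path_def by (auto intro!: mono_onD[of "{0..}" "\<lambda>u. Yp u \<omega>"] mono_onD[of "{0..}" "\<lambda>u. Ym u \<omega>"] mult_right_mono)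
  have zero: "Yp 0 \<omega> = 0" "Ym 0 \<omega> = 0" using cp unfolding counting_path_def by auto
  have Z: "Z_at \<omega> u =
      exp (ln (a / b) * two_sided (\<lambda>u. Yp u \<omega>) (\<lambda>u. Ym u \<omega>) u + (b - a) * u)" for u
    by (rule Zstar_eq[OF a_pos b_pos])
  have pow: "(b / a) ^ m = exp (- (ln (a / b) * real m))" for m
  proof -
    have "(b / a) ^ m = exp (ln (b / a)) ^ m" using a_pos b_pos by simp
    also have "\<dots> = exp (real m * ln (b / a))" by (rule exp_of_nat_mult[symmetric])
    finally show ?thesis using a_pos b_pos by (simp add: ln_div algebra_simps)
  qed
  have L: "likelihood h N k l = exp (- ((b - a) * (real (N - l) * h)) - ln (a / b) * real (\<Sum>s\<in>{l..<N}. k s))" for l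
    unfolding likelihood_def pow by (simp add: mult_exp_exp)
  show ?thesis
  proof (cases "i \<le> j")
    case True
    have "(\<Sum>s\<in>{i..<j}. k s) = (\<Sum>s\<in>{i..<j}. Yp (real (Suc (s - i)) * h) \<omega> - Yp (real (s - i) * h) \<omega>)"
      using j by (intro sum.cong refl) (simp add: k cell_count_def)
    also have "\<dots> = (\<Sum>l\<in>{0..<j-i}. Yp (real (Suc l) * h) \<omega> - Yp (real l * h) \<omega>)"
      using True by (intro sum.reindex_bij_witness[of _ "\<lambda>l. l + i" "\<lambda>s. s - i"]) auto
    also have "\<dots> = Yp (real (j - i) * h) \<omega> - Yp (real 0 * h) \<omega>"
      by (rule sum_telescope_nat) (auto intro!: mono simp del: of_nat_Suc)
    finally have sum: "(\<Sum>s\<in>{i..<j}. k s) = Yp (real (j - i) * h) \<omega>" by (simp add: zero)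
    have "(\<Sum>s\<in>{i..<N}. k s) = (\<Sum>s\<in>{i..<j}. k s) + (\<Sum>s\<in>{j..<N}. k s)"
      using True j by (simp add: sum.atLeastLessThan_concat)
    moreover have "two_sided (\<lambda>u. Yp u \<omega>) (\<lambda>u. Ym u \<omega>) ((real j - real i) * h) = real (Yp (real (j - i) * h) \<omega>)"
      using True h by (simp add: two_sided_def of_nat_diff)
    ultimately show ?thesis
      unfolding L Z using True i j sum by (simp add: mult_exp_exp of_nat_diff algebra_simps)
  next
    case False
    then have ji: "j < i" by simp
    have "(\<Sum>s\<in>{j..<i}. k s) = (\<Sum>s\<in>{j..<i}. Ym (real (Suc (i - Suc s)) * h) \<omega> - Ym (real (i - Suc s) * h) \<omega>)"
      using i by (intro sum.cong refl) (simp add: k cell_count_def)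
    also have "\<dots> = (\<Sum>l\<in>{0..<i-j}. Ym (real (Suc l) * h) \<omega> - Ym (real l * h) \<omega>)"
      using ji by (intro sum.reindex_bij_witness[of _ "\<lambda>l. i - Suc l" "\<lambda>s. i - Suc s"]) auto
    also have "\<dots> = Ym (real (i - j) * h) \<omega> - Ym (real 0 * h) \<omega>"
      by (rule sum_telescope_nat) (auto intro!: mono simp del: of_nat_Suc)
    finally have sum: "(\<Sum>s\<in>{j..<i}. k s) = Ym (real (i - j) * h) \<omega>" by (simp add: zero)
    have "(\<Sum>s\<in>{j..<N}. k s) = (\<Sum>s\<in>{j..<i}. k s) + (\<Sum>s\<in>{i..<N}. k s)"
      using ji i by (simp add: sum.atLeastLessThan_concat)
    moreover have "two_sided (\<lambda>u. Yp u \<omega>) (\<lambda>u. Ym u \<omega>) ((real j - real i) * h) = - real (Ym (real (i - j) * h) \<omega>)"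
    proof -
      have "(real j - real i) * h < 0" using ji h by (simp add: mult_less_0_iff)
      moreover have "- ((real j - real i) * h) = real (i - j) * h" using ji by (simp add: of_nat_diff algebra_simps)
      ultimately show ?thesis by (simp add: two_sided_def)
    qed
    ultimately show ?thesis
      unfolding L Z using ji i j sum by (simp add: mult_exp_exp of_nat_diff algebra_simps)
  qed
qed

text \<open>Measured from the true grid point, the posterior mean is the mean of the displacements
  weighted with Zstar.\<close>

lemma bayes_mean_eq_zeta_sum:
  assumes w: "\<omega> \<in> space S" and h: "0 < h" and i: "i \<le> N"
    and k: "\<And>s. s < N \<Longrightarrow> k s = cell_count h i \<omega> s"
  shows "bayes_mean {..N} (\<lambda>j. real j * h) (likelihood h N k) - real i * h =
    zeta_at \<omega> h i (N - i)"
proof -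
  let ?Z = "\<lambda>u. Z_at \<omega> u"
  let ?L = "likelihood h N k"
  have reindex: "(\<Sum>l\<in>{- int i..int (N - i)}. F (of_int l)) = (\<Sum>j\<le>N. F (real j - real i))" for F :: "real \<Rightarrow> real"
    by (rule sum.reindex_bij_witness[of _ "\<lambda>j. int j - int i" "\<lambda>l. nat (l + int i)"]) (use i in auto)
  have tot: "0 < (\<Sum>j\<le>N. ?L j)" by (intro sum_pos likelihood_pos) auto
  have Li: "0 < ?L i" by (rule likelihood_pos)
  have Lj: "?L j = ?L i * ?Z ((real j - real i) * h)" if "j \<le> N" for j
    by (rule likelihood_ratio[OF w h i that k])
  have "bayes_mean {..N} (\<lambda>j. real j * h) ?L - real i * h =
     ((\<Sum>j\<le>N. real j * h * ?L j) - real i * h * (\<Sum>j\<le>N. ?L j)) / (\<Sum>j\<le>N. ?L j)"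
    using tot by (simp add: bayes_mean_def diff_divide_distrib)
  also have "(\<Sum>j\<le>N. real j * h * ?L j) - real i * h * (\<Sum>j\<le>N. ?L j) =
     (\<Sum>j\<le>N. (real j - real i) * h * ?L j)"
    by (simp add: sum_distrib_left sum_subtractf[symmetric] algebra_simps)
  also have "\<dots> = ?L i * (\<Sum>j\<le>N. (real j - real i) * h * ?Z ((real j - real i) * h))"
    unfolding sum_distrib_left by (intro sum.cong refl) (simp add: Lj)
  also have "(\<Sum>j\<le>N. ?L j) = ?L i * (\<Sum>j\<le>N. ?Z ((real j - real i) * h))"
    unfolding sum_distrib_left by (intro sum.cong refl) (simp add: Lj)
  finally show ?thesis
    using Li unfolding zeta_sum_def reindex[of "\<lambda>x. x * h * ?Z (x * h)"] reindex[of "\<lambda>x. ?Z (x * h)"] by simp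
qed

lemma Zstar_measurable:
  "(\<lambda>\<omega>. Z_at \<omega> u) \<in> borel_measurable S"
proof (cases "0 \<le> u")
  case True
  have "(\<lambda>\<omega>. real (Yp u \<omega>)) \<in> borel_measurable S"
    using measurable_compose[OF Y_measurable(1)[OF True], of real borel] by simp
  then show ?thesis using True unfolding Zstar_def by simp
next
  case False
  have "(\<lambda>\<omega>. real (Ym (- u) \<omega>)) \<in> borel_measurable S"
    using measurable_compose[OF Y_measurable(2)[of "- u"], of real borel] False by simp
  then show ?thesis using False unfolding Zstar_def by simp
qed

lemma zeta_sum_measurable:
  "(\<lambda>\<omega>. zeta_at \<omega> h p q) \<in> borel_measurable S"
  unfolding zeta_sum_def
  by (intro borel_measurable_divide borel_measurable_sum borel_measurable_times borel_measurable_const Zstar_measurable)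

abbreviation zeta_risk :: "real \<Rightarrow> nat \<Rightarrow> nat \<Rightarrow> ennreal" where
  "zeta_risk h p q \<equiv> (\<integral>\<^sup>+\<omega>. ennreal ((zeta_at \<omega> h p q)\<^sup>2) \<partial>S)"

lemma cell_count_event:
  assumes "0 < h"
  shows "{\<omega>\<in>space S. \<forall>s<N. cell_count h i \<omega> s = k s} \<in> events"
proof -
  have m: "(\<lambda>\<omega>. cell_count h i \<omega> s) \<in> measurable S (count_space UNIV)" for s
    unfolding cell_count_def using assms
    by (cases "s < i") (auto intro!: measurable_nat_diff Y_measurable simp del: of_nat_Suc)
  have "{\<omega>\<in>space S. \<forall>s\<in>{..<N}. cell_count h i \<omega> s = k s} \<in> events"
    by (intro sets.sets_Collect_finite_All measurable_nat_eq m) auto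
  then show ?thesis by (simp only: ball_simps lessThan_iff Ball_def)
qed

text \<open>The likelihood times the reference weight of k is the probability of the cell counts k under
  the i-th grid point, so the Bayes risk is a sum of expectations in the two Poisson
  processes.\<close>

lemma sum_bayes_risk_eq:
  assumes h: "0 < h" and KK: "finite KK" "KK \<subseteq> PiE {..<N} (\<lambda>_. UNIV)"
  shows "ennreal (\<Sum>k\<in>KK. (\<Prod>s<N. poisson_weight (h * a) (k s)) *
      bayes_risk {..N} (\<lambda>i. real i * h) (likelihood h N k)) =
    (\<Sum>i\<le>N. \<integral>\<^sup>+\<omega>. ennreal ((zeta_at \<omega> h i (N - i))\<^sup>2) *
      indicator {\<omega>. restrict (cell_count h i \<omega>) {..<N} \<in> KK} \<omega> \<partial>S)"
proof -
  let ?u = "\<lambda>i. real i * h"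
  let ?e = "\<lambda>k i. (bayes_mean {..N} ?u (likelihood h N k) - ?u i)\<^sup>2"
  let ?E = "\<lambda>k i. {\<omega>\<in>space S. \<forall>s<N. cell_count h i \<omega> s = k s}"
  let ?w = "\<lambda>k i. \<Prod>s<N. poisson_weight (if s < i then a * h else b * h) (k s)"
  have w: "emeasure S (?E k i) = ennreal (?w k i)" if "i \<le> N" for k i
    unfolding emeasure_eq_measure prob_cell_counts[OF h that] ..
  have w0: "0 \<le> ?w k i" for k i
    using a_pos b_pos h by (intro prod_nonneg poisson_weight_nonneg) auto
  have "(\<Sum>k\<in>KK. (\<Prod>s<N. poisson_weight (h * a) (k s)) * bayes_risk {..N} ?u (likelihood h N k)) =
     (\<Sum>k\<in>KK. \<Sum>i\<le>N. ?w k i * ?e k i)"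
    unfolding bayes_risk_def sum_distrib_left
    by (intro sum.cong refl) (simp add: mult.assoc[symmetric] prod_poisson_weight_likelihood[OF h])
  then have "ennreal (\<Sum>k\<in>KK. (\<Prod>s<N. poisson_weight (h * a) (k s)) * bayes_risk {..N} ?u (likelihood h N k)) =
     (\<Sum>k\<in>KK. \<Sum>i\<le>N. ennreal (?e k i) * ennreal (?w k i))"
    using w0 by (simp add: sum_ennreal[symmetric] sum_nonneg ennreal_mult mult.commute del: sum_ennreal)
  also have "\<dots> = (\<Sum>i\<le>N. \<Sum>k\<in>KK. \<integral>\<^sup>+\<omega>. ennreal (?e k i) * indicator (?E k i) \<omega> \<partial>S)"
    by (subst sum.swap, intro sum.cong refl, subst nn_integral_cmult_indicator)
      (auto simp: w cell_count_event[OF h])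
  also have "\<dots> = (\<Sum>i\<le>N. \<integral>\<^sup>+\<omega>. (\<Sum>k\<in>KK. ennreal (?e k i) * indicator (?E k i) \<omega>) \<partial>S)"
  proof (intro sum.cong refl)
    fix i
    have "(\<lambda>\<omega>. ennreal (?e k i) * indicator (?E k i) \<omega>) \<in> borel_measurable S" for k
      by (intro borel_measurable_times_ennreal borel_measurable_const borel_measurable_indicator
          cell_count_event h)
    then show "(\<Sum>k\<in>KK. \<integral>\<^sup>+\<omega>. ennreal (?e k i) * indicator (?E k i) \<omega> \<partial>S) =
        (\<integral>\<^sup>+\<omega>. (\<Sum>k\<in>KK. ennreal (?e k i) * indicator (?E k i) \<omega>) \<partial>S)"
      by (rule nn_integral_sum[symmetric])
  qed
  also have "\<dots> = (\<Sum>i\<le>N. \<integral>\<^sup>+\<omega>. ennreal ((zeta_at \<omega> h i (N - i))\<^sup>2) *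
      indicator {\<omega>. restrict (cell_count h i \<omega>) {..<N} \<in> KK} \<omega> \<partial>S)"
  proof (intro sum.cong refl nn_integral_cong)
    fix i \<omega> assume "i \<in> {..N}" and w: "\<omega> \<in> space S"
    then have i: "i \<le> N" by simp
    let ?k = "restrict (cell_count h i \<omega>) {..<N}"
    have "(\<Sum>k\<in>KK. ennreal (?e k i) * indicator (?E k i) \<omega>) = (\<Sum>k\<in>KK. if k = ?k then ennreal (?e ?k i) else 0)"
    proof (intro sum.cong refl)
      fix k assume "k \<in> KK"
      then have k: "k \<in> PiE {..<N} (\<lambda>_. UNIV)" using KK by blast
      have "\<omega> \<in> ?E k i \<longleftrightarrow> k = ?k"
      proof
        assume "\<omega> \<in> ?E k i"
        then show "k = ?k" by (intro PiE_ext[OF k]) auto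
      qed (use w in simp)
      then show "ennreal (?e k i) * indicator (?E k i) \<omega> = (if k = ?k then ennreal (?e ?k i) else 0)"
        by (simp add: indicator_def)
    qed
    also have "\<dots> = ennreal (?e ?k i) * indicator {\<omega>. restrict (cell_count h i \<omega>) {..<N} \<in> KK} \<omega>"
      using KK(1) by (simp add: indicator_def)
    also have "?e ?k i = (zeta_at \<omega> h i (N - i))\<^sup>2"
      by (subst bayes_mean_eq_zeta_sum[OF w h i]) auto
    finally show "(\<Sum>k\<in>KK. ennreal (?e k i) * indicator (?E k i) \<omega>) =
        ennreal ((zeta_at \<omega> h i (N - i))\<^sup>2) *
        indicator {\<omega>. restrict (cell_count h i \<omega>) {..<N} \<in> KK} \<omega>" .
  qed
  finally show ?thesis .
qed

lemma sum_zeta_risk_le: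
  assumes h: "0 < h"
    and le: "\<And>KK. finite KK \<Longrightarrow> KK \<subseteq> PiE {..<N} (\<lambda>_. UNIV) \<Longrightarrow>
      ennreal (\<Sum>k\<in>KK. (\<Prod>s<N. poisson_weight (h * a) (k s)) *
        bayes_risk {..N} (\<lambda>i. real i * h) (likelihood h N k)) \<le> c"
  shows "(\<Sum>i\<le>N. zeta_risk h i (N - i)) \<le> c"
proof -
  \<comment> \<open>Finite sets of count vectors that exhaust all of them.\<close>
  define KK where "KK B = PiE {..<N} (\<lambda>_. {..B})" for B :: nat
  let ?z = "\<lambda>i \<omega>. ennreal ((zeta_at \<omega> h i (N - i))\<^sup>2)"
  define f where "f i B \<omega> = ?z i \<omega> * indicator {\<omega>. restrict (cell_count h i \<omega>) {..<N} \<in> KK B} \<omega>" for i B \<omega>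
  have KK_iff: "restrict g {..<N} \<in> KK B \<longleftrightarrow> (\<forall>s<N. g s \<le> B)" for g B
    unfolding KK_def by (auto simp: PiE_iff)
  have inc: "incseq (f i)" for i
    unfolding f_def incseq_def le_fun_def
    by (auto simp: KK_iff indicator_def intro: order_trans)
  have meas: "f i B \<in> borel_measurable S" for i B
  proof -
    have "f i B \<in> borel_measurable S \<longleftrightarrow>
      (\<lambda>\<omega>. ?z i \<omega> * indicator (\<Union>k\<in>KK B. {\<omega>\<in>space S. \<forall>s<N. cell_count h i \<omega> s = k s}) \<omega>) \<in> borel_measurable S"
    proof (rule measurable_cong)
      fix \<omega> assume w: "\<omega> \<in> space S"
      have "restrict (cell_count h i \<omega>) {..<N} \<in> KK B \<longleftrightarrow>
        (\<exists>k\<in>KK B. \<forall>s<N. cell_count h i \<omega> s = k s)"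
      proof
        assume A: "restrict (cell_count h i \<omega>) {..<N} \<in> KK B"
        show "\<exists>k\<in>KK B. \<forall>s<N. cell_count h i \<omega> s = k s" by (rule bexI[OF _ A]) simp
      next
        assume "\<exists>k\<in>KK B. \<forall>s<N. cell_count h i \<omega> s = k s"
        then show "restrict (cell_count h i \<omega>) {..<N} \<in> KK B"
          unfolding KK_iff by (auto simp: KK_def PiE_iff)
      qed
      then show "f i B \<omega> = ?z i \<omega> * indicator (\<Union>k\<in>KK B. {\<omega>\<in>space S. \<forall>s<N. cell_count h i \<omega> s = k s}) \<omega>"
        using w by (simp add: f_def indicator_def)
    qed
    moreover have "(\<Union>k\<in>KK B. {\<omega>\<in>space S. \<forall>s<N. cell_count h i \<omega> s = k s}) \<in> events"
    proof (rule sets.finite_UN)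
      show "finite (KK B)" unfolding KK_def by (rule finite_PiE) simp_all
    qed (rule cell_count_event[OF h])
    then have "(\<lambda>\<omega>. ?z i \<omega> * indicator (\<Union>k\<in>KK B. {\<omega>\<in>space S. \<forall>s<N. cell_count h i \<omega> s = k s}) \<omega>)
        \<in> borel_measurable S"
      by (intro borel_measurable_times_ennreal borel_measurable_indicator measurable_compose[OF _ measurable_ennreal]
          borel_measurable_power zeta_sum_measurable)
    ultimately show ?thesis by (rule iffD2)
  qed
  have sup: "(SUP B. f i B \<omega>) = ?z i \<omega>" for i \<omega>
  proof (rule antisym)
    show "(SUP B. f i B \<omega>) \<le> ?z i \<omega>" by (rule SUP_least) (simp add: f_def indicator_def)
    have "\<forall>s<N. cell_count h i \<omega> s \<le> Max (insert 0 (cell_count h i \<omega> ` {..<N}))" by auto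
    then have "f i (Max (insert 0 (cell_count h i \<omega> ` {..<N}))) \<omega> = ?z i \<omega>"
      unfolding f_def by (simp add: KK_iff)
    then show "?z i \<omega> \<le> (SUP B. f i B \<omega>)" by (metis SUP_upper UNIV_I)
  qed
  have "(\<lambda>B. \<integral>\<^sup>+\<omega>. f i B \<omega> \<partial>S) \<longlonglongrightarrow> zeta_risk h i (N - i)" for i
  proof -
    have "incseq (\<lambda>B. \<integral>\<^sup>+\<omega>. f i B \<omega> \<partial>S)"
      using inc[of i] by (auto simp: incseq_def le_fun_def intro!: nn_integral_mono)
    then have "(\<lambda>B. \<integral>\<^sup>+\<omega>. f i B \<omega> \<partial>S) \<longlonglongrightarrow> (SUP B. \<integral>\<^sup>+\<omega>. f i B \<omega> \<partial>S)" by (rule LIMSEQ_SUP)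
    also have "(SUP B. \<integral>\<^sup>+\<omega>. f i B \<omega> \<partial>S) = zeta_risk h i (N - i)"
      using nn_integral_monotone_convergence_SUP[OF inc meas, of i] unfolding sup by simp
    finally show ?thesis .
  qed
  then have "(\<lambda>B. \<Sum>i\<le>N. \<integral>\<^sup>+\<omega>. f i B \<omega> \<partial>S) \<longlonglongrightarrow> (\<Sum>i\<le>N. zeta_risk h i (N - i))"
    by (intro tendsto_sum)
  then show ?thesis
  proof (rule LIMSEQ_le_const2)
    have "(\<Sum>i\<le>N. \<integral>\<^sup>+\<omega>. f i B \<omega> \<partial>S) \<le> c" for B
    proof -
      have fin: "finite (KK B)" "KK B \<subseteq> PiE {..<N} (\<lambda>_. UNIV)" unfolding KK_def by (auto intro!: finite_PiE)
      show ?thesis using le[OF fin] unfolding sum_bayes_risk_eq[OF h fin] f_def .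
    qed
    then show "\<exists>n0. \<forall>B\<ge>n0. (\<Sum>i\<le>N. \<integral>\<^sup>+\<omega>. f i B \<omega> \<partial>S) \<le> c" by blast
  qed
qed

text \<open>For the mesh 1 / Suc k, both ends of these windows have length at least Suc k. If the bound
  failed infinitely often, choose a window where it fails whenever there is one: the Riemann sums
  still converge along this choice, and Fatou's lemma gives a contradiction.\<close>

lemma zeta_risk_eventually_large:
  assumes c: "c < (\<integral>\<^sup>+\<omega>. ennreal ((zeta a b (\<lambda>u. Yp u \<omega>) (\<lambda>u. Ym u \<omega>))\<^sup>2) \<partial>S)"
  shows "\<forall>\<^sub>F k in sequentially. \<forall>p\<ge>Suc k ^ 2. \<forall>q\<ge>Suc k ^ 2. c < zeta_risk (1 / real (Suc k)) p q"
proof -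
  let ?bad = "\<lambda>k pq. Suc k ^ 2 \<le> fst pq \<and> Suc k ^ 2 \<le> snd pq \<and> \<not> c < zeta_risk (1 / real (Suc k)) (fst pq) (snd pq)"
  \<comment> \<open>A bad window for every k that has one, and the shortest admissible window otherwise.\<close>
  define P where "P k = (if \<exists>pq. ?bad k pq then SOME pq. ?bad k pq else (Suc k ^ 2, Suc k ^ 2))" for k
  have P_bad: "?bad k (P k)" if "\<exists>pq. ?bad k pq" for k
    using someI_ex[OF that] that unfolding P_def by simp
  have P_ge: "Suc k ^ 2 \<le> fst (P k)" "Suc k ^ 2 \<le> snd (P k)" for k
    using P_bad[of k] by (cases "\<exists>pq. ?bad k pq"; simp add: P_def)+
  have large: "filterlim (\<lambda>k. 1 / real (Suc k) * real (x k)) at_top sequentially"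
    if "\<And>k. Suc k ^ 2 \<le> x k" for x :: "nat \<Rightarrow> nat"
  proof (rule filterlim_at_top_mono[OF filterlim_real_sequentially], rule always_eventually, rule allI)
    fix k
    have "real (Suc k) ^ 2 \<le> real (x k)" using that[of k] by (metis of_nat_le_iff of_nat_power)
    then show "real k \<le> 1 / real (Suc k) * real (x k)" by (simp add: field_simps power2_eq_square)
  qed
  have h: "(\<lambda>k. 1 / real (Suc k)) \<longlonglongrightarrow> 0" using LIMSEQ_inverse_real_of_nat by (simp add: inverse_eq_divide)
  have "(\<integral>\<^sup>+\<omega>. ennreal ((zeta a b (\<lambda>u. Yp u \<omega>) (\<lambda>u. Ym u \<omega>))\<^sup>2) \<partial>S) \<le>
     (\<integral>\<^sup>+\<omega>. liminf (\<lambda>k. ennreal ((zeta_at \<omega> (1 / real (Suc k)) (fst (P k)) (snd (P k)))\<^sup>2)) \<partial>S)"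
    by (intro nn_integral_mono zeta_le_liminf[OF a_pos b_pos counting_path_Y] h large P_ge) auto
  also have "\<dots> \<le> liminf (\<lambda>k. zeta_risk (1 / real (Suc k)) (fst (P k)) (snd (P k)))"
    using zeta_sum_measurable by (intro nn_integral_liminf) simp
  finally have "c < liminf (\<lambda>k. zeta_risk (1 / real (Suc k)) (fst (P k)) (snd (P k)))"
    using c by simp
  then obtain y where y: "c < y" "y \<le> liminf (\<lambda>k. zeta_risk (1 / real (Suc k)) (fst (P k)) (snd (P k)))"
    by blast
  have "\<forall>\<^sub>F k in sequentially. c < zeta_risk (1 / real (Suc k)) (fst (P k)) (snd (P k))"
    using y unfolding le_Liminf_iff by blast
  then show ?thesis
  proof eventually_elim
    case (elim k)
    then have good: "\<not> (\<exists>pq. ?bad k pq)" using P_bad[of k] by blast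
    show ?case
    proof (intro allI impI)
      fix p q assume "Suc k ^ 2 \<le> p" "Suc k ^ 2 \<le> q"
      moreover have "\<not> ?bad k (p, q)" using good by blast
      ultimately show "c < zeta_risk (1 / real (Suc k)) p q" unfolding fst_conv snd_conv by blast
    qed
  qed
qed

end

section \<open>The local asymptotic minimax bound\<close>

lemma tendsto_at_right_INF:
  fixes f :: "real \<Rightarrow> 'a::{complete_linorder, linorder_topology}"
  assumes mono: "\<And>x y. 0 < x \<Longrightarrow> x \<le> y \<Longrightarrow> f x \<le> f y"
  shows "(f \<longlongrightarrow> (INF x\<in>{0<..}. f x)) (at_right 0)"
proof (rule order_tendstoI)
  fix a assume a: "a < (INF x\<in>{0<..}. f x)"
  have "a < f x" if "0 < x" for x
    by (rule less_le_trans[OF a]) (rule INF_lower, use that in simp)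
  then show "\<forall>\<^sub>F x in at_right 0. a < f x"
    by (auto intro: eventually_mono[OF eventually_at_right_less])
next
  fix a assume "(INF x\<in>{0<..}. f x) < a"
  then obtain y where y: "0 < y" "f y < a" unfolding INF_less_iff by auto
  then have "f x < a" if "x \<in> {0<..<y}" for x
    using mono[of x y] that by (auto intro: le_less_trans)
  then show "\<forall>\<^sub>F x in at_right 0. f x < a"
    using eventually_at_right_real[OF y(1)] by (auto elim: eventually_mono)
qed

lemma minimax_risk_mono:
  assumes "\<epsilon> \<le> \<epsilon>'"
  shows "minimax_risk \<alpha> \<beta> \<tau> \<theta>0 M X \<epsilon> n \<le> minimax_risk \<alpha> \<beta> \<tau> \<theta>0 M X \<epsilon>' n"
  unfolding minimax_risk_def
  by (intro INF_mono bexI[rotated] SUP_subset_mono order_refl) (use assms in auto)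

text \<open>Discarding K points at both ends of a grid with 2 m + 1 points is negligible for large m.\<close>

lemma limit_average_bound:
  fixes c R :: ennreal
  assumes c: "c < \<top>" and le: "\<And>m. K \<le> m \<Longrightarrow> of_nat (2 * m - 2 * K + 1) * c \<le> of_nat (2 * m + 1) * R"
  shows "c \<le> R"
proof (cases R)
  case (real R')
  obtain c' where c': "0 \<le> c'" "c = ennreal c'" using c by (cases c) auto
  have real_le: "real (2 * m - 2 * K + 1) * c' \<le> real (2 * m + 1) * R'" if "K \<le> m" for m
    using le[OF that] real c' by (simp add: ennreal_of_nat_eq_real_of_nat ennreal_mult'[symmetric] del: of_nat_add of_nat_mult of_nat_Suc)
  have "c' \<le> R'"
  proof (rule ccontr)
    assume "\<not> c' \<le> R'"
    then have pos: "0 < c' - R'" by simp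
    obtain m0 :: nat where m0: "2 * real K * c' < real m0 * (c' - R')"
      using reals_Archimedean3[OF pos] by blast
    define m where "m = max m0 K"
    have m: "K \<le> m" "m0 \<le> m" by (auto simp: m_def)
    have "real (2 * m - 2 * K + 1) = 2 * real m - 2 * real K + 1" using m by (simp add: of_nat_diff)
    moreover have "real (2 * m + 1) = 2 * real m + 1" by simp
    ultimately have "(2 * real m - 2 * real K + 1) * c' \<le> (2 * real m + 1) * R'" using real_le[OF m(1)] by metis
    then have "(2 * real m + 1) * (c' - R') \<le> 2 * real K * c'" by (simp add: algebra_simps)
    moreover have "real m0 * (c' - R') \<le> (2 * real m + 1) * (c' - R')"
      using m pos by (intro mult_right_mono) auto
    ultimately show False using m0 by linarith
  qed
  then show ?thesis using real c' by (simp add: ennreal_leI)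
qed simp

theorem theorem3:
  fixes \<alpha> \<beta> \<tau> r \<theta>0 :: real
    and \<psi> :: "real \<Rightarrow> real"
    and \<delta> :: "nat \<Rightarrow> real"
    and M :: "nat \<Rightarrow> real \<Rightarrow> 'w measure"
    and X :: "nat \<Rightarrow> real \<Rightarrow> nat \<Rightarrow> real \<Rightarrow> 'w \<Rightarrow> nat"
    and S :: "'v measure"
    and Yp Ym :: "real \<Rightarrow> 'v \<Rightarrow> nat"
  assumes "0 < \<alpha>" and "\<alpha> < \<beta>" and "\<beta> < \<tau>"
    and "continuous_on {0..\<tau>} \<psi>" and "\<forall>t\<in>{0..\<tau>}. \<psi> t > 0"
    and "r > - (INF t\<in>{0..\<tau>}. \<psi> t)" and "r \<noteq> 0"
    and "\<forall>n\<ge>1. \<delta> n > 0" and "antimono_on {1..} \<delta>" and "\<delta> \<longlonglongrightarrow> 0"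
    and X_poisson: "\<And>n \<theta> j. n \<ge> 1 \<Longrightarrow> \<theta> \<in> {\<alpha><..<\<beta>} \<Longrightarrow> j \<in> {1..n} \<Longrightarrow>
      poisson_process (M n \<theta>) {0..\<tau>} (intensity \<psi> r \<tau> (\<delta> n) \<theta>) (X n \<theta> j)"
    and X_indep: "\<And>n \<theta>. n \<ge> 1 \<Longrightarrow> \<theta> \<in> {\<alpha><..<\<beta>} \<Longrightarrow>
      prob_space.indep_vars (M n \<theta>) (\<lambda>_. path_space {0..\<tau>})
        (\<lambda>j. path_of {0..\<tau>} (X n \<theta> j)) {1..n}"
    and "\<theta>0 \<in> {\<alpha><..<\<beta>}"
    and Yp_poisson: "poisson_process S {0..} (\<lambda>_. \<psi> \<theta>0 + r) Yp"
    and Ym_poisson: "poisson_process S {0..} (\<lambda>_. \<psi> \<theta>0) Ym"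
    and Y_indep: "prob_space.indep_var S
      (path_space {0..}) (path_of {0..} Yp) (path_space {0..}) (path_of {0..} Ym)"
    and "(\<lambda>n. real n * \<delta> n) \<longlonglongrightarrow> 0"
  shows "\<exists>L :: ennreal.
    ((\<lambda>\<epsilon>. liminf (\<lambda>n. INF f\<in>borel_measurable (sample_space n \<tau>).
        SUP \<theta>\<in>{\<theta>\<in>{\<alpha><..<\<beta>}. \<bar>\<theta> - \<theta>0\<bar> < \<epsilon>}.
          ennreal ((real n)\<^sup>2) *
            (\<integral>\<^sup>+ x. ennreal ((f x - \<theta>)\<^sup>2) \<partial>sample_law n \<tau> (M n \<theta>) (X n \<theta>))))
      \<longlongrightarrow> L) (at_right 0) \<and>
    L \<ge> (\<integral>\<^sup>+ \<omega>. ennreal ((zeta (\<psi> \<theta>0) (\<psi> \<theta>0 + r)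
            (\<lambda>u. Yp u \<omega>) (\<lambda>u. Ym u \<omega>))\<^sup>2) \<partial>S)"
proof -
  note \<theta>0 = \<open>\<theta>0 \<in> {\<alpha><..<\<beta>}\<close>
  interpret model: change_model \<tau> r \<psi>
    by (rule change_model.intro) (use assms(1-6) in auto)
  have d_pos: "0 < \<delta> n" if "1 \<le> n" for n using assms(8) that by blast
  have sample: "poisson_sample (M n \<theta>) n \<tau> (intensity \<psi> r \<tau> (\<delta> n) \<theta>) (X n \<theta>)"
    if n: "1 \<le> n" and \<theta>: "\<theta> \<in> {\<alpha><..<\<beta>}" for n \<theta>
  proof (rule poisson_sample.intro)
    show "prob_space (M n \<theta>)"
      using X_poisson[OF n \<theta>, of 1] n by (simp add: poisson_process_def)
    show "poisson_sample_axioms (M n \<theta>) n \<tau> (intensity \<psi> r \<tau> (\<delta> n) \<theta>) (X n \<theta>)"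
      by (rule poisson_sample_axioms.intro)
        (use n \<theta> model.tau_pos X_poisson X_indep model.mean_intensity_pos[OF d_pos[OF n]] in auto)
  qed
  define a where "a = \<psi> \<theta>0"
  define b where "b = \<psi> \<theta>0 + r"
  have \<theta>0_in: "\<theta>0 \<in> {0..\<tau>}" using \<theta>0 assms(1,3) by auto
  have a: "0 < a" and b: "0 < b"
    using model.psi_bounds \<theta>0_in unfolding a_def b_def by (metis less_le_trans)+
  interpret limit: two_poisson S a b Yp Ym
  proof (rule two_poisson.intro)
    show "prob_space S" using Yp_poisson by (simp add: poisson_process_def)
    show "two_poisson_axioms S a b Yp Ym"
      by (rule two_poisson_axioms.intro)
        (use a b Yp_poisson Ym_poisson Y_indep in \<open>simp_all add: a_def b_def\<close>)
  qed
  let ?R = "\<lambda>\<epsilon>. liminf (minimax_risk \<alpha> \<beta> \<tau> \<theta>0 M X \<epsilon>)"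
  let ?T = "\<integral>\<^sup>+ \<omega>. ennreal ((zeta a b (\<lambda>u. Yp u \<omega>) (\<lambda>u. Ym u \<omega>))\<^sup>2) \<partial>S"
  have sums: "(\<Sum>i\<le>N. limit.zeta_risk h i (N - i)) \<le> of_nat (N + 1) * ?R \<epsilon>"
    if \<epsilon>: "0 < \<epsilon>" and h: "0 < h" for \<epsilon> h N
  proof (rule limit.sum_zeta_risk_le[OF h])
    fix KK :: "(nat \<Rightarrow> nat) set" assume KK: "finite KK" "KK \<subseteq> PiE {..<N} (\<lambda>_. UNIV)"
    show "ennreal (\<Sum>k\<in>KK. (\<Prod>s<N. poisson_weight (h * a) (k s)) *
        bayes_risk {..N} (\<lambda>i. real i * h) (limit.likelihood h N k)) \<le> of_nat (N + 1) * ?R \<epsilon>"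
    proof (rule tendsto_upperbound)
      let ?F = "\<lambda>\<rho>. ennreal (\<Sum>k\<in>KK. (\<Prod>s<N. poisson_weight (h * a) (k s)) *
        bayes_risk {..N} (\<lambda>i. real i * h) (model.limit_likelihood h N \<rho> k))"
      have lik: "limit.likelihood h N k = model.limit_likelihood h N (b / a) k" for k
        unfolding limit.likelihood_def model.limit_likelihood_def by (simp add: fun_eq_iff a_def b_def)
      have pos: "(\<Sum>i\<le>N. model.limit_likelihood h N (b / a) k i) \<noteq> 0" for k
        using sum_pos[of "{..N}" "limit.likelihood h N k"] limit.likelihood_pos unfolding lik[symmetric] by force
      \<comment> \<open>At \<rho> = b / a the weights are the true likelihoods, but only smaller \<rho> are admissible.\<close>
      show "(?F \<longlongrightarrow> ennreal (\<Sum>k\<in>KK. (\<Prod>s<N. poisson_weight (h * a) (k s)) *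
        bayes_risk {..N} (\<lambda>i. real i * h) (limit.likelihood h N k))) (at_left (b / a))"
        unfolding lik
        by (intro tendsto_ennrealI tendsto_sum tendsto_mult tendsto_const tendsto_bayes_risk pos)
          (unfold model.limit_likelihood_def, intro tendsto_intros)
      have "0 < b / a" using a b by simp
      then show "\<forall>\<^sub>F \<rho> in at_left (b / a). ?F \<rho> \<le> of_nat (N + 1) * ?R \<epsilon>"
      proof (rule eventually_mono[OF eventually_at_left_real])
        fix \<rho> assume "\<rho> \<in> {0<..<b / a}"
        then have "0 < \<rho>" "\<rho> * \<psi> \<theta>0 < \<psi> \<theta>0 + r"
          using a by (auto simp: a_def b_def field_simps)
        then show "?F \<rho> \<le> of_nat (N + 1) * ?R \<epsilon>"
          unfolding a_def
          by (intro model.minimax_ge_limit_bayes[OF assms(1,3) \<theta>0 d_pos assms(17) sample h \<epsilon> _ _ KK])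
      qed
    qed (rule trivial_limit_at_left_real)
  qed
  have bound: "?T \<le> ?R \<epsilon>" if \<epsilon>: "0 < \<epsilon>" for \<epsilon>
  proof (rule dense_le)
    fix c assume c: "c < ?T"
    then obtain k where k: "\<And>p q. Suc k ^ 2 \<le> p \<Longrightarrow> Suc k ^ 2 \<le> q \<Longrightarrow> c < limit.zeta_risk (1 / real (Suc k)) p q"
      using limit.zeta_risk_eventually_large[OF c] unfolding eventually_sequentially by blast
    let ?K = "Suc k ^ 2" and ?h = "1 / real (Suc k)"
    \<comment> \<open>On the grid with N = 2 m, the points from ?K to 2 m - ?K have long windows on both sides.\<close>
    show "c \<le> ?R \<epsilon>"
    proof (rule limit_average_bound[where K = ?K])
      show "c < \<top>" using c by (rule less_le_trans) simp
      fix m assume m: "?K \<le> m"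
      have "of_nat (2 * m - 2 * ?K + 1) * c = (\<Sum>i\<in>{?K..2 * m - ?K}. c)"
      proof -
        have "card {?K..2 * m - ?K} = 2 * m - 2 * ?K + 1" using m unfolding card_atLeastAtMost by linarith
        then show ?thesis unfolding sum_constant by metis
      qed
      also have "\<dots> \<le> (\<Sum>i\<in>{?K..2 * m - ?K}. limit.zeta_risk ?h i (2 * m - i))"
        using m by (intro sum_mono less_imp_le[OF k]) auto
      also have "\<dots> \<le> (\<Sum>i\<le>2 * m. limit.zeta_risk ?h i (2 * m - i))"
        by (intro sum_mono2) auto
      also have "\<dots> \<le> of_nat (2 * m + 1) * ?R \<epsilon>" by (rule sums[OF \<epsilon>]) simp
      finally show "of_nat (2 * m - 2 * ?K + 1) * c \<le> of_nat (2 * m + 1) * ?R \<epsilon>" .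
    qed
  qed
  have "((\<lambda>\<epsilon>. ?R \<epsilon>) \<longlongrightarrow> (INF \<epsilon>\<in>{0<..}. ?R \<epsilon>)) (at_right 0)"
    by (rule tendsto_at_right_INF) (auto intro!: Liminf_mono always_eventually minimax_risk_mono)
  moreover have "?T \<le> (INF \<epsilon>\<in>{0<..}. ?R \<epsilon>)" by (rule INF_greatest) (use bound in simp)
  ultimately show ?thesis
    unfolding minimax_risk_def a_def b_def by blast
qed

end
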